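(* There exists a polynomial-time $5$-approximation algorithm for the $(L,U,\text{soft-}\emptyset,p)$-Supplier problem.
   Context: An instance of $(L,U,\text{soft-}\emptyset,p)$-Supplier consists of an integer $p\ge0$, a finite client set $\mathcal{C}$, a finite facility set $\mathcal{F}$, a symmetric distance function $d:(\mathcal{C}\cup\mathcal{F})^2\to\mathbb{R}_{\ge0}$ satisfying the triangle inequality, and integers $0\le L\le U$ (uniform capacity lower and upper bounds). A feasible solution consists of a client set $C\subseteq\mathcal{C}$ with $|C|\ge p$, a multiset $F=\{u_1,\dots,u_m\}$ of facilities of arbitrary size $m$ (the same facility may be opened several times, each copy being a separate center), and an assignment $\phi$ of each client of $C$ to one of the open copies such that each open copy is assigned between $L$ and $U$ clients; its value is $\max_{v\in C}d(v,\phi(v))$, to be minimized. A $\rho$-approximation algorithm outputs, on every instance having a feasible solution, a feasible solution of value at most $\rho$ times the optimum. *)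

theory Defs
  imports Complex_Main "HOL-Computational_Algebra.Polynomial"
begin

section \<open>The supplier problem\<close>

record 'a supplier =
  clients :: "'a set"
  facilities :: "'a set"
  distance :: "'a \<Rightarrow> 'a \<Rightarrow> real"
  lower :: nat
  upper :: nat
  target :: nat

abbreviation points :: "'a supplier \<Rightarrow> 'a set" where
  "points I \<equiv> clients I \<union> facilities I"

text \<open>Clients and facilities may overlap. The distance only matters on \<open>points I\<close>.\<close>

definition supplier_instance :: "'a supplier \<Rightarrow> bool" where
  "supplier_instance I \<longleftrightarrow>
     finite (clients I) \<and> finite (facilities I) \<and>
     (\<forall>x\<in>points I. \<forall>y\<in>points I. 0 \<le> distance I x y) \<and>
     (\<forall>x\<in>points I. \<forall>y\<in>points I. distance I x y = distance I y x) \<and>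
     (\<forall>x\<in>points I. \<forall>y\<in>points I. \<forall>z\<in>points I.
        distance I x z \<le> distance I x y + distance I y z) \<and>
     lower I \<le> upper I"

text \<open>The multiset of opened facilities is given as a list \<open>centers\<close>, possibly with
  repetitions, so that the copies can be told apart by their positions; \<open>assign v\<close> is the
  position of the copy that serves \<open>v\<close>.\<close>

record 'a solution =
  served :: "'a set"
  centers :: "'a list"
  assign :: "'a \<Rightarrow> nat"

definition feasible :: "'a supplier \<Rightarrow> 'a solution \<Rightarrow> bool" where
  "feasible I S \<longleftrightarrow>
     served S \<subseteq> clients I \<and> target I \<le> card (served S) \<and>
     set (centers S) \<subseteq> facilities I \<and>
     (\<forall>v\<in>served S. assign S v < length (centers S)) \<and>
     (\<forall>i<length (centers S).
        lower I \<le> card {v \<in> served S. assign S v = i} \<and>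
        card {v \<in> served S. assign S v = i} \<le> upper I)"

text \<open>The maximum over no clients is taken to be 0.\<close>

definition cost :: "'a supplier \<Rightarrow> 'a solution \<Rightarrow> real" where
  "cost I S =
     (if served S = {} then 0
      else Max ((\<lambda>v. distance I v (centers S ! assign S v)) ` served S))"

definition optimum :: "'a supplier \<Rightarrow> real" where
  "optimum I = (INF S\<in>{S. feasible I S}. cost I S)"

lemma optimum_attained:
  assumes I: "supplier_instance I" and ex: "\<exists>S. feasible I S"
  obtains S where "feasible I S" "cost I S = optimum I" "\<And>S'. feasible I S' \<Longrightarrow> optimum I \<le> cost I S'"
proof -
  let ?A = "cost I ` {S. feasible I S}"
  let ?B = "insert 0 ((\<lambda>(v, u). distance I v u) ` (clients I \<times> facilities I))"
  have "cost I S \<in> ?B" if S: "feasible I S" for S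
  proof (cases "served S = {}")
    case False
    let ?D = "(\<lambda>v. distance I v (centers S ! assign S v)) ` served S"
    have "finite (served S)"
      using S I unfolding feasible_def supplier_instance_def by (meson finite_subset)
    with False have "Max ?D \<in> ?D"
      by (intro Max_in) auto
    moreover have "?D \<subseteq> ?B"
    proof
      fix x assume "x \<in> ?D"
      then obtain v where v: "v \<in> served S" and x: "x = distance I v (centers S ! assign S v)" by blast
      have "v \<in> clients I" "centers S ! assign S v \<in> facilities I"
        using S v nth_mem[of "assign S v" "centers S"] unfolding feasible_def by blast+
      then show "x \<in> ?B" unfolding x by (intro insertI2 image_eqI[where x = "(v, centers S ! assign S v)"]) simp_all
    qed
    ultimately show ?thesis
      using False unfolding cost_def by (simp only: if_False subsetD)
  qed (simp add: cost_def)
  then have "?A \<subseteq> ?B" by blast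
  moreover have "finite ?B"
    using I by (simp add: supplier_instance_def)
  ultimately have fin: "finite ?A" by (rule finite_subset)
  have ne: "?A \<noteq> {}" using ex by blast
  have eq: "optimum I = Min ?A"
    unfolding optimum_def using fin ne by (rule cInf_eq_Min)
  have "Min ?A \<in> ?A" using fin ne by (rule Min_in)
  then obtain S where "feasible I S" "cost I S = optimum I" using eq by (metis (mono_tags, lifting) imageE mem_Collect_eq)
  moreover have "optimum I \<le> cost I S'" if "feasible I S'" for S'
    using eq fin that by simp
  ultimately show ?thesis using that by blast
qed


section \<open>Real random access machines\<close>

text \<open>While programs over an integer memory and a real memory, each divided into arrays.
  Array names are constants of the program, array indices are computed. Integers have addition
  and truncated subtraction, reals have addition and subtraction, and both can be compared; there
  is no conversion from reals to integers. Multiplication is omitted on purpose: after \<open>t\<close>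
  steps on rational data all numbers have bit length polynomial in \<open>t\<close> and the input
  length, so that counting every operation as one step agrees with Turing machine time up to a
  polynomial.\<close>

datatype iexp =
    IConst nat
  | IGet nat iexp
  | IAdd iexp iexp
  | ISub iexp iexp

datatype rexp =
    RConst nat
  | RGet nat iexp
  | RAdd rexp rexp
  | RSub rexp rexp

datatype bexp =
    ILess iexp iexp
  | RLess rexp rexp
  | BNot bexp
  | BAnd bexp bexp

datatype com =
    Skip
  | ISet nat iexp iexp
  | RSet nat iexp rexp
  | Seq com com
  | Cond bexp com com
  | While bexp com

record state =
  imem :: "nat \<Rightarrow> nat \<Rightarrow> nat"
  rmem :: "nat \<Rightarrow> nat \<Rightarrow> real"

primrec ival :: "iexp \<Rightarrow> state \<Rightarrow> nat" where
  "ival (IConst k) s = k"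
| "ival (IGet a e) s = imem s a (ival e s)"
| "ival (IAdd e f) s = ival e s + ival f s"
| "ival (ISub e f) s = ival e s - ival f s"

primrec rval :: "rexp \<Rightarrow> state \<Rightarrow> real" where
  "rval (RConst k) s = real k"
| "rval (RGet a e) s = rmem s a (ival e s)"
| "rval (RAdd e f) s = rval e s + rval f s"
| "rval (RSub e f) s = rval e s - rval f s"

primrec bval :: "bexp \<Rightarrow> state \<Rightarrow> bool" where
  "bval (ILess e f) s \<longleftrightarrow> ival e s < ival f s"
| "bval (RLess e f) s \<longleftrightarrow> rval e s < rval f s"
| "bval (BNot b) s \<longleftrightarrow> \<not> bval b s"
| "bval (BAnd b c) s \<longleftrightarrow> bval b s \<and> bval c s"

definition iset :: "nat \<Rightarrow> nat \<Rightarrow> nat \<Rightarrow> state \<Rightarrow> state" where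
  "iset a i x s = s\<lparr>imem := (imem s)(a := (imem s a)(i := x))\<rparr>"

definition rset :: "nat \<Rightarrow> nat \<Rightarrow> real \<Rightarrow> state \<Rightarrow> state" where
  "rset a i x s = s\<lparr>rmem := (rmem s)(a := (rmem s a)(i := x))\<rparr>"

text \<open>\<open>exec c s t s'\<close>: program \<open>c\<close> started in \<open>s\<close> halts in \<open>s'\<close> after
  \<open>t\<close> steps. The expressions occurring in a program have bounded size, so counting one step
  for evaluating an expression only affects the time by a constant factor.\<close>

inductive exec :: "com \<Rightarrow> state \<Rightarrow> nat \<Rightarrow> state \<Rightarrow> bool" where
  Skip: "exec Skip s 1 s"
| ISet: "exec (ISet a e f) s 1 (iset a (ival e s) (ival f s) s)"
| RSet: "exec (RSet a e f) s 1 (rset a (ival e s) (rval f s) s)"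
| Seq: "exec c1 s1 t1 s2 \<Longrightarrow> exec c2 s2 t2 s3 \<Longrightarrow> exec (Seq c1 c2) s1 (t1 + t2) s3"
| CondTrue: "bval b s \<Longrightarrow> exec c1 s t s' \<Longrightarrow> exec (Cond b c1 c2) s (1 + t) s'"
| CondFalse: "\<not> bval b s \<Longrightarrow> exec c2 s t s' \<Longrightarrow> exec (Cond b c1 c2) s (1 + t) s'"
| WhileFalse: "\<not> bval b s \<Longrightarrow> exec (While b c) s 1 s"
| WhileTrue: "bval b s1 \<Longrightarrow> exec c s1 t1 s2 \<Longrightarrow> exec (While b c) s2 t2 s3 \<Longrightarrow>
    exec (While b c) s1 (1 + t1 + t2) s3"

inductive_cases SkipE: "exec Skip s t s'"
inductive_cases ISetE: "exec (ISet a e f) s t s'"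
inductive_cases RSetE: "exec (RSet a e f) s t s'"
inductive_cases SeqE: "exec (Seq c1 c2) s t s'"
inductive_cases CondE: "exec (Cond b c1 c2) s t s'"
inductive_cases WhileE: "exec (While b c) s t s'"

lemma exec_deterministic:
  "exec c s t s' \<Longrightarrow> exec c s u s'' \<Longrightarrow> u = t \<and> s'' = s'"
proof (induction arbitrary: u s'' rule: exec.induct)
  case (Skip s)
  then show ?case by (rule SkipE) simp
next
  case (ISet a e f s)
  then show ?case by (rule ISetE) simp
next
  case (RSet a e f s)
  then show ?case by (rule RSetE) simp
next
  case (Seq c1 s1 t1 s2 c2 t2 s3)
  from Seq.prems show ?case
  proof (rule SeqE)
    fix u1 r u2
    assume u: "u = u1 + u2" and 1: "exec c1 s1 u1 r" and 2: "exec c2 r u2 s''"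
    from Seq.IH(1)[OF 1] have t1: "u1 = t1" and r: "r = s2" by simp_all
    from Seq.IH(2)[OF 2[unfolded r]] t1 u show ?thesis by simp
  qed
next
  case (CondTrue b s c1 t s' c2)
  from CondTrue.prems show ?case
  proof (rule CondE)
    fix v
    assume u: "u = Suc v" and v: "exec c1 s v s''"
    from CondTrue.IH[OF v] u show ?thesis by simp
  next
    assume "\<not> bval b s"
    with CondTrue.hyps(1) show ?thesis by contradiction
  qed
next
  case (CondFalse b s c2 t s' c1)
  from CondFalse.prems show ?case
  proof (rule CondE)
    assume "bval b s"
    with CondFalse.hyps(1) show ?thesis by contradiction
  next
    fix v
    assume u: "u = Suc v" and v: "exec c2 s v s''"
    from CondFalse.IH[OF v] u show ?thesis by simp
  qed
next
  case (WhileFalse b s c)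
  from WhileFalse.prems show ?case by (rule WhileE) (use WhileFalse.hyps in simp_all)
next
  case (WhileTrue b s1 c t1 s2 t2 s3)
  from WhileTrue.prems show ?case
  proof (rule WhileE)
    assume "\<not> bval b s1"
    with WhileTrue.hyps(1) show ?thesis by simp
  next
    fix u1 r u2
    assume u: "u = Suc (u1 + u2)" and 1: "exec c s1 u1 r" and 2: "exec (While b c) r u2 s''"
    from WhileTrue.IH(1)[OF 1] have t1: "u1 = t1" and r: "r = s2" by simp_all
    from WhileTrue.IH(2)[OF 2[unfolded r]] t1 u show ?thesis by simp
  qed
qed


section \<open>Polynomial-time approximation algorithms\<close>

text \<open>To be handed to a program, the \<open>n\<close> points of an instance are numbered
  \<open>0, \<dots>, n - 1\<close>.\<close>

definition numbered_instance :: "nat supplier \<Rightarrow> bool" where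
  "numbered_instance I \<longleftrightarrow> supplier_instance I \<and> points I = {..<card (points I)}"

text \<open>Integer array 0 holds \<open>n\<close>, \<open>L\<close>, \<open>U\<close>, \<open>p\<close>; arrays 1 and 2 mark the clients
  and the facilities; real array 0 holds the distance matrix row by row. All other cells are 0.\<close>

definition initial_state :: "nat supplier \<Rightarrow> state" where
  "initial_state I =
     (let n = card (points I); header = [n, lower I, upper I, target I] in
      \<lparr>imem = (\<lambda>a i.
          if a = 0 \<and> i < length header then header ! i
          else if a = 1 \<and> i \<in> clients I then 1
          else if a = 2 \<and> i \<in> facilities I then 1
          else 0),
       rmem = (\<lambda>a i.
          if a = 0 \<and> i < n * n then distance I (i div n) (i mod n) else 0)\<rparr>)"

definition input_size :: "nat supplier \<Rightarrow> nat" where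
  "input_size I = (let n = card (points I) in 4 + 2 * n + n * n)"

text \<open>Cell 0 of integer array 3 holds the number of opened copies, array 4 their locations, and
  cell \<open>v\<close> of array 5 is 0 if point \<open>v\<close> is not served and \<open>j + 1\<close> if it is assigned to
  copy \<open>j\<close>.\<close>

definition solution_of :: "nat supplier \<Rightarrow> state \<Rightarrow> nat solution" where
  "solution_of I s =
     \<lparr>served = {v. v < card (points I) \<and> imem s 5 v \<noteq> 0},
      centers = map (imem s 4) [0..<imem s 3 0],
      assign = (\<lambda>v. imem s 5 v - 1)\<rparr>"

text \<open>The time bound also covers the instances without a feasible solution, on which the output
  is arbitrary.\<close>

definition polynomial_time :: "com \<Rightarrow> bool" where
  "polynomial_time c \<longleftrightarrow>
     (\<exists>q :: nat poly. \<forall>I. numbered_instance I \<longrightarrow>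
        (\<exists>t s. exec c (initial_state I) t s \<and> t \<le> poly q (input_size I)))"

definition approximation_algorithm :: "real \<Rightarrow> com \<Rightarrow> bool" where
  "approximation_algorithm \<rho> c \<longleftrightarrow>
     (\<forall>I. numbered_instance I \<and> (\<exists>S. feasible I S) \<longrightarrow>
        (\<exists>t s. exec c (initial_state I) t s \<and> feasible I (solution_of I s) \<and>
           cost I (solution_of I s) \<le> \<rho> * optimum I))"

end

theory Submission
  imports Defs
begin

text \<open>Fix a threshold \<open>r\<close> and let \<open>L\<close> be the larger of 1 and the lower bound. Only facilities whose
  \<open>r\<close>-ball contains at least \<open>L\<close> clients matter. As in the Khuller--Sussmann algorithm for capacitated
  \<open>k\<close>-center, a forest of such facilities with disjoint balls (the \<^emph>\<open>home\<close> clients) is grown so that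
  each non-root is within \<open>4 r\<close> of its parent and every other client of a relevant ball is within
  \<open>3 r\<close> of some node. All clusters of a solution of value at most \<open>r\<close> stay within one tree, so a tree with \<open>N\<close>
  clients contributes at most \<open>min N ((N div L) * U)\<close> served clients. This number is attained: bottom up,
  a node keeps a multiple of \<open>L\<close> and sends the remainder to its parent, while the overall remainder
  \<open>N mod L\<close> is granted in advance to nodes with spare capacity and cancelled against the upward flow.
  Fewer than \<open>L\<close> clients leave any node, so home clients suffice, and they travel at most
  \<open>r + 4 r = 5 r\<close>. Running this for all distances \<open>r\<close> and keeping the best success gives the factor 5.\<close>

section \<open>Bounded programs and their weakest preconditions\<close>

text \<open>The constants come from short paths. A client attached to a node only because a relevant
  ball around it meets the home ball of that node is within \<open>r + r + r\<close>; a new facility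
  whose ball contains an attached client is within \<open>r + 3 r\<close> of that client's node.
  Moving a client at distance \<open>3 r\<close> over such an edge could cost \<open>7 r\<close>,
  hence only home clients move, and only over one edge. The second obstacle is the upper bound:
  pushing all remainders to the root could overload it while nodes deep in the tree still have room.
  Sending the surplus back down would take several hops, so the remainder of the whole tree is
  computed beforehand, each node takes up to \<open>m * (U - L)\<close> of it when it is processed,
  and an edge carries only the net amount. The machine neither multiplies nor divides, so every
  product and residue is maintained as a counter. Total correctness is split: halting and time
  follow from the loop syntax alone, and all reasoning about results is partial correctness.\<close>

primrec writes :: "com \<Rightarrow> nat set" where
  "writes Skip = {}"
| "writes (ISet a e f) = {a}"
| "writes (RSet a e f) = {}"
| "writes (Seq c d) = writes c \<union> writes d"
| "writes (Cond b c d) = writes c \<union> writes d"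
| "writes (While b c) = writes c"

primrec real_writes :: "com \<Rightarrow> nat set" where
  "real_writes Skip = {}"
| "real_writes (ISet a e f) = {}"
| "real_writes (RSet a e f) = {a}"
| "real_writes (Seq c d) = real_writes c \<union> real_writes d"
| "real_writes (Cond b c d) = real_writes c \<union> real_writes d"
| "real_writes (While b c) = real_writes c"

text \<open>Both sets are computed from the syntax, so every execution satisfies the frame
  condition, and specifications need only mention the cells that change.\<close>

definition frame :: "com \<Rightarrow> state \<Rightarrow> state \<Rightarrow> bool" where
  "frame c s s' \<longleftrightarrow> (\<forall>a. a \<notin> writes c \<longrightarrow> imem s' a = imem s a) \<and>
     (\<forall>a. a \<notin> real_writes c \<longrightarrow> rmem s' a = rmem s a)"

lemma imem_iset [simp]:
  "imem (iset a i x s) = (imem s)(a := (imem s a)(i := x))"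
  "rmem (iset a i x s) = rmem s"
  "rmem (rset a i y s) = (rmem s)(a := (rmem s a)(i := y))"
  "imem (rset a i y s) = imem s"
  by (simp_all add: iset_def rset_def)

lemma iset_iset [simp]: "iset a i x (iset a i y s) = iset a i x s"
  by (simp add: iset_def)

lemma exec_frame: "exec c s t s' \<Longrightarrow> frame c s s'"
  by (induction rule: exec.induct) (auto simp: frame_def)

text \<open>All loops run to \<open>n\<close>, so that polynomial time becomes a syntactic property.\<close>

definition For :: "nat \<Rightarrow> com \<Rightarrow> com" where
  "For a c = Seq (ISet a (IConst 0) (IConst 0))
     (While (ILess (IGet a (IConst 0)) (IGet 0 (IConst 0)))
        (Seq c (ISet a (IConst 0) (IAdd (IGet a (IConst 0)) (IConst 1)))))"

lemma writes_For [simp]: "writes (For a c) = insert a (writes c)"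
  "real_writes (For a c) = real_writes c"
  by (auto simp: For_def)

text \<open>Array 0, whose first cell bounds every loop, is never assigned, and no loop body assigns
  its own counter; so each loop makes exactly \<open>n\<close> rounds. A bare \<open>While\<close>
  is excluded.\<close>

inductive tame :: "com \<Rightarrow> bool" where
  "tame Skip"
| "a \<noteq> 0 \<Longrightarrow> tame (ISet a e f)"
| "tame (RSet a e' f')"
| "tame c \<Longrightarrow> tame d \<Longrightarrow> tame (Seq c d)"
| "tame c \<Longrightarrow> tame d \<Longrightarrow> tame (Cond b c d)"
| "tame c \<Longrightarrow> a \<noteq> 0 \<Longrightarrow> a \<notin> writes c \<Longrightarrow> tame (For a c)"

lemma tame_writes: "tame c \<Longrightarrow> 0 \<notin> writes c"
  by (induction rule: tame.induct) auto

text \<open>The bound depends on the cell \<open>imem s 0 0\<close> alone. Since that cell is never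
  written, the bounds of subprograms refer to the same number in all later states and can be added
  and multiplied.\<close>

lemma tame_time:
  assumes "tame c"
  shows "\<exists>q :: nat poly. \<forall>s. \<exists>t s'. exec c s t s' \<and> t \<le> poly q (imem s 0 0)"
  using assms
proof (induction rule: tame.induct)
  case 1
  show ?case by (rule exI[of _ 1]) (simp, metis One_nat_def le_refl exec.Skip exec.ISet exec.RSet)
next
  case (2 a e f)
  show ?case by (rule exI[of _ 1]) (simp, metis One_nat_def le_refl exec.Skip exec.ISet exec.RSet)
next
  case (3 a e f)
  show ?case by (rule exI[of _ 1]) (simp, metis One_nat_def le_refl exec.Skip exec.ISet exec.RSet)
next
  case (4 c d)
  then obtain p q :: "nat poly" where
    p: "\<And>s. \<exists>t s'. exec c s t s' \<and> t \<le> poly p (imem s 0 0)" and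
    q: "\<And>s. \<exists>t s'. exec d s t s' \<and> t \<le> poly q (imem s 0 0)" by blast
  have "\<exists>t s'. exec (Seq c d) s t s' \<and> t \<le> poly (p + q) (imem s 0 0)" for s
  proof -
    obtain t s' where 1: "exec c s t s'" "t \<le> poly p (imem s 0 0)" using p by blast
    obtain u s'' where 2: "exec d s' u s''" "u \<le> poly q (imem s' 0 0)" using q by blast
    have "imem s' 0 0 = imem s 0 0"
      using exec_frame[OF 1(1)] tame_writes[OF 4(1)] by (simp add: frame_def)
    then show ?thesis using 1 2 exec.Seq[OF 1(1) 2(1)] by (metis add_mono poly_add)
  qed
  then show ?case by blast
next
  case (5 c d b)
  then obtain p q :: "nat poly" where
    p: "\<And>s. \<exists>t s'. exec c s t s' \<and> t \<le> poly p (imem s 0 0)" and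
    q: "\<And>s. \<exists>t s'. exec d s t s' \<and> t \<le> poly q (imem s 0 0)" by blast
  have "\<exists>t s'. exec (Cond b c d) s t s' \<and> t \<le> poly (1 + p + q) (imem s 0 0)" for s
  proof (cases "bval b s")
    case True
    obtain t s' where 1: "exec c s t s'" "t \<le> poly p (imem s 0 0)" using p by blast
    show ?thesis
      by (intro exI conjI, rule exec.CondTrue[OF True 1(1)]) (use 1(2) in simp)
  next
    case False
    obtain t s' where 1: "exec d s t s'" "t \<le> poly q (imem s 0 0)" using q by blast
    show ?thesis
      by (intro exI conjI, rule exec.CondFalse[OF False 1(1)]) (use 1(2) in simp)
  qed
  then show ?case by blast
next
  case (6 c a)
  then obtain p :: "nat poly" where
    p: "\<And>s. \<exists>t s'. exec c s t s' \<and> t \<le> poly p (imem s 0 0)" by blast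
  let ?b = "ILess (IGet a (IConst 0)) (IGet 0 (IConst 0))"
  let ?i = "ISet a (IConst 0) (IAdd (IGet a (IConst 0)) (IConst 1))"
  \<comment> \<open>Induction on the number of rounds left; a round costs the test, the body and the
    increment, which explains \<open>2 + poly p\<close>.\<close>
  have loop: "\<exists>t s'. exec (While ?b (Seq c ?i)) s t s' \<and> t \<le> 1 + k * (2 + poly p (imem s 0 0))"
    if "k = imem s 0 0 - imem s a 0" for k s
    using that
  proof (induction k arbitrary: s)
    case 0
    then have "exec (While ?b (Seq c ?i)) s 1 s" by (intro exec.WhileFalse) simp
    then show ?case by auto
  next
    case (Suc k)
    obtain t s1 where 1: "exec c s t s1" "t \<le> poly p (imem s 0 0)" using p by blast
    have fr: "imem s1 0 = imem s 0" "imem s1 a = imem s a"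
      using exec_frame[OF 1(1)] tame_writes[OF 6(1)] 6(3) by (simp_all add: frame_def)
    let ?s2 = "iset a (ival (IConst 0) s1) (ival (IAdd (IGet a (IConst 0)) (IConst 1)) s1) s1"
    have 2: "exec (Seq c ?i) s (t + 1) ?s2"
      using 1(1) exec.ISet by (rule exec.Seq)
    have z: "imem ?s2 0 0 = imem s 0 0" "imem ?s2 a 0 = Suc (imem s a 0)"
      using fr 6(2) by auto
    have "k = imem ?s2 0 0 - imem ?s2 a 0" using Suc.prems z by auto
    from Suc.IH[OF this] z(1) obtain u s3 where
      3: "exec (While ?b (Seq c ?i)) ?s2 u s3" "u \<le> 1 + k * (2 + poly p (imem s 0 0))" by auto
    have b: "bval ?b s" using Suc.prems by simp
    show ?case
      by (intro exI conjI, rule exec.WhileTrue[OF b 2 3(1)]) (use 1(2) 3(2) in simp)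
  qed
  have "\<exists>t s'. exec (For a c) s t s' \<and> t \<le> poly (2 + [:0, 1:] * (2 + p)) (imem s 0 0)" for s
  proof -
    let ?s = "iset a (ival (IConst 0) s) (ival (IConst 0) s) s"
    have z: "imem s 0 0 = imem ?s 0 0 - imem ?s a 0" "imem ?s 0 0 = imem s 0 0" using 6(2) by auto
    from loop[OF z(1)] z(2) obtain t s' where
      1: "exec (While ?b (Seq c ?i)) ?s t s'" "t \<le> 1 + imem s 0 0 * (2 + poly p (imem s 0 0))"
      by auto
    show ?thesis
      unfolding For_def
      by (intro exI conjI, rule exec.Seq[OF exec.ISet 1(1)]) (use 1(2) in simp)
  qed
  then show ?case by blast
qed

text \<open>Natural coefficients make a polynomial monotone, so a bound in \<open>n\<close> carries
  over to the larger \<open>input_size\<close>.\<close>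

lemma poly_nat_mono:
  fixes q :: "nat poly"
  assumes "m \<le> n"
  shows "poly q m \<le> poly q n"
  using assms by (induction q) (auto intro!: add_mono mult_mono)

lemma tame_polynomial_time:
  assumes "tame c"
  shows "polynomial_time c"
proof -
  obtain q :: "nat poly" where
    q: "\<And>s. \<exists>t s'. exec c s t s' \<and> t \<le> poly q (imem s 0 0)"
    using tame_time[OF assms] by blast
  have "\<exists>t s. exec c (initial_state I) t s \<and> t \<le> poly q (input_size I)" for I
  proof -
    have "imem (initial_state I) 0 0 \<le> input_size I"
      by (simp add: initial_state_def input_size_def Let_def)
    then show ?thesis using q[of "initial_state I"] poly_nat_mono le_trans by blast
  qed
  then show ?thesis unfolding polynomial_time_def by blast
qed

text \<open>The liberal version: nothing is claimed about halting, which \<open>tame_time\<close>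
  supplies for every start state.\<close>

definition wlp :: "com \<Rightarrow> (state \<Rightarrow> bool) \<Rightarrow> state \<Rightarrow> bool" where
  "wlp c Q s \<longleftrightarrow> (\<forall>t s'. exec c s t s' \<longrightarrow> Q s')"

lemma wlp_simps [simp]:
  "wlp (ISet a e f) Q s \<longleftrightarrow> Q (iset a (ival e s) (ival f s) s)"
  "wlp (RSet a e f') Q s \<longleftrightarrow> Q (rset a (ival e s) (rval f' s) s)"
  "wlp (Cond b c d) Q s \<longleftrightarrow> (if bval b s then wlp c Q s else wlp d Q s)"
  unfolding wlp_def
  by (auto intro: exec.intros elim!: SkipE ISetE RSetE CondE; 
      metis exec.CondTrue exec.CondFalse exec.ISet exec.RSet exec.Skip)+

lemma wlp_Skip [simp]: "wlp Skip Q = Q"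
  by (rule ext) (auto simp: wlp_def intro: exec.Skip elim: SkipE)

lemma wlp_Seq [simp]: "wlp (Seq c d) Q = wlp c (wlp d Q)"
  unfolding wlp_def by (blast intro: exec.Seq elim: SeqE)

text \<open>Consequence rule that also hands over the frame condition: facts about arrays that
  \<open>c\<close> does not write survive without appearing in \<open>Q\<close>.\<close>

lemma wlp_frame:
  assumes "wlp c Q s" "\<And>s'. Q s' \<Longrightarrow> frame c s s' \<Longrightarrow> Q' s'"
  shows "wlp c Q' s"
  using assms exec_frame unfolding wlp_def by blast

text \<open>\<open>J i\<close> describes the state whose counter already has the value
  \<open>i\<close>, which is why \<open>init\<close> and \<open>step\<close> apply it to
  \<open>iset\<close> states. The frame hypotheses keep unwritten arrays out of the
  invariants.\<close>

lemma wlp_For: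
  assumes "a \<noteq> 0" "a \<notin> writes c" "0 \<notin> writes c"
    and init: "J 0 (iset a 0 0 s0)"
    and step: "\<And>i s. i < imem s0 0 0 \<Longrightarrow> J i s \<Longrightarrow> imem s a 0 = i \<Longrightarrow> frame (For a c) s0 s \<Longrightarrow>
      wlp c (\<lambda>s'. J (Suc i) (iset a 0 (Suc i) s')) s"
    and post: "\<And>s. J (imem s0 0 0) s \<Longrightarrow> frame (For a c) s0 s \<Longrightarrow> Q s"
  shows "wlp (For a c) Q s0"
proof -
  let ?n = "imem s0 0 0"
  let ?b = "ILess (IGet a (IConst 0)) (IGet 0 (IConst 0))"
  let ?d = "Seq c (ISet a (IConst 0) (IAdd (IGet a (IConst 0)) (IConst 1)))"
  have loop: "J ?n s'" if "exec (While ?b ?d) s t s'" "J (imem s a 0) s" "imem s a 0 \<le> ?n"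
    "frame (For a c) s0 s" for s t s'
    using that
  proof (induction "While ?b ?d" s t s' rule: exec.induct)
    case (WhileFalse s)
    have "imem s 0 0 = ?n" using WhileFalse assms(1,3) by (simp add: frame_def)
    then show ?case using WhileFalse by simp
  next
    case (WhileTrue s1 t1 s2 t2 s3)
    have n: "imem s1 0 0 = ?n" using WhileTrue assms(1,3) by (simp add: frame_def)
    let ?i = "imem s1 a 0"
    have lt: "?i < ?n" using WhileTrue.hyps(1) n by simp
    have "wlp c (\<lambda>s'. J (Suc ?i) (iset a 0 (Suc ?i) s')) s1"
      using step[OF lt WhileTrue.prems(1) refl WhileTrue.prems(3)] .
    then have "wlp ?d (\<lambda>s'. J (Suc ?i) s' \<and> imem s' a 0 = Suc ?i) s1"
      unfolding wlp_Seq
      by (rule wlp_frame) (use assms(2) in \<open>auto simp: frame_def\<close>)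
    then have *: "J (Suc ?i) s2 \<and> imem s2 a 0 = Suc ?i"
      using WhileTrue.hyps(2) unfolding wlp_def by blast
    have "frame (For a c) s0 s2"
      using exec_frame[OF WhileTrue.hyps(2)] WhileTrue.prems(3) by (auto simp: frame_def)
    then show ?case using WhileTrue.hyps(4) * lt by simp
  qed
  have "J ?n s' \<and> frame (For a c) s0 s'" if e: "exec (For a c) s0 t s'" for t s'
  proof
    show "frame (For a c) s0 s'" using exec_frame[OF e] .
    from e obtain t' where "exec (While ?b ?d) (iset a 0 0 s0) t' s'"
      unfolding For_def by (auto elim!: SeqE ISetE)
    then show "J ?n s'"
      by (rule loop) (use init in \<open>auto simp: frame_def\<close>)
  qed
  then show ?thesis using post unfolding wlp_def by blast
qed

section \<open>Growing the forest\<close>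

locale radius =
  fixes I :: "nat supplier" and L :: nat and r :: real
  assumes inst: "supplier_instance I" and L_pos: "0 < L" and L_le: "L \<le> upper I" and r_nonneg: "0 \<le> r"
begin

abbreviation "cl \<equiv> clients I"
abbreviation "U \<equiv> upper I"
abbreviation "d \<equiv> distance I"

definition "ball f = {v \<in> cl. d v f \<le> r}"

definition "valid f \<longleftrightarrow> f \<in> facilities I \<and> L \<le> card (ball f)"

lemma finite_cl: "finite cl"
  using inst by (simp add: supplier_instance_def)

lemma ball_sub: "ball f \<subseteq> cl"
  by (auto simp: ball_def)

lemma finite_ball: "finite (ball f)"
  using finite_subset[OF ball_sub finite_cl] .

lemma triangle: "x \<in> points I \<Longrightarrow> y \<in> points I \<Longrightarrow> z \<in> points I \<Longrightarrow> d x z \<le> d x y + d y z"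
  using inst unfolding supplier_instance_def by blast

lemma sym: "x \<in> points I \<Longrightarrow> y \<in> points I \<Longrightarrow> d x y = d y x"
  using inst unfolding supplier_instance_def by blast

text \<open>Tree label of a client: one more than the root of its node, so that 0 is left for
  clients attached to no node.\<close>

definition node_label :: "(nat \<Rightarrow> nat) \<Rightarrow> (nat \<Rightarrow> nat) \<Rightarrow> nat \<Rightarrow> nat" where
  "node_label rt node v = (if node v = 0 then 0 else Suc (rt (node v - 1)))"

text \<open>Parents are stored shifted by one, with 0 for a root. Thus \<open>par k \<le> k\<close>
  says that the parent \<open>par k - 1\<close> is an older node, and counting down visits children
  before parents.\<close>

definition is_forest :: "nat \<Rightarrow> (nat \<Rightarrow> nat) \<Rightarrow> (nat \<Rightarrow> nat) \<Rightarrow> (nat \<Rightarrow> nat) \<Rightarrow> bool" where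
  "is_forest K fac par rt \<longleftrightarrow>
     (\<forall>k<K. valid (fac k) \<and> rt k \<le> k \<and> (par k = 0 \<longrightarrow> rt k = k) \<and>
        (0 < par k \<longrightarrow> par k \<le> k \<and> rt (par k - 1) = rt k \<and> d (fac k) (fac (par k - 1)) \<le> 4 * r))"

text \<open>\<open>h\<close> is the home flag and \<open>node\<close> is shifted by one. The supply
  of \<open>L\<close> home clients per node is what the moves of the balancing phase draw
  on.\<close>

definition is_assigned :: "nat \<Rightarrow> (nat \<Rightarrow> nat) \<Rightarrow> (nat \<Rightarrow> nat) \<Rightarrow> (nat \<Rightarrow> nat) \<Rightarrow> bool" where
  "is_assigned K fac node h \<longleftrightarrow>
     (\<forall>k<K. L \<le> card {v \<in> cl. 0 < h v \<and> node v = Suc k}) \<and>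
     (\<forall>v\<in>cl. node v \<le> K \<and> (0 < node v \<longrightarrow> d v (fac (node v - 1)) \<le> 3 * r) \<and>
        (0 < h v \<longrightarrow> 0 < node v \<and> d v (fac (node v - 1)) \<le> r))"

text \<open>\<open>cur\<close> is the label of the tree being grown. Relevant balls that meet a finished tree lie inside
  it; this makes the trees independent of each other.\<close>

definition is_closed :: "nat \<Rightarrow> (nat \<Rightarrow> nat) \<Rightarrow> (nat \<Rightarrow> nat) \<Rightarrow> (nat \<Rightarrow> nat) \<Rightarrow> bool" where
  "is_closed cur rt node h \<longleftrightarrow>
     (\<forall>g. valid g \<longrightarrow> (\<exists>v\<in>ball g. 0 < h v) \<longrightarrow> (\<forall>w\<in>ball g. 0 < node w)) \<and>
     (\<forall>g. valid g \<longrightarrow> (\<forall>v\<in>ball g. node_label rt node v \<notin> {0, cur} \<longrightarrow>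
        (\<forall>w\<in>ball g. node_label rt node w = node_label rt node v) \<and> (\<exists>w\<in>ball g. 0 < h w)))"

lemma forest_root:
  assumes F: "is_forest K fac par rt" and "k < K"
  shows "rt (rt k) = rt k"
  using assms(2)
proof (induction k rule: less_induct)
  case (less k)
  show ?case
  proof (cases "par k = 0")
    case True
    then show ?thesis using F less.prems by (simp add: is_forest_def)
  next
    case False
    then have "par k - 1 < k" "rt (par k - 1) = rt k" using F less.prems by (auto simp: is_forest_def)
    then show ?thesis using less.IH[of "par k - 1"] less.prems by simp
  qed
qed

definition "grown K fac par rt node h cur \<longleftrightarrow>
  is_forest K fac par rt \<and> is_assigned K fac node h \<and> is_closed cur rt node h"

text \<open>By the first clause of closedness the ball is attached completely. If two labels
  differed, one of them would not be \<open>cur\<close>, and the second clause would force a single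
  label. So the current tree needs no separate treatment.\<close>

lemma closed_label:
  assumes c: "is_closed cur rt node h" and g: "valid g" "v \<in> ball g" "w \<in> ball g" "0 < h u" "u \<in> ball g"
  shows "node_label rt node v = node_label rt node w"
proof -
  have *: "node_label rt node x \<noteq> 0" if "x \<in> ball g" for x
  proof -
    have "0 < node x" using c g(1,4,5) that unfolding is_closed_def by blast
    then show ?thesis by (simp add: node_label_def)
  qed
  have Q: "\<forall>v\<in>ball g. node_label rt node v \<notin> {0, cur} \<longrightarrow>
        (\<forall>w\<in>ball g. node_label rt node w = node_label rt node v)"
    using c g(1) unfolding is_closed_def by blast
  show ?thesis using Q *[OF g(2)] *[OF g(3)] g(2,3) by (metis insertE empty_iff)
qed

text \<open>\<open>free\<close> says that no relevant ball without home clients meets an attached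
  client, so the current tree cannot be extended. It thereby counts as finished, and any label may
  become current.\<close>

lemma closed_new_label:
  assumes c: "is_closed cur rt node h"
    and free: "\<And>g. valid g \<Longrightarrow> (\<forall>v\<in>ball g. node v = 0) \<or> (\<exists>v\<in>ball g. 0 < h v)"
  shows "is_closed cur' rt node h"
  unfolding is_closed_def
proof (intro conjI allI impI ballI)
  fix g v w assume g: "valid g" "v \<in> ball g" "node_label rt node v \<notin> {0, cur'}"
  then have "node v \<noteq> 0" by (auto simp: node_label_def split: if_splits)
  then show h: "\<exists>w\<in>ball g. 0 < h w" using free[OF g(1)] g(2) by metis
  show "node_label rt node w = node_label rt node v" if "w \<in> ball g"
    using h closed_label[OF c g(1) that g(2)] by blast
next
  fix g w assume "valid g" "\<exists>v\<in>ball g. 0 < h v" "w \<in> ball g"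
  then show "0 < node w" using c unfolding is_closed_def by blast
qed

text \<open>Only clients with label 0 or \<open>cur\<close> change their node, and they receive
  label \<open>cur\<close>, so finished trees stay closed. The assumption on the labels in
  \<open>ball f\<close> ensures that no client is taken from a finished tree.\<close>

lemma closed_extend:
  assumes c: "is_closed cur rt node h"
    and f: "valid f" "\<forall>v\<in>ball f. h v = 0" "\<forall>v\<in>ball f. node_label rt node v \<in> {0, cur}"
    and K: "\<forall>v\<in>cl. node v \<le> K"
    and h': "\<And>v. v \<in> cl \<Longrightarrow> 0 < h' v \<longleftrightarrow> 0 < h v \<or> v \<in> ball f"
    and node': "\<And>v. v \<in> cl \<Longrightarrow> node' v =
      (if v \<in> ball f \<or> node v = 0 \<and> (\<exists>g. valid g \<and> v \<in> ball g \<and> (\<exists>w\<in>ball g. 0 < h' w)) then Suc K else node v)"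
    and e: "cur = Suc e"
  shows "is_closed cur (rt(K := e)) node' h'"
proof -
  let ?l = "node_label rt node" and ?l' = "node_label (rt(K := e)) node'"
  have changed: "?l' v = ?l v \<or> ?l v \<in> {0, cur} \<and> ?l' v = cur" if "v \<in> cl" for v
  proof (cases "v \<in> ball f \<or> node v = 0 \<and> (\<exists>g. valid g \<and> v \<in> ball g \<and> (\<exists>w\<in>ball g. 0 < h' w))")
    case True
    then have "?l v \<in> {0, cur}" using f(3) by (auto simp: node_label_def)
    moreover have "node' v = Suc K" using True node'[OF that] by simp
    ultimately show ?thesis using e by (simp add: node_label_def)
  next
    case False
    then have "node' v = node v" using node'[OF that] by simp
    moreover have "node v \<le> K" using K that by blast
    then have "node v = 0 \<or> node v - 1 \<noteq> K" by linarith
    ultimately show ?thesis by (auto simp: node_label_def)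
  qed
  show ?thesis unfolding is_closed_def
  proof (intro conjI allI impI ballI)
    fix g w assume g: "valid g" "\<exists>v\<in>ball g. 0 < h' v" "w \<in> ball g"
    then have "w \<in> cl" using ball_sub by blast
    moreover have "w \<in> ball f \<or> node w = 0 \<and> (\<exists>g. valid g \<and> w \<in> ball g \<and> (\<exists>w\<in>ball g. 0 < h' w)) \<or> 0 < node w"
      using g by blast
    ultimately show "0 < node' w" using node'[of w] by auto
  next
    fix g v assume g: "valid g" "v \<in> ball g" and l: "?l' v \<notin> {0, cur}"
    have v: "v \<in> cl" using g ball_sub by blast
    have lv: "?l v = ?l' v" using changed[OF v] l by auto
    have all: "\<forall>w\<in>ball g. ?l w = ?l v" and ex: "\<exists>w\<in>ball g. 0 < h w"
      using c g l lv unfolding is_closed_def by metis+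
    show "\<exists>w\<in>ball g. 0 < h' w" using ex h' ball_sub by blast
    fix w assume w: "w \<in> ball g"
    then have "w \<in> cl" using ball_sub by blast
    from changed[OF this] all w lv l show "?l' w = ?l' v" by auto
  qed
qed

text \<open>The disjunction \<open>p\<close> reflects the greedy rule: a new root is opened only
  when no ball free of home clients meets the trees built so far. Clients of \<open>ball f\<close>
  go to the new node even if they were attached elsewhere; other clients are attached to it only if
  they were still free.\<close>

lemma grown_extend:
  assumes G: "grown K fac par rt node h cur"
    and f: "valid f" "\<forall>v\<in>ball f. h v = 0"
    and p: "p = 0 \<and> c = K \<and> (\<forall>g. valid g \<longrightarrow> (\<forall>v\<in>ball g. node v = 0) \<or> (\<exists>v\<in>ball g. 0 < h v)) \<or>
      0 < p \<and> c = rt (p - 1) \<and> (\<exists>v\<in>ball f. node v = p)"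
    and h': "\<And>v. v \<in> cl \<Longrightarrow> 0 < h' v \<longleftrightarrow> 0 < h v \<or> v \<in> ball f"
    and node': "\<And>v. v \<in> cl \<Longrightarrow> node' v =
      (if v \<in> ball f \<or> node v = 0 \<and> (\<exists>g. valid g \<and> v \<in> ball g \<and> (\<exists>w\<in>ball g. 0 < h' w)) then Suc K else node v)"
  shows "\<exists>cur. grown (Suc K) (fac(K := f)) (par(K := p)) (rt(K := c)) node' h' cur"
proof -
  have F: "is_forest K fac par rt" and A: "is_assigned K fac node h" and C: "is_closed cur rt node h"
    using G by (auto simp: grown_def)
  have fv: "f \<in> facilities I" using f(1) by (simp add: valid_def)
  have fac: "fac k \<in> facilities I" if "k < K" for k
    using F that by (auto simp: is_forest_def valid_def)
  have nK: "\<forall>v\<in>cl. node v \<le> K" using A by (auto simp: is_assigned_def)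
  have forest: "is_forest (Suc K) (fac(K := f)) (par(K := p)) (rt(K := c))"
  proof (cases "p = 0")
    case True
    then have "c = K" using p by blast
    then show ?thesis using True F f(1) unfolding is_forest_def
      by (auto simp: less_Suc_eq)
  next
    case False
    then obtain v where v: "v \<in> ball f" "node v = p" and c: "c = rt (p - 1)" using p by auto
    have vc: "v \<in> cl" using v ball_sub by blast
    have pK: "p \<le> K" "p - 1 < K" using v nK vc False by auto
    \<comment> \<open>The edge is bounded by \<open>r + 3 * r\<close> through a client
      \<open>v\<close> of \<open>ball f\<close> that is attached to the parent.\<close>
    have "d f (fac (p - 1)) \<le> d f v + d v (fac (p - 1))"
      using triangle fv vc fac[OF pK(2)] by blast
    moreover have "d f v \<le> r" using sym[of f v] fv vc v by (simp add: ball_def)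
    moreover have "d v (fac (p - 1)) \<le> 3 * r" using A vc v False by (auto simp: is_assigned_def)
    moreover have "rt (p - 1) \<le> p - 1" using F pK by (auto simp: is_forest_def)
    ultimately show ?thesis using False F f(1) c pK unfolding is_forest_def
      by (auto simp: less_Suc_eq)
  qed
  have E: "\<forall>g. valid g \<longrightarrow> (\<exists>v\<in>ball g. 0 < h v) \<longrightarrow> (\<forall>w\<in>ball g. 0 < node w)"
    using C by (auto simp: is_closed_def)
  have kept: "node' v = node v" if "v \<in> cl" "0 < h v" for v
  proof -
    have "v \<notin> ball f" using f(2) that by auto
    moreover have "node v \<noteq> 0" using A that by (auto simp: is_assigned_def)
    ultimately show ?thesis using node'[OF that(1)] by simp
  qed
  have "is_assigned (Suc K) (fac(K := f)) node' h'"
    unfolding is_assigned_def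
  proof (intro conjI allI impI ballI)
    fix k assume "k < Suc K"
    show "L \<le> card {v \<in> cl. 0 < h' v \<and> node' v = Suc k}"
    proof (cases "k = K")
      case True
      have "ball f \<subseteq> {v \<in> cl. 0 < h' v \<and> node' v = Suc k}"
        using h' node' ball_sub True by fastforce
      then have "card (ball f) \<le> card {v \<in> cl. 0 < h' v \<and> node' v = Suc k}"
        by (rule card_mono[rotated]) (use finite_cl in simp)
      then show ?thesis using f(1) by (simp add: valid_def)
    next
      case False
      have "{v \<in> cl. 0 < h v \<and> node v = Suc k} \<subseteq> {v \<in> cl. 0 < h' v \<and> node' v = Suc k}"
        using h' kept by auto
      then have "card {v \<in> cl. 0 < h v \<and> node v = Suc k} \<le> card {v \<in> cl. 0 < h' v \<and> node' v = Suc k}"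
        by (rule card_mono[rotated]) (use finite_cl in simp)
      then show ?thesis using A False \<open>k < Suc K\<close> unfolding is_assigned_def
        by (meson le_trans less_SucE)
    qed
  next
    fix v assume v: "v \<in> cl"
    then show "node' v \<le> Suc K" using node' nK by (auto simp: le_Suc_eq)
    show "d v ((fac(K := f)) (node' v - 1)) \<le> 3 * r" if pos: "0 < node' v"
    proof -
      consider "v \<in> ball f" | "v \<notin> ball f" "node' v = node v" "node v \<noteq> 0"
        | g w where "v \<notin> ball f" "node v = 0" "valid g" "v \<in> ball g" "w \<in> ball g" "0 < h' w"
        by (metis (no_types, lifting) less_irrefl node'[OF v] pos)
      then show ?thesis
      proof cases
        case 1
        then show ?thesis using node'[OF v] r_nonneg by (simp add: ball_def)
      next
        case 2
        moreover have "node v - 1 \<noteq> K" using nK v 2(3) by fastforce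
        moreover have "0 < node v \<longrightarrow> d v (fac (node v - 1)) \<le> 3 * r"
          using A v unfolding is_assigned_def by blast
        ultimately show ?thesis by simp
      next
        case 3
        have w: "w \<in> cl" using 3 ball_sub by blast
        \<comment> \<open>Had \<open>w\<close> been a home client before, closedness would have
          attached all of \<open>ball g\<close>, including \<open>v\<close>. So \<open>w\<close> is
          a new home client, and the path through \<open>g\<close> and \<open>w\<close> gives
          \<open>3 * r\<close>.\<close>
        have "w \<in> ball f" using E h'[OF w] 3 by (metis less_irrefl)
        then have "d w f \<le> r" by (simp add: ball_def)
        moreover have "d v g \<le> r" "d w g \<le> r" using 3 by (auto simp: ball_def)
        moreover have g: "g \<in> facilities I" using 3 by (simp add: valid_def)
        then have "d v f \<le> d v g + d g f" "d g f \<le> d g w + d w f" "d g w = d w g"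
          using triangle sym v w fv by blast+
        moreover have "\<exists>g. valid g \<and> v \<in> ball g \<and> (\<exists>w\<in>ball g. 0 < h' w)" using 3 by blast
        then have "node' v = Suc K" using 3(2) node'[OF v] by simp
        ultimately show ?thesis by simp
      qed
    qed
    assume hv: "0 < h' v"
    have "v \<in> ball f \<or> 0 < h v" using hv h'[OF v] by metis
    then have "0 < node' v \<and> d v ((fac(K := f)) (node' v - 1)) \<le> r"
    proof
      assume "v \<in> ball f"
      then show ?thesis using node'[OF v] by (simp add: ball_def)
    next
      assume *: "0 < h v"
      then have "0 < node v" "d v (fac (node v - 1)) \<le> r"
        using A v unfolding is_assigned_def by blast+
      moreover have "node v - 1 \<noteq> K" using nK v \<open>0 < node v\<close> by fastforce
      ultimately show ?thesis using kept[OF v *] by simp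
    qed
    then show "0 < node' v" "d v ((fac(K := f)) (node' v - 1)) \<le> r" by auto
  qed
  moreover have "is_closed (Suc c) (rt(K := c)) node' h'"
    using p
  proof
    assume p: "p = 0 \<and> c = K \<and> (\<forall>g. valid g \<longrightarrow> (\<forall>v\<in>ball g. node v = 0) \<or> (\<exists>v\<in>ball g. 0 < h v))"
    \<comment> \<open>Opening a root finishes the old tree; since \<open>c = K\<close>, the new
      current label is \<open>Suc K\<close>.\<close>
    have C': "is_closed (Suc c) rt node h"
      by (rule closed_new_label[OF C]) (use p in blast)
    have "\<forall>v\<in>ball f. node v = 0" using p f(1,2) less_irrefl by metis
    then show ?thesis
      by (intro closed_extend[OF C' f _ nK h' node' refl]) (auto simp: node_label_def)
  next
    assume p: "0 < p \<and> c = rt (p - 1) \<and> (\<exists>v\<in>ball f. node v = p)"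
    then obtain v where v: "v \<in> ball f" "node_label rt node v = Suc c" by (auto simp: node_label_def)
    have nohome: "\<not> (\<exists>v\<in>ball f. 0 < h v)" using f(2) by auto
    \<comment> \<open>A ball without home clients cannot meet a finished tree, so its labels are 0
      or \<open>cur\<close>; the attached client \<open>v\<close> then shows that the parent lies in
      the current tree.\<close>
    have lab: "\<forall>v\<in>ball f. node_label rt node v \<in> {0, cur}"
      using C f(1) nohome unfolding is_closed_def by blast
    then have cur: "cur = Suc c" using v by force
    show ?thesis
      using closed_extend[OF C f lab nK h' node' cur] unfolding cur .
  qed
  ultimately show ?thesis using forest by (auto simp: grown_def)
qed

end

section \<open>Balancing the trees\<close>

lemma sum_change:
  fixes f g :: "'b \<Rightarrow> nat"
  assumes "finite A" "q \<in> A" "\<And>j. j \<in> A \<Longrightarrow> j \<noteq> q \<Longrightarrow> g j = f j" "g q = f q + z"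
  shows "sum g A = sum f A + z"
proof -
  have "sum g A = g q + sum g (A - {q})" "sum f A = f q + sum f (A - {q})"
    using assms(1,2) by (auto intro: sum.remove)
  moreover have "sum g (A - {q}) = sum f (A - {q})" using assms(3) by (intro sum.cong) auto
  ultimately show ?thesis using assms(4) by simp
qed

section \<open>Moves along edges and the flow invariant\<close>

context radius
begin

definition "load pos k = card {v \<in> cl. pos v = Suc k}"

definition "staying node h pos k = {v \<in> cl. 0 < h v \<and> node v = Suc k \<and> pos v = Suc k}"

definition "away node h pos k = {v \<in> cl. 0 < h v \<and> node v = Suc k \<and> pos v \<noteq> Suc k}"

definition "label_count rt node c = card {v \<in> cl. 0 < node v \<and> rt (node v - 1) = c}"

text \<open>The minimum lets this describe the effect of the moving loop unconditionally. That
  \<open>z\<close> clients are really available is derived separately.\<close>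

definition moved :: "(nat \<Rightarrow> nat) \<Rightarrow> (nat \<Rightarrow> nat) \<Rightarrow> nat \<Rightarrow> nat \<Rightarrow> nat \<Rightarrow> (nat \<Rightarrow> nat) \<Rightarrow> (nat \<Rightarrow> nat) \<Rightarrow> bool" where
  "moved node h a b z pos pos' \<longleftrightarrow>
     (\<exists>Z. Z \<subseteq> staying node h pos a \<and> card Z = min z (card (staying node h pos a)) \<and>
        (\<forall>v\<in>cl. pos' v = (if v \<in> Z then Suc b else pos v)))"

lemma card_staying_away:
  assumes "is_assigned K fac node h" "k < K"
  shows "L \<le> card (staying node h pos k) + card (away node h pos k)"
proof -
  have "{v \<in> cl. 0 < h v \<and> node v = Suc k} = staying node h pos k \<union> away node h pos k"
    by (auto simp: staying_def away_def)
  moreover have "card (staying node h pos k \<union> away node h pos k) = card (staying node h pos k) + card (away node h pos k)"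
    by (intro card_Un_disjoint) (use finite_cl in \<open>auto simp: staying_def away_def\<close>)
  ultimately show ?thesis using assms unfolding is_assigned_def by metis
qed

text \<open>A node has at least \<open>L\<close> home clients, so if \<open>z\<close> plus those
  already away is at most \<open>L\<close>, then \<open>z\<close> of them are still there. The
  minimum in \<open>moved\<close> is then \<open>z\<close> itself.\<close>

lemma moved_load:
  assumes m: "moved node h a b z pos pos'" and ab: "a \<noteq> b"
    and A: "is_assigned K fac node h" "a < K" and z: "z + card (away node h pos a) \<le> L"
  shows "load pos' a + z = load pos a" "load pos' b = load pos b + z"
    "\<And>j. j \<noteq> a \<Longrightarrow> j \<noteq> b \<Longrightarrow> load pos' j = load pos j"
    "card (away node h pos' a) = card (away node h pos a) + z"
    "\<And>j. j \<noteq> a \<Longrightarrow> away node h pos' j = away node h pos j"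
proof -
  obtain Z where Z: "Z \<subseteq> staying node h pos a" "card Z = min z (card (staying node h pos a))"
    "\<And>v. v \<in> cl \<Longrightarrow> pos' v = (if v \<in> Z then Suc b else pos v)"
    using m unfolding moved_def by blast
  have cz: "card Z = z" using Z(2) card_staying_away[OF A, of pos] z by linarith
  have fin: "finite Z" using Z(1) finite_cl by (rule_tac finite_subset) (auto simp: staying_def)
  have Zcl: "Z \<subseteq> cl" "\<And>v. v \<in> Z \<Longrightarrow> pos v = Suc a" using Z(1) by (auto simp: staying_def)
  have "{v \<in> cl. pos v = Suc a} = {v \<in> cl. pos' v = Suc a} \<union> Z"
    using Z(3) Zcl ab by (auto split: if_splits)
  then have "load pos a = card ({v \<in> cl. pos' v = Suc a} \<union> Z)" by (simp add: load_def)
  also have "\<dots> = load pos' a + card Z" unfolding load_def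
    by (rule card_Un_disjoint) (use finite_cl fin Z(3) ab in \<open>auto split: if_splits\<close>)
  finally show "load pos' a + z = load pos a" using cz by simp
  have "{v \<in> cl. pos' v = Suc b} = {v \<in> cl. pos v = Suc b} \<union> Z"
    using Z(3) Zcl ab by (auto split: if_splits)
  then have "load pos' b = card ({v \<in> cl. pos v = Suc b} \<union> Z)" by (simp add: load_def)
  also have "\<dots> = load pos b + card Z" unfolding load_def
    by (rule card_Un_disjoint) (use finite_cl fin Zcl ab in auto)
  finally show "load pos' b = load pos b + z" using cz by simp
  show "load pos' j = load pos j" if "j \<noteq> a" "j \<noteq> b" for j
    unfolding load_def using Z(3) Zcl that by (intro arg_cong[where f = card]) (auto split: if_splits)
  have "away node h pos' a = away node h pos a \<union> Z"
    using Z(3) Z(1) Zcl ab by (auto simp: away_def staying_def split: if_splits)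
  then have "card (away node h pos' a) = card (away node h pos a \<union> Z)" by simp
  also have "\<dots> = card (away node h pos a) + card Z"
    by (rule card_Un_disjoint) (use finite_cl fin Zcl in \<open>auto simp: away_def\<close>)
  finally show "card (away node h pos' a) = card (away node h pos a) + z" using cz by simp
  show "away node h pos' j = away node h pos j" if "j \<noteq> a" for j
    using Z(1,3) that by (auto simp: away_def staying_def split: if_splits)
qed

text \<open>Positions may deviate from nodes but never leave the tree, which keeps the number of
  clients per tree fixed during balancing.\<close>

definition good_pos :: "nat \<Rightarrow> (nat \<Rightarrow> nat) \<Rightarrow> (nat \<Rightarrow> nat) \<Rightarrow> (nat \<Rightarrow> nat) \<Rightarrow> (nat \<Rightarrow> nat) \<Rightarrow> bool" where
  "good_pos K fac rt node pos \<longleftrightarrow>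
     (\<forall>v\<in>cl. pos v \<le> K \<and> (0 < pos v \<longleftrightarrow> 0 < node v) \<and>
        (0 < node v \<longrightarrow> rt (pos v - 1) = rt (node v - 1) \<and> d v (fac (pos v - 1)) \<le> 5 * r))"

text \<open>A client of \<open>Z\<close> is a home client of \<open>a\<close> still located there,
  so it is within \<open>r\<close> of \<open>fac a\<close> and travels over one edge:
  \<open>r + 4 * r\<close>.\<close>

lemma moved_good:
  assumes m: "moved node h a b z pos pos'" and g: "good_pos K fac rt node pos"
    and A: "is_assigned K fac node h" and F: "is_forest K fac par rt" and b: "b < K" "a < K"
    and near: "rt a = rt b" "d (fac a) (fac b) \<le> 4 * r"
  shows "good_pos K fac rt node pos'"
proof -
  obtain Z where Z: "Z \<subseteq> staying node h pos a"
    "\<And>v. v \<in> cl \<Longrightarrow> pos' v = (if v \<in> Z then Suc b else pos v)"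
    using m unfolding moved_def by blast
  have "pos' v \<le> K \<and> (0 < pos' v \<longleftrightarrow> 0 < node v) \<and>
        (0 < node v \<longrightarrow> rt (pos' v - 1) = rt (node v - 1) \<and> d v (fac (pos' v - 1)) \<le> 5 * r)"
    if v: "v \<in> cl" for v
  proof (cases "v \<in> Z")
    case True
    then have s: "0 < h v" "node v = Suc a" using Z(1) by (auto simp: staying_def)
    have "fac a \<in> facilities I" "fac b \<in> facilities I" using F b by (auto simp: is_forest_def valid_def)
    then have "d v (fac b) \<le> d v (fac a) + d (fac a) (fac b)" using triangle v by blast
    moreover have "d v (fac a) \<le> r" using A v s by (auto simp: is_assigned_def)
    ultimately show ?thesis using Z(2)[OF v] True s near b by simp
  next
    case False
    then show ?thesis using Z(2)[OF v] g v by (simp add: good_pos_def)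
  qed
  then show ?thesis unfolding good_pos_def by blast
qed

text \<open>Nodes below \<open>i\<close> are still to be processed. Such a node holds \<open>m k * L + t k\<close> clients on paper,
  of which \<open>acc k\<close> have been granted to its descendants. The bound on \<open>away\<close> leaves a home client
  for every move, since \<open>acc\<close> and \<open>bud\<close> together stay below \<open>L\<close>.\<close>

definition flow :: "nat \<Rightarrow> (nat \<Rightarrow> nat) \<Rightarrow> (nat \<Rightarrow> nat) \<Rightarrow> (nat \<Rightarrow> nat) \<Rightarrow> (nat \<Rightarrow> nat) \<Rightarrow> (nat \<Rightarrow> nat) \<Rightarrow>
    nat \<Rightarrow> (nat \<Rightarrow> nat) \<Rightarrow> (nat \<Rightarrow> nat) \<Rightarrow> (nat \<Rightarrow> nat) \<Rightarrow> (nat \<Rightarrow> nat) \<Rightarrow> (nat \<Rightarrow> nat) \<Rightarrow> bool" where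
  "flow K fac par rt node h i m t acc bud pos \<longleftrightarrow>
     good_pos K fac rt node pos \<and>
     (\<forall>k<K. t k < L) \<and>
     (\<forall>k<i. m k * L + t k = load pos k + acc k) \<and>
     (\<forall>k<K. i \<le> k \<longrightarrow> m k * L \<le> load pos k) \<and>
     (\<forall>k<K. i \<le> k \<longrightarrow> par k \<noteq> 0 \<or> bud (rt k) = 0 \<longrightarrow> load pos k \<le> m k * U) \<and>
     (\<forall>k<K. i \<le> k \<longrightarrow> 0 < bud (rt k) \<longrightarrow> m k * U \<le> load pos k) \<and>
     (\<forall>k<i. card (away node h pos k) \<le> acc k) \<and>
     (\<forall>c<K. (\<Sum>k<i. if rt k = c then acc k else 0) + bud c \<le> label_count rt node c mod L) \<and>
     (\<forall>c<i. (\<Sum>k<i. if rt k = c then acc k else 0) + bud c = label_count rt node c mod L) \<and>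
     (\<forall>c<K. rt c = c \<longrightarrow>
        (\<Sum>k<K. if rt k = c then m k * L + (if k < i then t k else 0) else 0)
          + (if c < i then 0 else t c) = label_count rt node c)"

lemma flowD:
  assumes "flow K fac par rt node h i m t acc bud pos"
  shows "good_pos K fac rt node pos"
    "k < K \<Longrightarrow> t k < L"
    "k < i \<Longrightarrow> m k * L + t k = load pos k + acc k"
    "k < K \<Longrightarrow> i \<le> k \<Longrightarrow> m k * L \<le> load pos k"
    "k < K \<Longrightarrow> i \<le> k \<Longrightarrow> par k \<noteq> 0 \<or> bud (rt k) = 0 \<Longrightarrow> load pos k \<le> m k * U"
    "k < K \<Longrightarrow> i \<le> k \<Longrightarrow> 0 < bud (rt k) \<Longrightarrow> m k * U \<le> load pos k"
    "k < i \<Longrightarrow> card (away node h pos k) \<le> acc k"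
    "c < K \<Longrightarrow> (\<Sum>k<i. if rt k = c then acc k else 0) + bud c \<le> label_count rt node c mod L"
    "c < i \<Longrightarrow> (\<Sum>k<i. if rt k = c then acc k else 0) + bud c = label_count rt node c mod L"
    "c < K \<Longrightarrow> rt c = c \<Longrightarrow>
        (\<Sum>k<K. if rt k = c then m k * L + (if k < i then t k else 0) else 0)
          + (if c < i then 0 else t c) = label_count rt node c"
  using assms unfolding flow_def by blast+

text \<open>All other nodes of the tree have larger indices and have passed on their remainders. So
  \<open>t k\<close> is the tree size modulo \<open>L\<close>, and the part not granted below,
  \<open>bud k\<close>, is exactly the surplus present at the root.\<close>

lemma flow_step_root:
  assumes F: "is_forest K fac par rt"
    and fl: "flow K fac par rt node h (Suc k) m t acc bud pos" and k: "k < K" "par k = 0"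
    and x: "x = min (bud k) (m k * (U - L))"
  shows "flow K fac par rt node h k m t acc (bud(k := bud k - x)) pos"
proof -
  have rk: "rt k = k" and rle: "\<And>j. j < K \<Longrightarrow> rt j \<le> j" using F k by (auto simp: is_forest_def)
  note D = flowD[OF fl]
  have bal: "m k * L + t k = load pos k + acc k" using D(3) by simp
  \<comment> \<open>The root has the smallest index in its tree, so the nodes below \<open>k\<close>
    contribute nothing.\<close>
  have *: "(\<Sum>j<k. if rt j = k then f j else 0) = 0" for f :: "nat \<Rightarrow> nat"
  proof (intro sum.neutral ballI)
    fix j assume "j \<in> {..<k}"
    then show "(if rt j = k then f j else 0) = 0" using rle[of j] k by auto
  qed
  have tot: "acc k + bud k = label_count rt node k mod L"
  proof -
    have "(\<Sum>j<Suc k. if rt j = k then acc j else 0) + bud k = label_count rt node k mod L"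
      using D(9) lessI by blast
    then show ?thesis unfolding sum.lessThan_Suc * using rk by simp
  qed
  have M: "(\<Sum>j<K. if rt j = k then m j * L + (if j < Suc k then t j else 0) else 0) = label_count rt node k"
    using D(10)[OF k(1) rk] by simp
  have M': "(\<Sum>j<K. if rt j = k then m j * L + (if j < Suc k then t j else 0) else 0) =
      (\<Sum>j<K. if rt j = k then m j * L + (if j < k then t j else 0) else 0) + t k"
    by (rule sum_change[of _ k]) (use k rk in auto)
  have "(\<Sum>j<K. if rt j = k then m j * L + (if j < k then t j else 0) else 0) =
      (\<Sum>j<K. if rt j = k then m j else 0) * L"
    unfolding sum_distrib_right
  proof (intro sum.cong refl)
    fix j assume "j \<in> {..<K}"
    then show "(if rt j = k then m j * L + (if j < k then t j else 0) else 0) = (if rt j = k then m j else 0) * L"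
      using rle[of j] k by auto
  qed
  then have eq: "label_count rt node k = (\<Sum>j<K. if rt j = k then m j else 0) * L + t k"
    using M M' by simp
  have "label_count rt node k mod L = t k"
    unfolding eq using D(2)[OF k(1)] by simp
  then have cnt: "load pos k = m k * L + bud k" using tot bal by simp
  have mU: "m k * U = m k * L + m k * (U - L)"
    using L_le by (metis add_mult_distrib2 le_add_diff_inverse)
  \<comment> \<open>If some budget remains, then \<open>x = m k * (U - L)\<close> and the root holds
    more than \<open>m k * U\<close> clients; the excess stays unserved.\<close>
  have c1: "bud k - x = 0 \<Longrightarrow> load pos k \<le> m k * U" "0 < bud k - x \<Longrightarrow> m k * U \<le> load pos k"
    using cnt mU x by auto
  have acc: "(\<Sum>j<k. if rt j = c then acc j else 0) + (bud(k := bud k - x)) c \<le> label_count rt node c mod L" if "c < K" for c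
    using D(8)[OF that] by (auto split: if_splits)
  have acc': "(\<Sum>j<k. if rt j = c then acc j else 0) + (bud(k := bud k - x)) c = label_count rt node c mod L" if "c < k" for c
    using D(9)[of c] that rk by (simp split: if_splits)
  have Mc: "(\<Sum>j<K. if rt j = c then m j * L + (if j < k then t j else 0) else 0)
          + (if c < k then 0 else t c) = label_count rt node c" if c: "c < K" "rt c = c" for c
  proof (cases "c = k")
    case True
    then show ?thesis using M M' by simp
  next
    case False
    have "(\<Sum>j<K. if rt j = c then m j * L + (if j < k then t j else 0) else 0) =
      (\<Sum>j<K. if rt j = c then m j * L + (if j < Suc k then t j else 0) else 0)"
      using rk False by (intro sum.cong) (auto simp: less_Suc_eq)
    moreover have "(c < k) = (c < Suc k)" using False by auto
    ultimately show ?thesis using D(10)[OF c] by simp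
  qed
  have ge: "k \<le> j \<Longrightarrow> j = k \<or> Suc k \<le> j" for j by auto
  have B: "m j * L \<le> load pos j" if "j < K" "k \<le> j" for j
    using ge[OF that(2)] D(4)[OF that(1)] cnt by auto
  have C: "load pos j \<le> m j * U" if "j < K" "k \<le> j" "par j \<noteq> 0 \<or> (bud(k := bud k - x)) (rt j) = 0" for j
  proof (cases "j = k")
    case True
    then show ?thesis using c1 that rk k by simp
  next
    case False
    then have j: "Suc k \<le> j" using that by simp
    show ?thesis
    proof (cases "par j = 0")
      case True
      then have "rt j = j" using F that by (simp add: is_forest_def)
      then have "bud (rt j) = 0" using that True False by simp
      then show ?thesis using D(5)[OF that(1) j] by simp
    next
      case False
      then show ?thesis using D(5)[OF that(1) j] by simp
    qed
  qed
  have E: "m j * U \<le> load pos j" if "j < K" "k \<le> j" "0 < (bud(k := bud k - x)) (rt j)" for j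
  proof (cases "j = k")
    case True
    then show ?thesis using c1 that rk by simp
  next
    case False
    then have "Suc k \<le> j" "0 < bud (rt j)" using that by (auto split: if_splits)
    then show ?thesis using D(6) that(1) by simp
  qed
  show ?thesis
    unfolding flow_def
    by (intro conjI allI impI B C E acc acc' Mc) (use D(1,2,3,7) in auto)
qed

text \<open>On paper all of \<open>t k\<close> goes to the parent, while \<open>acc k + x\<close> is
  owed to the subtree of \<open>k\<close> for grants. Only the difference travels, up by the first
  move or down by the second; truncated subtraction makes one of them empty. Afterwards
  \<open>k\<close> holds \<open>m k * L + x\<close> clients.\<close>

lemma flow_step_child:
  assumes F: "is_forest K fac par rt" and A: "is_assigned K fac node h"
    and fl: "flow K fac par rt node h (Suc k) m t acc bud pos" and k: "k < K" "par k = Suc q"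
    and x: "x = min (bud (rt k)) (m k * (U - L))"
    and mq: "m' q * L + t' q = m q * L + t q + t k" "t' q < L"
    and other: "\<And>j. j \<noteq> q \<Longrightarrow> m' j = m j" "\<And>j. j \<noteq> q \<Longrightarrow> t' j = t j"
    and mv1: "moved node h k q (t k - (acc k + x)) pos pos1"
    and mv2: "moved node h q k ((acc k + x) - t k) pos1 pos2"
  shows "flow K fac par rt node h k m' t' (acc(q := acc q + (acc k + x))) (bud(rt k := bud (rt k) - x)) pos2"
proof -
  define X where "X = acc k + x"
  note D = flowD[OF fl]
  have rle: "\<And>j. j < K \<Longrightarrow> rt j \<le> j" using F by (auto simp: is_forest_def)
  have q: "q < k" "rt q = rt k" "d (fac k) (fac q) \<le> 4 * r"
    using F k by (auto simp: is_forest_def)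
  have rk: "rt k < k" using rle[of q] q k by simp
  have fq: "fac q \<in> facilities I" "fac k \<in> facilities I" using F k q by (auto simp: is_forest_def valid_def)
  have bal: "m k * L + t k = load pos k + acc k" "m q * L + t q = load pos q + acc q"
    using D(3) q by auto
  have aw: "card (away node h pos k) \<le> acc k" "card (away node h pos q) \<le> acc q"
    using D(7) q by auto
  have tL: "t k < L" using D(2) k by blast
  have S: "(\<Sum>j<Suc k. if rt j = c then acc j else 0) =
      (\<Sum>j<k. if rt j = c then acc j else 0) + (if rt k = c then acc k else 0)" for c by simp
  have S': "(\<Sum>j<k. if rt j = c then (acc(q := acc q + X)) j else 0) =
      (\<Sum>j<k. if rt j = c then acc j else 0) + (if rt k = c then X else 0)" for c
    by (rule sum_change[of _ q]) (use q in auto)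
  have xb: "x \<le> bud (rt k)" using x by simp
  have "(\<Sum>j<Suc k. if rt j = rt k then acc j else 0) + bud (rt k) = label_count rt node (rt k) mod L"
    using D(9)[of "rt k"] rk by simp
  moreover have "acc q \<le> (\<Sum>j<k. if rt j = rt k then acc j else 0)"
    using member_le_sum[of q "{..<k}" "\<lambda>j. if rt j = rt k then acc j else 0"] q by auto
  moreover have "label_count rt node (rt k) mod L < L" using L_pos by simp
  \<comment> \<open>\<open>acc k\<close>, \<open>acc q\<close> and \<open>x\<close> are disjoint
    shares of the tree size modulo \<open>L\<close>, hence their sum is below
    \<open>L\<close>.\<close>
  ultimately have XL: "X + acc q < L" using S[of "rt k"] xb by (simp add: X_def)
  \<comment> \<open>If the first move is nonempty, at most \<open>acc k \<le> X\<close> home clients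
    are away, so the sum is at most \<open>t k < L\<close>.\<close>
  have z1: "(t k - X) + card (away node h pos k) \<le> L" using aw tL X_def XL by linarith
  have mv1': "moved node h k q (t k - X) pos pos1" and mv2': "moved node h q k (X - t k) pos1 pos2"
    using mv1 mv2 by (auto simp: X_def)
  have kq: "k \<noteq> q" and qK: "q < K" using q k by auto
  note M1 = moved_load[OF mv1' kq A k(1) z1]
  \<comment> \<open>The parent sends at most \<open>X\<close> clients and has lost at most
    \<open>acc q\<close> before.\<close>
  have z2: "(X - t k) + card (away node h pos1 q) \<le> L" using M1(5) q aw(2) XL by auto
  note M2 = moved_load[OF mv2' kq[symmetric] A qK z2]
  note gp = D(1)
  have gp1: "good_pos K fac rt node pos1" using moved_good[OF mv1' gp A F qK k(1)] q by simp
  have gp2: "good_pos K fac rt node pos2"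
    by (rule moved_good[OF mv2' gp1 A F k(1) qK]) (use q sym[of "fac k" "fac q"] fq in auto)
  have cj: "load pos2 j = load pos j" if "j \<noteq> k" "j \<noteq> q" for j
    using M1(3) M2(3) that by metis
  have cx: "load pos2 k = m k * L + x" using M1(1) M2(2) bal by (auto simp: X_def)
  have cq: "m' q * L + t' q = load pos2 q + (acc q + X)" using M1(2) M2(1) bal mq by auto
  have mU: "m k * U = m k * L + m k * (U - L)"
    using L_le by (metis add_mult_distrib2 le_add_diff_inverse)
  have mk: "m' k = m k" using other q by auto
  have E: "t' j < L" if "j < K" for j using D(2)[OF that] mq(2) other(2) by (cases "j = q") auto
  have b1: "m' j * L + t' j = load pos2 j + (acc(q := acc q + X)) j" if "j < k" for j
    using that cq D(3)[of j] other[of j] cj[of j] by (cases "j = q") auto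
  have b2: "m' j * L \<le> load pos2 j" if "j < K" "k \<le> j" for j
    using that cx mk D(4)[of j] other[of j] cj[of j] q by (cases "j = k") auto
  have b3: "load pos2 j \<le> m' j * U" if "j < K" "k \<le> j" "par j \<noteq> 0 \<or> (bud(rt k := bud (rt k) - x)) (rt j) = 0" for j
  proof (cases "j = k")
    case True
    then show ?thesis using cx mU x mk by simp
  next
    case False
    then have j: "Suc k \<le> j" "j \<noteq> q" using that q by auto
    show ?thesis
    proof (cases "par j = 0")
      case True
      then have "rt j = j" using F that by (simp add: is_forest_def)
      then have "bud (rt j) = 0" using that True j rk by simp
      then show ?thesis using D(5)[OF that(1) j(1)] other[of j] cj[OF False j(2)] j by simp
    next
      case False
      then show ?thesis using D(5)[OF that(1) j(1)] other[of j] cj[OF \<open>j \<noteq> k\<close> j(2)] j by simp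
    qed
  qed
  have b4: "m' j * U \<le> load pos2 j" if "j < K" "k \<le> j" "0 < (bud(rt k := bud (rt k) - x)) (rt j)" for j
  proof (cases "j = k")
    case True
    then have "0 < bud (rt k) - x" using that by simp
    then have "x = m k * (U - L)" using x by linarith
    then show ?thesis using True cx mU mk by simp
  next
    case False
    then have j: "Suc k \<le> j" "j \<noteq> q" "0 < bud (rt j)" using that q by (auto split: if_splits)
    then show ?thesis using D(6)[OF that(1) j(1)] other[of j] cj[OF False j(2)] by simp
  qed
  have b5: "card (away node h pos2 j) \<le> (acc(q := acc q + X)) j" if "j < k" for j
  proof (cases "j = q")
    case True
    then show ?thesis using M2(4) M1(5)[of q] q aw by simp
  next
    case False
    then show ?thesis using M2(5)[of j] M1(5)[of j] that D(7)[of j] by simp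
  qed
  \<comment> \<open>Node \<open>k\<close> drops out of the sum, \<open>acc q\<close> takes over
    \<open>acc k\<close> and the new grant \<open>x\<close>, and \<open>bud\<close> loses
    \<open>x\<close>: the total of the tree is unchanged.\<close>
  have b6: "(\<Sum>j<k. if rt j = c then (acc(q := acc q + X)) j else 0) + (bud(rt k := bud (rt k) - x)) c
    = (\<Sum>j<Suc k. if rt j = c then acc j else 0) + bud c" for c
    unfolding S S' using xb X_def by (auto split: if_splits)
  have Mc: "(\<Sum>j<K. if rt j = c then m' j * L + (if j < k then t' j else 0) else 0)
      + (if c < k then 0 else t' c) = label_count rt node c" if c: "c < K" "rt c = c" for c
  proof -
    have "(\<Sum>j<K. if rt j = c then m j * L + (if j < Suc k then t j else 0) else 0) =
      (\<Sum>j<K. if rt j = c then m j * L + (if j < k then t j else 0) else 0) + (if rt k = c then t k else 0)"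
      by (rule sum_change[of _ k]) (use k in auto)
    moreover have "(\<Sum>j<K. if rt j = c then m' j * L + (if j < k then t' j else 0) else 0) =
      (\<Sum>j<K. if rt j = c then m j * L + (if j < k then t j else 0) else 0) + (if rt k = c then t k else 0)"
      by (rule sum_change[of _ q]) (use q qK mq other in auto)
    moreover have "(if c < k then 0 else t' c) = (if c < Suc k then 0 else t c)"
    proof -
      have "c \<noteq> k" using c rk by auto
      then show ?thesis using other(2)[of c] q by (cases "c < k") auto
    qed
    ultimately show ?thesis using D(10)[OF c] by simp
  qed
  have b7: "(\<Sum>j<k. if rt j = c then (acc(q := acc q + X)) j else 0) + (bud(rt k := bud (rt k) - x)) c
      \<le> label_count rt node c mod L" if "c < K" for c
    using D(8)[OF that] unfolding b6 .
  have b8: "(\<Sum>j<k. if rt j = c then (acc(q := acc q + X)) j else 0) + (bud(rt k := bud (rt k) - x)) c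
      = label_count rt node c mod L" if "c < k" for c
    using D(9)[of c] that unfolding b6 by simp
  show ?thesis
    unfolding flow_def X_def[symmetric]
    by (intro conjI allI impI gp2 b1 b2 b3 b4 b5 b7 b8 Mc) (use E in blast)
qed

lemma flow_init:
  assumes F: "is_forest K fac par rt" and A: "is_assigned K fac node h"
    and t: "\<And>k. k < K \<Longrightarrow> m k * L + t k = load node k" "\<And>k. k < K \<Longrightarrow> t k < L"
    and bud: "\<And>c. c < K \<Longrightarrow> bud c = label_count rt node c mod L"
    and pos: "\<And>v. v \<in> cl \<Longrightarrow> pos v = node v" and acc: "\<And>k. k < K \<Longrightarrow> acc k = 0"
  shows "flow K fac par rt node h K m t acc bud pos"
proof -
  have cnt: "load pos k = load node k" for k
    unfolding load_def using pos by (intro arg_cong[where f = card]) auto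
  have aw: "away node h pos k = {}" for k using pos by (auto simp: away_def)
  have good: "good_pos K fac rt node pos"
    using A pos r_nonneg unfolding good_pos_def is_assigned_def by force
  have sum: "(\<Sum>k<K. if rt k = c then m k * L + (if k < K then t k else 0) else 0) = label_count rt node c" for c
  proof -
    have "(\<Sum>k<K. if rt k = c then m k * L + (if k < K then t k else 0) else 0) = (\<Sum>k | k < K \<and> rt k = c. load node k)"
      using t(1) by (subst sum.inter_filter[symmetric]) (auto intro!: sum.cong simp: lessThan_def)
    also have "\<dots> = card (\<Union>k\<in>{k. k < K \<and> rt k = c}. {v \<in> cl. node v = Suc k})"
      unfolding load_def by (rule card_UN_disjoint[symmetric]) (use finite_cl in auto)
    also have "(\<Union>k\<in>{k. k < K \<and> rt k = c}. {v \<in> cl. node v = Suc k}) = {v \<in> cl. 0 < node v \<and> rt (node v - 1) = c}"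
    proof (intro equalityI subsetI)
      fix v assume v: "v \<in> {v \<in> cl. 0 < node v \<and> rt (node v - 1) = c}"
      then have "node v \<le> K" using A by (auto simp: is_assigned_def)
      then show "v \<in> (\<Union>k\<in>{k. k < K \<and> rt k = c}. {v \<in> cl. node v = Suc k})"
        using v by (intro UN_I[of "node v - 1"]) auto
    qed auto
    finally show ?thesis by (simp add: label_count_def)
  qed
  show ?thesis
    unfolding flow_def using good t cnt aw bud sum acc by simp
qed

lemma load_label:
  assumes g: "good_pos K fac rt node pos"
  shows "(\<Sum>k | k < K \<and> rt k = c. load pos k) = label_count rt node c"
proof -
  have "(\<Sum>k | k < K \<and> rt k = c. load pos k) = card (\<Union>k\<in>{k. k < K \<and> rt k = c}. {v \<in> cl. pos v = Suc k})"
    unfolding load_def by (rule card_UN_disjoint[symmetric]) (use finite_cl in auto)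
  also have "(\<Union>k\<in>{k. k < K \<and> rt k = c}. {v \<in> cl. pos v = Suc k}) = {v \<in> cl. 0 < node v \<and> rt (node v - 1) = c}"
  proof (intro equalityI subsetI)
    fix v assume v: "v \<in> {v \<in> cl. 0 < node v \<and> rt (node v - 1) = c}"
    then have "pos v \<le> K" "0 < pos v" "rt (pos v - 1) = c" using g by (auto simp: good_pos_def)
    then show "v \<in> (\<Union>k\<in>{k. k < K \<and> rt k = c}. {v \<in> cl. pos v = Suc k})"
      using v by (intro UN_I[of "pos v - 1"]) auto
  next
    fix v assume "v \<in> (\<Union>k\<in>{k. k < K \<and> rt k = c}. {v \<in> cl. pos v = Suc k})"
    then show "v \<in> {v \<in> cl. 0 < node v \<and> rt (node v - 1) = c}"
      using g unfolding good_pos_def by force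
  qed
  finally show ?thesis by (simp add: label_count_def)
qed

text \<open>If the budget of a tree is used up, no node exceeds its quota and all clients are
  served. Otherwise every node is filled to \<open>m k * U\<close>, and the multiplicities add up to
  the tree size divided by \<open>L\<close>, since only \<open>t c < L\<close> is left over. Each
  case attains one side of the minimum.\<close>

lemma flow_served:
  assumes F: "is_forest K fac par rt" 
    and fl: "flow K fac par rt node h 0 m t acc bud pos"
  shows "(\<Sum>c<K. min (label_count rt node c) (label_count rt node c div L * U)) \<le> (\<Sum>k<K. min (load pos k) (m k * U))"
proof -
  have rle: "\<And>j. j < K \<Longrightarrow> rt j \<le> j" using F by (auto simp: is_forest_def)
  note D = flowD[OF fl]
  have one: "min (label_count rt node c) (label_count rt node c div L * U)
      \<le> (\<Sum>k | k < K \<and> rt k = c. min (load pos k) (m k * U))" if c: "c < K" for c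
  proof (cases "bud c = 0")
    case True
    have "(\<Sum>k | k < K \<and> rt k = c. min (load pos k) (m k * U)) = (\<Sum>k | k < K \<and> rt k = c. load pos k)"
      by (intro sum.cong refl) (use D(5) True in auto)
    then show ?thesis using load_label[OF D(1), of c] by simp
  next
    case False
    have full: "(\<Sum>k | k < K \<and> rt k = c. min (load pos k) (m k * U)) = (\<Sum>k | k < K \<and> rt k = c. m k * U)"
      by (intro sum.cong refl) (use D(6) False in auto)
    show ?thesis
    proof (cases "rt c = c")
      case True
      have "(\<Sum>k<K. if rt k = c then m k * L + (if k < 0 then t k else 0) else 0) + t c = label_count rt node c"
        using D(10)[OF c True] by simp
      moreover have "(\<Sum>k<K. if rt k = c then m k * L + (if k < 0 then t k else 0) else 0) =
          (\<Sum>k | k < K \<and> rt k = c. m k) * L"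
        unfolding sum_distrib_right
        by (subst sum.inter_filter[symmetric]) (auto intro!: sum.cong simp: lessThan_def)
      ultimately have eq: "label_count rt node c = (\<Sum>k | k < K \<and> rt k = c. m k) * L + t c" by simp
      have "label_count rt node c div L = (\<Sum>k | k < K \<and> rt k = c. m k)"
        unfolding eq using D(2)[OF c] by simp
      then show ?thesis using full by (simp add: sum_distrib_right)
    next
      \<comment> \<open>An index that is not a root labels no node at all.\<close>
      case False2: False
      have none: "{k. k < K \<and> rt k = c} = {}" using forest_root[OF F] False2 by auto
      have "label_count rt node c = 0"
        using load_label[OF D(1), of c] unfolding none by simp
      then show ?thesis by simp
    qed
  qed
  have "(\<Sum>c<K. min (label_count rt node c) (label_count rt node c div L * U))
     \<le> (\<Sum>c<K. \<Sum>k | k < K \<and> rt k = c. min (load pos k) (m k * U))"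
    using one by (intro sum_mono) auto
  also have "\<dots> = (\<Sum>k<K. min (load pos k) (m k * U))"
  proof -
    have "rt ` {..<K} \<subseteq> {..<K}" using rle le_less_trans by blast
    from sum.group[OF _ _ this, of "\<lambda>k. min (load pos k) (m k * U)"] show ?thesis by simp
  qed
  finally show ?thesis .
qed

end

section \<open>Comparison with the optimum\<close>

text \<open>Dealing \<open>c\<close> items in turn to \<open>m\<close> receivers. The lower bound
  comes from the injection \<open>j \<mapsto> m * j + i\<close>, the upper one from division by
  \<open>m\<close>, which is injective on a residue class.\<close>

lemma card_residue:
  fixes m :: nat
  assumes i: "i < m" and lo: "m * l \<le> c" and up: "c \<le> m * u"
  shows "l \<le> card {x. x < c \<and> x mod m = i}" "card {x. x < c \<and> x mod m = i} \<le> u"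
proof -
  have "(\<lambda>j. m * j + i) ` {..<l} \<subseteq> {x. x < c \<and> x mod m = i}"
  proof
    fix x assume "x \<in> (\<lambda>j. m * j + i) ` {..<l}"
    then obtain j where j: "j < l" "x = m * j + i" by auto
    have "m * Suc j \<le> m * l" using j(1) by (intro mult_le_mono2) simp
    then show "x \<in> {x. x < c \<and> x mod m = i}" using j i lo by simp
  qed
  then have "card ((\<lambda>j. m * j + i) ` {..<l}) \<le> card {x. x < c \<and> x mod m = i}"
    by (rule card_mono[rotated]) simp
  moreover have "inj_on (\<lambda>j. m * j + i) {..<l}" using i by (auto intro!: inj_onI)
  ultimately show "l \<le> card {x. x < c \<and> x mod m = i}" by (simp add: card_image)
  have "inj_on (\<lambda>x. x div m) {x. x < c \<and> x mod m = i}"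
    by (rule inj_onI) (metis (mono_tags, lifting) div_mult_mod_eq mem_Collect_eq)
  moreover have "(\<lambda>x. x div m) ` {x. x < c \<and> x mod m = i} \<subseteq> {..<u}"
    using up by (auto simp: less_mult_imp_div_less mult.commute)
  ultimately have "card {x. x < c \<and> x mod m = i} \<le> card {..<u}"
    by (rule card_inj_on_le) simp
  then show "card {x. x < c \<and> x mod m = i} \<le> u" by simp
qed

lemma bij_betw_rank:
  fixes A :: "nat set"
  assumes "finite A"
  shows "bij_betw (\<lambda>v. card {w \<in> A. w < v}) A {..<card A}"
proof -
  have less: "card {w \<in> A. w < x} < card {w \<in> A. w < y}" if "x \<in> A" "x < y" for x y
    by (rule psubset_card_mono) (use assms that in auto)
  have inj: "inj_on (\<lambda>v. card {w \<in> A. w < v}) A"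
    by (rule linorder_inj_onI) (use less in fastforce)+
  have "(\<lambda>v. card {w \<in> A. w < v}) ` A \<subseteq> {..<card A}"
    using assms by (auto intro!: psubset_card_mono)
  then have "(\<lambda>v. card {w \<in> A. w < v}) ` A = {..<card A}"
    by (rule card_subset_eq[rotated]) (simp_all add: card_image[OF inj])
  then show ?thesis using inj by (simp add: bij_betw_def)
qed

text \<open>The copies of node \<open>k\<close> form a block of length \<open>m k\<close>. Together
  with \<open>prefix_sum_inject\<close> this splits a global copy number uniquely into a node and a
  copy of that node.\<close>

lemma prefix_sum_index:
  fixes m :: "nat \<Rightarrow> nat"
  shows "j < (\<Sum>k<K. m k) \<Longrightarrow> \<exists>k i. k < K \<and> i < m k \<and> j = (\<Sum>l<k. m l) + i"
proof (induction K)
  case (Suc K)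
  show ?case
  proof (cases "j < (\<Sum>k<K. m k)")
    case True
    then show ?thesis using Suc.IH less_SucI by blast
  next
    case False
    then show ?thesis using Suc.prems
      by (intro exI[of _ K] exI[of _ "j - (\<Sum>k<K. m k)"]) auto
  qed
qed simp

lemma prefix_sum_mono:
  fixes m :: "nat \<Rightarrow> nat"
  assumes "k < k'"
  shows "(\<Sum>l<k. m l) + m k \<le> (\<Sum>l<k'. m l)"
proof -
  have "(\<Sum>l<k. m l) + m k = (\<Sum>l<Suc k. m l)" by simp
  also have "\<dots> \<le> (\<Sum>l<k'. m l)" by (rule sum_mono2) (use assms in auto)
  finally show ?thesis .
qed

lemma prefix_sum_inject:
  fixes m :: "nat \<Rightarrow> nat"
  assumes "(\<Sum>l<k. m l) + i = (\<Sum>l<k'. m l) + i'" "i < m k" "i' < m k'"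
  shows "k = k' \<and> i = i'"
  using assms prefix_sum_mono[of k k' m] prefix_sum_mono[of k' k m]
  by (cases k k' rule: linorder_cases) auto

section \<open>The bound for arbitrary solutions, and dealing clients to copies\<close>

context radius
begin

definition "rank pos v = card {w \<in> cl. pos w = pos v \<and> w < v}"

text \<open>A nonempty cluster lies in a relevant ball, which contains a home client and therefore
  has a single label. In a tree of size \<open>N\<close> the clusters are disjoint and have at least
  \<open>L\<close> clients each, so there are at most \<open>N div L\<close> of them, with at most
  \<open>U\<close> clients each.\<close>

lemma card_served_le:
  assumes G: "grown K fac par rt node h cur"
    and cov: "\<And>g. valid g \<Longrightarrow> \<exists>v\<in>ball g. 0 < h v"
    and S: "feasible I S" "cost I S \<le> r" and Lmax: "L = max 1 (lower I)"
  shows "card (served S) \<le> (\<Sum>c<K. min (label_count rt node c) (label_count rt node c div L * U))"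
proof -
  have F: "is_forest K fac par rt" and A: "is_assigned K fac node h" and C: "is_closed cur rt node h"
    using G by (auto simp: grown_def)
  define D where "D i = {v \<in> served S. assign S v = i}" for i
  \<comment> \<open>Copies serving nobody are legal when the lower bound is 0; dropping them makes
    \<open>max 1 (lower I)\<close> a lower bound on cluster sizes.\<close>
  define P where "P = {i. i < length (centers S) \<and> D i \<noteq> {}}"
  \<comment> \<open>The root of an arbitrary client; all clients of the cluster have the same
    one.\<close>
  define lab where "lab i = rt (node (SOME v. v \<in> D i) - 1)" for i
  have scl: "served S \<subseteq> cl" using S by (simp add: feasible_def)
  then have fin: "finite (served S)" using finite_cl finite_subset by blast
  have finD: "finite (D i)" for i using fin by (simp add: D_def)
  have finP: "finite P" by (simp add: P_def)
  have DL: "L \<le> card (D i)" "card (D i) \<le> U" if "i \<in> P" for i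
  proof -
    have "card (D i) \<noteq> 0" using that finD by (simp add: P_def)
    then show "L \<le> card (D i)" "card (D i) \<le> U"
      using S that Lmax unfolding P_def feasible_def D_def by auto
  qed
  have dist: "d v (centers S ! assign S v) \<le> r" if "v \<in> served S" for v
  proof -
    have "d v (centers S ! assign S v) \<le> Max ((\<lambda>v. d v (centers S ! assign S v)) ` served S)"
      using fin that by (intro Max_ge) auto
    then show ?thesis using S(2) that by (auto simp: cost_def split: if_splits)
  qed
  have Dball: "D i \<subseteq> ball (centers S ! i)" for i
    using dist scl by (auto simp: D_def ball_def)
  have val: "valid (centers S ! i)" if "i \<in> P" for i
  proof -
    have "centers S ! i \<in> facilities I" using S that nth_mem by (auto simp: P_def feasible_def)
    moreover have "card (D i) \<le> card (ball (centers S ! i))" using Dball finite_ball card_mono by blast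
    ultimately show ?thesis using DL[OF that] by (simp add: valid_def)
  qed
  have lab: "0 < node w \<and> rt (node w - 1) = lab i" if i: "i \<in> P" and w: "w \<in> D i" for i w
  proof -
    define v where "v = (SOME v. v \<in> D i)"
    have v: "v \<in> D i" unfolding v_def using w by (rule someI)
    obtain u where u: "u \<in> ball (centers S ! i)" "0 < h u" using cov[OF val[OF i]] by blast
    have "node_label rt node v = node_label rt node w"
      using closed_label[OF C val[OF i] _ _ u(2,1)] v w Dball by blast
    moreover have "0 < node v \<and> 0 < node w"
      using C val[OF i] u v w Dball unfolding is_closed_def by blast
    ultimately show ?thesis by (simp add: node_label_def lab_def v_def)
  qed
  have labK: "lab i < K" if i: "i \<in> P" for i
  proof -
    obtain w where w: "w \<in> D i" using i by (auto simp: P_def)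
    then have "w \<in> cl" using scl by (auto simp: D_def)
    then have "node w - 1 < K" using A lab[OF i w] by (auto simp: is_assigned_def)
    then show ?thesis using F lab[OF i w] unfolding is_forest_def by (metis le_less_trans)
  qed
  have disj: "D i \<inter> D j = {}" if "i \<noteq> j" for i j using that by (auto simp: D_def)
  have part: "(\<Sum>i | i \<in> P \<and> lab i = c. card (D i)) \<le> min (label_count rt node c) (label_count rt node c div L * U)" for c
  proof -
    let ?P = "{i. i \<in> P \<and> lab i = c}"
    have "(\<Sum>i\<in>?P. card (D i)) = card (\<Union>i\<in>?P. D i)"
      by (rule card_UN_disjoint[symmetric]) (use finP finD disj in auto)
    also have "\<dots> \<le> label_count rt node c" unfolding label_count_def
      by (rule card_mono) (use finite_cl lab scl in \<open>auto simp: D_def\<close>)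
    finally have 1: "(\<Sum>i\<in>?P. card (D i)) \<le> label_count rt node c" .
    have "card ?P * L \<le> (\<Sum>i\<in>?P. card (D i))"
      using sum_bounded_below[of ?P L "\<lambda>i. card (D i)"] DL by auto
    then have "card ?P \<le> label_count rt node c div L"
      using 1 L_pos by (simp add: less_eq_div_iff_mult_less_eq)
    moreover have "(\<Sum>i\<in>?P. card (D i)) \<le> card ?P * U"
      using sum_bounded_above[of ?P "\<lambda>i. card (D i)" U] DL by auto
    ultimately show ?thesis using 1 by (meson le_trans min.boundedI mult_le_mono1)
  qed
  have "served S = (\<Union>i\<in>P. D i)"
    using S unfolding feasible_def P_def D_def by auto
  then have "card (served S) = (\<Sum>i\<in>P. card (D i))"
    using card_UN_disjoint[of P D] finP finD disj by auto
  also have "\<dots> = (\<Sum>c<K. \<Sum>i | i \<in> P \<and> lab i = c. card (D i))"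
    using sum.group[OF finP, of "{..<K}" lab "\<lambda>i. card (D i)"] labK by force
  also have "\<dots> \<le> (\<Sum>c<K. min (label_count rt node c) (label_count rt node c div L * U))"
    by (intro sum_mono part)
  finally show ?thesis .
qed

text \<open>The copies of a node start at the prefix sum of the multiplicities, and its clients of
  smallest rank are dealt to them in turn. Centers are described only at positions that some client
  uses.\<close>

definition is_dealt :: "nat \<Rightarrow> (nat \<Rightarrow> nat) \<Rightarrow> (nat \<Rightarrow> nat) \<Rightarrow> (nat \<Rightarrow> nat) \<Rightarrow> nat solution \<Rightarrow> bool" where
  "is_dealt K fac pos m S \<longleftrightarrow>
     served S = {v \<in> cl. 0 < pos v \<and> rank pos v < m (pos v - 1) * U} \<and>
     length (centers S) = (\<Sum>k<K. m k) \<and>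
     (\<forall>v\<in>served S. assign S v = (\<Sum>l<pos v - 1. m l) + rank pos v mod m (pos v - 1) \<and>
        centers S ! assign S v = fac (pos v - 1))"

text \<open>Ranks number the clients of a node bijectively from 0, so counting clients becomes
  counting numbers, and the clients of one copy become a residue class.\<close>

lemma dealt_card:
  assumes "\<forall>v\<in>cl. pos v \<le> K" and S: "is_dealt K fac pos m S"
  shows "card (served S) = (\<Sum>k<K. min (load pos k) (m k * U))"
    and "\<And>k i. k < K \<Longrightarrow> i < m k \<Longrightarrow>
      card {v \<in> served S. assign S v = (\<Sum>l<k. m l) + i} = card {x. x < min (load pos k) (m k * U) \<and> x mod m k = i}"
proof -
  define A where "A k = {v \<in> cl. pos v = Suc k}" for k
  have finA: "finite (A k)" for k using finite_cl by (simp add: A_def)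
  have rank: "rank pos v = card {w \<in> A k. w < v}" if "v \<in> A k" for v k
    using that unfolding rank_def A_def by (intro arg_cong[where f = card]) auto
  have bij: "bij_betw (rank pos) (A k) {..<load pos k}" for k
  proof -
    have "bij_betw (rank pos) (A k) {..<card (A k)} = bij_betw (\<lambda>v. card {w \<in> A k. w < v}) (A k) {..<card (A k)}"
      by (rule bij_betw_cong) (rule rank)
    then show ?thesis using bij_betw_rank[OF finA, of k] by (simp add: load_def A_def)
  qed
  have crd: "card {v \<in> A k. P (rank pos v)} = card {x. x < load pos k \<and> P x}" for k P
  proof -
    have "bij_betw (rank pos) {v \<in> A k. P (rank pos v)} {x. x < load pos k \<and> P x}"
      using bij[of k] unfolding bij_betw_def inj_on_def by auto
    then show ?thesis by (rule bij_betw_same_card)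
  qed
  have m0: "0 < m (pos v - 1)" if "v \<in> served S" for v
    using S that by (cases "m (pos v - 1)") (auto simp: is_dealt_def)
  have "served S = (\<Union>k<K. {v \<in> A k. rank pos v < m k * U})"
  proof (intro equalityI subsetI)
    fix v assume "v \<in> served S"
    then have "v \<in> cl" "0 < pos v" "rank pos v < m (pos v - 1) * U" using S by (auto simp: is_dealt_def)
    moreover from this have "pos v \<le> K" using assms(1) by blast
    ultimately show "v \<in> (\<Union>k<K. {v \<in> A k. rank pos v < m k * U})"
      by (intro UN_I[of "pos v - 1"]) (auto simp: A_def)
  qed (use S in \<open>auto simp: is_dealt_def A_def\<close>)
  then have "card (served S) = (\<Sum>k<K. card {v \<in> A k. rank pos v < m k * U})"
    by (simp only:) (rule card_UN_disjoint, use finite_cl in \<open>auto simp: A_def\<close>)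
  also have "\<dots> = (\<Sum>k<K. min (load pos k) (m k * U))"
  proof (intro sum.cong refl)
    fix k
    have "card {v \<in> A k. rank pos v < m k * U} = card {x. x < load pos k \<and> x < m k * U}"
      by (rule crd[of k "\<lambda>x. x < m k * U"])
    moreover have "{x. x < load pos k \<and> x < m k * U} = {..<min (load pos k) (m k * U)}" by auto
    ultimately show "card {v \<in> A k. rank pos v < m k * U} = min (load pos k) (m k * U)" by simp
  qed
  finally show "card (served S) = (\<Sum>k<K. min (load pos k) (m k * U))" .
  fix k i assume k: "k < K" "i < m k"
  have sub: "{v \<in> served S. assign S v = (\<Sum>l<k. m l) + i} = {v \<in> A k. rank pos v < m k * U \<and> rank pos v mod m k = i}"
  proof (intro equalityI subsetI)
    fix v assume v: "v \<in> {v \<in> served S. assign S v = (\<Sum>l<k. m l) + i}"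
    then have "(\<Sum>l<pos v - 1. m l) + rank pos v mod m (pos v - 1) = (\<Sum>l<k. m l) + i"
      using S by (auto simp: is_dealt_def)
    then have "pos v - 1 = k \<and> rank pos v mod m (pos v - 1) = i"
      by (rule prefix_sum_inject) (use m0 v k in auto)
    then show "v \<in> {v \<in> A k. rank pos v < m k * U \<and> rank pos v mod m k = i}"
      using S v by (auto simp: is_dealt_def A_def)
  qed (use S in \<open>auto simp: is_dealt_def A_def\<close>)
  have "card {v \<in> A k. rank pos v < m k * U \<and> rank pos v mod m k = i} =
      card {x. x < load pos k \<and> x < m k * U \<and> x mod m k = i}"
    by (rule crd[of k "\<lambda>x. x < m k * U \<and> x mod m k = i"])
  moreover have "{x. x < load pos k \<and> x < m k * U \<and> x mod m k = i} = {x. x < min (load pos k) (m k * U) \<and> x mod m k = i}"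
    by auto
  ultimately show "card {v \<in> served S. assign S v = (\<Sum>l<k. m l) + i} =
    card {x. x < min (load pos k) (m k * U) \<and> x mod m k = i}"
    unfolding sub by (simp only:)
qed

lemma dealt_feasible:
  assumes F: "is_forest K fac par rt" and g: "good_pos K fac rt node pos"
    and m: "\<And>k. k < K \<Longrightarrow> m k * L \<le> load pos k" and S: "is_dealt K fac pos m S"
    and target: "target I \<le> card (served S)" and low: "lower I \<le> L"
  shows "feasible I S" "cost I S \<le> 5 * r"
proof -
  have posK: "\<forall>v\<in>cl. pos v \<le> K" using g by (simp add: good_pos_def)
  have m0: "0 < m (pos v - 1)" if "v \<in> served S" for v
    using S that by (cases "m (pos v - 1)") (auto simp: is_dealt_def)
  have size: "L \<le> card {v \<in> served S. assign S v = j} \<and> card {v \<in> served S. assign S v = j} \<le> U"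
    if j: "j < length (centers S)" for j
  proof -
    obtain k i where k: "k < K" "i < m k" "j = (\<Sum>l<k. m l) + i"
      using j S prefix_sum_index unfolding is_dealt_def by metis
    have c: "m k * L \<le> min (load pos k) (m k * U)" "min (load pos k) (m k * U) \<le> m k * U"
      using m[OF k(1)] L_le by auto
    show ?thesis
      using card_residue[OF k(2) c] dealt_card(2)[OF posK S k(1,2)] k(3) by simp
  qed
  have sv: "v \<in> cl" "pos v - 1 < K" "0 < node v" if "v \<in> served S" for v
    using that S g posK by (fastforce simp: is_dealt_def good_pos_def)+
  have idx: "assign S v < length (centers S)" if v: "v \<in> served S" for v
  proof -
    have "assign S v < (\<Sum>l<pos v - 1. m l) + m (pos v - 1)"
      using S v m0[OF v] by (auto simp: is_dealt_def)
    also have "\<dots> \<le> (\<Sum>k<K. m k)" using prefix_sum_mono[of "pos v - 1" K m] sv[OF v] by simp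
    finally show ?thesis using S by (simp add: is_dealt_def)
  qed
  \<comment> \<open>The location of a copy is known only through a client it serves; one exists
    because each copy has at least \<open>L > 0\<close> clients.\<close>
  have "set (centers S) \<subseteq> facilities I"
  proof
    fix u assume "u \<in> set (centers S)"
    then obtain j where j: "j < length (centers S)" "u = centers S ! j" by (auto simp: in_set_conv_nth)
    have "card {v \<in> served S. assign S v = j} > 0" using size[OF j(1)] L_pos by linarith
    then obtain v where v: "v \<in> served S" "assign S v = j" by (force simp: card_gt_0_iff)
    have "centers S ! assign S v = fac (pos v - 1)" using S v(1) unfolding is_dealt_def by blast
    then have "u = fac (pos v - 1)" using v(2) j by simp
    then show "u \<in> facilities I" using F sv[OF v(1)] by (auto simp: is_forest_def valid_def)
  qed
  then show "feasible I S"
    unfolding feasible_def using S target size low idx sv(1) by (auto intro: le_trans)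
  have fin: "finite (served S)" using sv(1) finite_cl by (meson finite_subset subsetI)
  have "d v (centers S ! assign S v) \<le> 5 * r" if "v \<in> served S" for v
  proof -
    have "centers S ! assign S v = fac (pos v - 1)" using S that unfolding is_dealt_def by blast
    then show ?thesis using g sv[OF that] by (simp add: good_pos_def)
  qed
  then show "cost I S \<le> 5 * r"
    using fin r_nonneg by (simp add: cost_def)
qed

end

section \<open>The program\<close>

text \<open>Array names: \<open>a\<dots>\<close> are working arrays, \<open>i\<dots>\<close> loop counters and \<open>o\<dots>\<close> hold the solution for
  the current threshold. Scalars live in cell 0. Node and copy numbers stored per client are shifted
  by one, with 0 for none. \<open>aAcc k\<close> is the part of the surplus granted below node \<open>k\<close>, and
  \<open>aBud c\<close> the part not yet granted in the tree with root \<open>c\<close>.\<close>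

abbreviation (input) "aRow \<equiv> 6 :: nat"
abbreviation (input) "aLow \<equiv> 7 :: nat"
abbreviation (input) "aNode \<equiv> 8 :: nat"
abbreviation (input) "aHome \<equiv> 9 :: nat"
abbreviation (input) "aFac \<equiv> 10 :: nat"
abbreviation (input) "aPar \<equiv> 11 :: nat"
abbreviation (input) "aRoot \<equiv> 12 :: nat"
abbreviation (input) "aNum \<equiv> 13 :: nat"
abbreviation (input) "aBest \<equiv> 14 :: nat"
abbreviation (input) "aBestPar \<equiv> 15 :: nat"
abbreviation (input) "aCnt \<equiv> 16 :: nat"
abbreviation (input) "aHom \<equiv> 17 :: nat"
abbreviation (input) "aAsg \<equiv> 18 :: nat"
abbreviation (input) "iRound \<equiv> 19 :: nat"
abbreviation (input) "iFac \<equiv> 20 :: nat"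
abbreviation (input) "iCl \<equiv> 21 :: nat"
abbreviation (input) "aMul \<equiv> 22 :: nat"
abbreviation (input) "aRem \<equiv> 23 :: nat"
abbreviation (input) "aSlack \<equiv> 24 :: nat"
abbreviation (input) "aQuota \<equiv> 25 :: nat"
abbreviation (input) "aBud \<equiv> 26 :: nat"
abbreviation (input) "aAcc \<equiv> 27 :: nat"
abbreviation (input) "aPos \<equiv> 28 :: nat"
abbreviation (input) "aTodo \<equiv> 29 :: nat"
abbreviation (input) "iNode \<equiv> 30 :: nat"
abbreviation (input) "aQ \<equiv> 31 :: nat"
abbreviation (input) "aX \<equiv> 32 :: nat"
abbreviation (input) "aBase \<equiv> 33 :: nat"
abbreviation (input) "aRank \<equiv> 34 :: nat"
abbreviation (input) "aTurn \<equiv> 35 :: nat"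
abbreviation (input) "aServed \<equiv> 36 :: nat"
abbreviation (input) "aFound \<equiv> 37 :: nat"
abbreviation (input) "iRow \<equiv> 38 :: nat"
abbreviation (input) "iCol \<equiv> 39 :: nat"
abbreviation (input) "aOff \<equiv> 40 :: nat"
abbreviation (input) "aJ \<equiv> 41 :: nat"
abbreviation (input) "oNum \<equiv> 43 :: nat"
abbreviation (input) "oCenters \<equiv> 44 :: nat"
abbreviation (input) "oAssign \<equiv> 45 :: nat"

abbreviation (input) "sc a \<equiv> IGet a (IConst 0)"
abbreviation (input) "setsc a e \<equiv> ISet a (IConst 0) e"
abbreviation (input) "inc e \<equiv> IAdd e (IConst (Suc 0))"
abbreviation (input) "dec e \<equiv> ISub e (IConst (Suc 0))"
abbreviation (input) "nz e \<equiv> ILess (IConst 0) e"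
abbreviation (input) "ieq e f \<equiv> BAnd (BNot (ILess e f)) (BNot (ILess f e))"
abbreviation (input) "When b c \<equiv> Cond b c Skip"

fun Block :: "com list \<Rightarrow> com" where
  "Block [] = Skip"
| "Block (c # cs) = Seq c (Block cs)"

section \<open>Program code and specification for growing the forest\<close>

definition "near v f = BAnd (nz (IGet 1 v)) (BNot (RLess (RGet 1 (IConst 0)) (RGet 0 (IAdd (IGet aRow v) f))))"

definition "scan = Block [
  setsc aCnt (IConst 0), setsc aHom (IConst 0), setsc aAsg (IConst 0),
  For iCl (When (near (sc iCl) (sc iFac)) (Block [
    setsc aCnt (inc (sc aCnt)),
    When (nz (IGet aHome (sc iCl))) (setsc aHom (IConst 1)),
    When (nz (IGet aNode (sc iCl))) (setsc aAsg (IGet aNode (sc iCl)))]))]"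

text \<open>A candidate replaces the current choice if there is none yet or if its ball meets an
  attached client. So a final choice with \<open>aBestPar\<close> equal to 0 certifies that no
  candidate meets the trees, which legitimates a new root.\<close>

definition "select = Block [
  setsc aBest (IConst 0), setsc aBestPar (IConst 0),
  For iFac (When (nz (IGet 2 (sc iFac))) (Block [
    scan,
    When (BAnd (BNot (ILess (sc aCnt) (sc aLow))) (BAnd (BNot (nz (sc aHom)))
        (BNot (BAnd (nz (sc aBest)) (BNot (nz (sc aAsg))))))) (Block [
      setsc aBest (inc (sc iFac)), setsc aBestPar (sc aAsg)])]))]"

definition "mark = For iCl (When (near (sc iCl) (dec (sc aBest))) (Block [
  ISet aNode (sc iCl) (sc aNum), ISet aHome (sc iCl) (IConst 1)]))"

definition "spread_ball = For iCl (When (BAnd (near (sc iCl) (sc iFac)) (BNot (nz (IGet aNode (sc iCl)))))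
  (ISet aNode (sc iCl) (sc aNum)))"

definition "spread = For iFac (When (nz (IGet 2 (sc iFac))) (Block [
  scan,
  When (BAnd (BNot (ILess (sc aCnt) (sc aLow))) (nz (sc aHom))) spread_ball]))"

text \<open>\<open>aNum\<close> is incremented before \<open>mark\<close> and \<open>spread\<close>,
  where it serves as the shifted number of the new node.\<close>

definition "add_node = Block [
  ISet aFac (sc aNum) (dec (sc aBest)),
  ISet aPar (sc aNum) (sc aBestPar),
  Cond (nz (sc aBestPar))
    (ISet aRoot (sc aNum) (IGet aRoot (dec (sc aBestPar))))
    (ISet aRoot (sc aNum) (sc aNum)),
  setsc aNum (inc (sc aNum)),
  mark, spread]"

definition "grow = For iRound (Seq select (When (nz (sc aBest)) add_node))"

lemma writes_grow [simp]:
  "writes scan = {aCnt, aHom, aAsg, iCl}" "real_writes scan = {}"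
  "writes select = {aBest, aBestPar, iFac, aCnt, aHom, aAsg, iCl}" "real_writes select = {}"
  "writes mark = {iCl, aNode, aHome}" "real_writes mark = {}"
  "writes spread_ball = {iCl, aNode}" "real_writes spread_ball = {}"
  "writes spread = {iFac, aCnt, aHom, aAsg, iCl, aNode}" "real_writes spread = {}"
  "writes add_node = {aFac, aPar, aRoot, aNum, aNode, aHome, iCl, iFac, aCnt, aHom, aAsg}" "real_writes add_node = {}"
  "writes grow = {aBest, aBestPar, iFac, aCnt, aHom, aAsg, iCl, aFac, aPar, aRoot, aNum, aNode, aHome, iRound}" "real_writes grow = {}"
  by (auto simp: scan_def select_def mark_def spread_ball_def spread_def add_node_def grow_def)

lemma Int_lessThan_Suc: "A \<inter> {..<Suc i} = (if i \<in> A then insert i (A \<inter> {..<i}) else A \<inter> {..<i})"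
  by (auto simp: less_Suc_eq)

locale run = radius +
  fixes n :: nat
  assumes pts: "points I = {..<n}"
begin

lemma cl_less: "v \<in> cl \<Longrightarrow> v < n"
  using pts by auto

lemma fa_less: "f \<in> facilities I \<Longrightarrow> f < n"
  using pts by auto

lemma ball_less: "v \<in> ball f \<Longrightarrow> v < n"
  using cl_less ball_sub by blast

lemma ball_Int: "ball f \<inter> {..<n} = ball f"
  using ball_less by blast

text \<open>\<open>aRow v\<close> caches the row offset \<open>v * n\<close> of the distance matrix,
  because indices cannot be computed by multiplication.\<close>

definition "env s \<longleftrightarrow> imem s 0 0 = n \<and> imem s 0 2 = U \<and> (\<forall>v<n. 0 < imem s 1 v \<longleftrightarrow> v \<in> cl) \<and>
  (\<forall>f<n. 0 < imem s 2 f \<longleftrightarrow> f \<in> facilities I) \<and> (\<forall>v<n. imem s aRow v = v * n) \<and>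
  imem s aLow 0 = L \<and> (\<forall>i<n * n. rmem s 0 i = d (i div n) (i mod n)) \<and> rmem s 1 0 = r"

lemma env_frame:
  assumes "env s" "frame c s s'" "writes c \<inter> {0, 1, 2, aRow, aLow} = {}" "real_writes c = {}"
  shows "env s'"
proof -
  have "imem s' a = imem s a" if "a \<in> {0, 1, 2, aRow, aLow}" for a
  proof -
    have "a \<notin> writes c" using assms(3) that by blast
    then show ?thesis using assms(2) by (simp add: frame_def)
  qed
  moreover have "rmem s' = rmem s" using assms(2,4) by (auto simp: frame_def)
  ultimately show ?thesis using assms(1) by (simp add: env_def)
qed

lemma env_iset [simp]: "a \<notin> {0, 1, 2, aRow, aLow} \<Longrightarrow> env (iset a i x s) = env s"
  by (auto simp: env_def)

lemma near_iff:
  assumes "env s" "ival e s < n" "ival f s < n"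
  shows "bval (near e f) s \<longleftrightarrow> ival e s \<in> ball (ival f s)"
proof -
  have "ival e s * n + n \<le> n * n"
    using mult_le_mono1[of "Suc (ival e s)" n n] assms(2) by simp
  then have "ival e s * n + ival f s < n * n" using assms(3) by linarith
  then have "rmem s 0 (ival e s * n + ival f s) = d (ival e s) (ival f s)"
    using assms by (simp add: env_def)
  then show ?thesis using assms by (auto simp: near_def env_def ball_def)
qed

lemma scan_spec:
  assumes e: "env s" and f: "imem s iFac 0 < n"
  shows "wlp scan (\<lambda>s'. imem s' aCnt 0 = card (ball (imem s iFac 0)) \<and>
     (0 < imem s' aHom 0 \<longleftrightarrow> (\<exists>v\<in>ball (imem s iFac 0). 0 < imem s aHome v)) \<and>
     (0 < imem s' aAsg 0 \<longleftrightarrow> (\<exists>v\<in>ball (imem s iFac 0). 0 < imem s aNode v)) \<and>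
     (0 < imem s' aAsg 0 \<longrightarrow> (\<exists>v\<in>ball (imem s iFac 0). imem s aNode v = imem s' aAsg 0))) s"
proof -
  define B where "B = ball (imem s iFac 0)"
  have fin: "finite B" by (simp add: B_def finite_ball)
  have Bn: "B \<inter> {..<n} = B" by (simp add: B_def ball_Int)
  show ?thesis
    unfolding scan_def B_def[symmetric]
    apply simp
    apply (rule wlp_For[where J = "\<lambda>i t. imem t aCnt 0 = card (B \<inter> {..<i}) \<and>
     (0 < imem t aHom 0 \<longleftrightarrow> (\<exists>v\<in>B \<inter> {..<i}. 0 < imem s aHome v)) \<and>
     (0 < imem t aAsg 0 \<longleftrightarrow> (\<exists>v\<in>B \<inter> {..<i}. 0 < imem s aNode v)) \<and>
     (0 < imem t aAsg 0 \<longrightarrow> (\<exists>v\<in>B \<inter> {..<i}. imem s aNode v = imem t aAsg 0))"])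
         apply (simp_all)[4]
    subgoal premises prems for i t
    proof -
      have n: "imem s 0 0 = n" using e by (simp add: env_def)
      have fr: "imem t aHome = imem s aHome" "imem t aNode = imem s aNode" "imem t iFac = imem s iFac"
        using prems(4) by (simp_all add: frame_def)
      have et: "env t" using env_frame[OF _ prems(4)] e by simp
      have nb: "bval (near (sc iCl) (sc iFac)) t \<longleftrightarrow> i \<in> B"
        using near_iff[OF et, of "sc iCl" "sc iFac"] prems(1,3) f n fr by (simp add: B_def)
      show ?thesis
        using prems(2,3) fr fin by (simp add: nb Int_lessThan_Suc)
    qed
    subgoal for t
      using Bn e by (simp add: env_def)
    done
qed

definition "cand s f \<longleftrightarrow> valid f \<and> (\<forall>v\<in>ball f. imem s aHome v = 0)"

lemma select_spec:
  assumes e: "env s"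
  shows "wlp select (\<lambda>s'. (imem s' aBest 0 = 0 \<longrightarrow> (\<forall>f. \<not> cand s f)) \<and>
     (0 < imem s' aBest 0 \<longrightarrow> cand s (imem s' aBest 0 - 1) \<and>
       (imem s' aBestPar 0 = 0 \<longrightarrow> (\<forall>f. cand s f \<longrightarrow> (\<forall>v\<in>ball f. imem s aNode v = 0))) \<and>
       (0 < imem s' aBestPar 0 \<longrightarrow> (\<exists>v\<in>ball (imem s' aBest 0 - 1). imem s aNode v = imem s' aBestPar 0)))) s"
  unfolding select_def
  apply simp
  apply (rule wlp_For[where J = "\<lambda>i t. (imem t aBest 0 = 0 \<longrightarrow> (\<forall>f<i. \<not> cand s f)) \<and>
     (0 < imem t aBest 0 \<longrightarrow> cand s (imem t aBest 0 - 1) \<and>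
       (imem t aBestPar 0 = 0 \<longrightarrow> (\<forall>f<i. cand s f \<longrightarrow> (\<forall>v\<in>ball f. imem s aNode v = 0))) \<and>
       (0 < imem t aBestPar 0 \<longrightarrow> (\<exists>v\<in>ball (imem t aBest 0 - 1). imem s aNode v = imem t aBestPar 0)))"])
       apply (simp_all)[4]
  subgoal premises prems for i t
  proof -
    have n: "imem s 0 0 = n" using e by (simp add: env_def)
    have i: "i < n" using prems(1) n by simp
    have fr: "imem t aHome = imem s aHome" "imem t aNode = imem s aNode"
      using prems(4) by (simp_all add: frame_def)
    have et: "env t" using env_frame[OF _ prems(4)] e by simp
    have fa: "0 < imem t 2 i \<longleftrightarrow> i \<in> facilities I" using et i by (simp add: env_def)
    show ?thesis
    proof (cases "i \<in> facilities I")
      case False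
      then have "\<not> cand s i" by (simp add: cand_def valid_def)
      then show ?thesis using False fa prems(2,3) by (auto simp: less_Suc_eq)
    next
      case True
      have sp: "wlp scan (\<lambda>s'. imem s' aCnt 0 = card (ball i) \<and>
     (0 < imem s' aHom 0 \<longleftrightarrow> (\<exists>v\<in>ball i. 0 < imem s aHome v)) \<and>
     (0 < imem s' aAsg 0 \<longleftrightarrow> (\<exists>v\<in>ball i. 0 < imem s aNode v)) \<and>
     (0 < imem s' aAsg 0 \<longrightarrow> (\<exists>v\<in>ball i. imem s aNode v = imem s' aAsg 0))) t"
        using scan_spec[OF et] i fr prems(3) by simp
      show ?thesis
        using True fa prems(3)
        apply simp
        apply (rule wlp_frame[OF sp])
        subgoal premises p2 for u
        proof -
          have fu: "imem u iFac 0 = i" "imem u aBest = imem t aBest" "imem u aBestPar = imem t aBestPar"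
            "imem u aLow 0 = L"
            using p2 et prems(3) by (auto simp: frame_def env_def)
          have c: "cand s i \<longleftrightarrow> \<not> imem u aCnt 0 < L \<and> imem u aHom 0 = 0"
            using p2 True by (auto simp: cand_def valid_def)
          have "(\<forall>v\<in>ball i. imem s aNode v = 0) \<longleftrightarrow> imem u aAsg 0 = 0" using p2 by auto
          then show ?thesis
            using fu c p2 prems(2) by (auto simp: less_Suc_eq)
        qed
        done
    qed
  qed
  subgoal premises prems for t
  proof -
    have n: "imem s 0 0 = n" using e by (simp add: env_def)
    have "cand s f \<longrightarrow> f < n" for f using fa_less by (auto simp: cand_def valid_def)
    then show ?thesis using prems(1) n by auto
  qed
  done

end

context run
begin

lemma env_n: "env s \<Longrightarrow> imem s 0 0 = n"
  by (simp add: env_def)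

lemma mark_spec:
  assumes e: "env s" and f: "imem s aBest 0 = Suc f" "f < n"
  shows "wlp mark (\<lambda>t. \<forall>v<n. imem t aNode v = (if v \<in> ball f then imem s aNum 0 else imem s aNode v) \<and>
     imem t aHome v = (if v \<in> ball f then 1 else imem s aHome v)) s"
  unfolding mark_def
  apply (rule wlp_For[where J = "\<lambda>i t. \<forall>v<n. imem t aNode v = (if v \<in> ball f \<and> v < i then imem s aNum 0 else imem s aNode v) \<and>
     imem t aHome v = (if v \<in> ball f \<and> v < i then 1 else imem s aHome v)"])
       apply (simp_all)[4]
  subgoal premises prems for i t
  proof -
    have et: "env t" using env_frame[OF e prems(4)] by simp
    have fr: "imem t aNum = imem s aNum" "imem t aBest = imem s aBest"
      using prems(4) by (simp_all add: frame_def)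
    have nb: "bval (near (sc iCl) (dec (sc aBest))) t \<longleftrightarrow> i \<in> ball f"
      using near_iff[OF et, of "sc iCl" "dec (sc aBest)"] prems(1,3) f env_n[OF e] fr by simp
    show ?thesis
      using prems(2,3) fr by (simp add: nb less_Suc_eq) auto
  qed
  subgoal for t
    using env_n[OF e] by simp
  done

lemma spread_ball_spec:
  assumes e: "env s" and f: "imem s iFac 0 = f" "f < n"
  shows "wlp spread_ball (\<lambda>t. \<forall>v<n. imem t aNode v =
    (if imem s aNode v = 0 \<and> v \<in> ball f then imem s aNum 0 else imem s aNode v)) s"
  unfolding spread_ball_def
  apply (rule wlp_For[where J = "\<lambda>i t. \<forall>v<n. imem t aNode v =
    (if imem s aNode v = 0 \<and> v \<in> ball f \<and> v < i then imem s aNum 0 else imem s aNode v)"])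
       apply (simp_all)[4]
  subgoal premises prems for i t
  proof -
    have et: "env t" using env_frame[OF e prems(4)] by simp
    have fr: "imem t aNum = imem s aNum" "imem t iFac = imem s iFac"
      using prems(4) by (simp_all add: frame_def)
    have nb: "bval (near (sc iCl) (sc iFac)) t \<longleftrightarrow> i \<in> ball f"
      using near_iff[OF et, of "sc iCl" "sc iFac"] prems(1,3) f env_n[OF e] fr by simp
    have i: "i < n" using prems(1) env_n[OF e] by simp
    then have "imem t aNode i = imem s aNode i" using prems(2) by simp
    then show ?thesis
      using prems(2,3) fr by (simp add: nb less_Suc_eq) auto
  qed
  subgoal for t
    using env_n[OF e] by (auto dest: ball_less)
  done

definition "touched h g \<longleftrightarrow> valid g \<and> (\<exists>w\<in>ball g. 0 < (h w :: nat))"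

text \<open>Nodes change during the loop, but the new value is positive, so each initially free
  client is attached only once. \<open>aHome\<close> is constant here, which fixes the set of
  touched balls.\<close>

lemma spread_spec:
  assumes e: "env s" and K: "0 < imem s aNum 0"
  shows "wlp spread (\<lambda>t. \<forall>v<n. imem t aNode v =
    (if imem s aNode v = 0 \<and> (\<exists>g. touched (imem s aHome) g \<and> v \<in> ball g) then imem s aNum 0 else imem s aNode v)) s"
proof -
  define N where "N i v = (if imem s aNode v = 0 \<and> (\<exists>g<i. touched (imem s aHome) g \<and> v \<in> ball g)
    then imem s aNum 0 else imem s aNode v)" for i v
  have N0: "N 0 v = imem s aNode v" for v by (simp add: N_def)
  have N_Suc: "N (Suc i) v = (if N i v = 0 \<and> v \<in> ball i then imem s aNum 0 else N i v)"
    if "touched (imem s aHome) i" for i v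
    using that K by (auto simp: N_def less_Suc_eq)
  have N_same: "N (Suc i) v = N i v" if "\<not> touched (imem s aHome) i" for i v
    using that by (auto simp: N_def less_Suc_eq)
  have "(\<exists>g<n. touched (imem s aHome) g \<and> v \<in> ball g) \<longleftrightarrow> (\<exists>g. touched (imem s aHome) g \<and> v \<in> ball g)" for v
    using fa_less unfolding touched_def valid_def by blast
  then have Nn: "(if imem s aNode v = 0 \<and> (\<exists>g. touched (imem s aHome) g \<and> v \<in> ball g)
      then imem s aNum 0 else imem s aNode v) = N n v" for v
    by (simp add: N_def)
  show ?thesis
    unfolding spread_def Nn
    apply (rule wlp_For[where J = "\<lambda>i t. \<forall>v<n. imem t aNode v = N i v"])
         apply (simp_all add: N0)[4]
    subgoal premises prems for i t
    proof -
      have et: "env t" using env_frame[OF e prems(4)] by simp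
      have fr: "imem t aNum = imem s aNum" "imem t aHome = imem s aHome"
        using prems(4) by (simp_all add: frame_def)
      have i: "i < n" using prems(1) env_n[OF e] by simp
      have fa: "0 < imem t 2 i \<longleftrightarrow> i \<in> facilities I" using et i by (simp add: env_def)
      show ?thesis
      proof (cases "i \<in> facilities I")
        case False
        then have "\<not> touched (imem s aHome) i" by (simp add: touched_def valid_def)
        then show ?thesis using False fa prems(2,3) by (simp add: N_same)
      next
        case True
        have it: "imem t iFac 0 < n" using i prems(3) by simp
        show ?thesis
          using True fa prems(3)
          apply simp
          apply (rule wlp_frame[OF scan_spec[OF et it]])
          subgoal premises p2 for u
          proof -
            have eu: "env u" using env_frame[OF et p2(5)] by simp
            have fu: "imem u iFac 0 = i" "imem u aNode = imem t aNode" "imem u aNum = imem s aNum"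
              "imem u aLow 0 = L"
              using p2(5) et prems(3) fr by (auto simp: frame_def env_def)
            have c: "\<not> imem u aCnt 0 < L \<and> 0 < imem u aHom 0 \<longleftrightarrow> touched (imem s aHome) i"
              using p2(4) True fr prems(3) by (auto simp: touched_def valid_def)
            show ?thesis
            proof (cases "touched (imem s aHome) i")
              case False
              then have "imem u aCnt 0 < L \<or> imem u aHom 0 = 0" using c by auto
              then show ?thesis using False fu prems(2) by (auto simp: N_same)
            next
              case True
              then have "\<not> imem u aCnt 0 < L" "0 < imem u aHom 0" using c by auto
              then show ?thesis
                using fu
                apply simp
                apply (rule wlp_frame[OF spread_ball_spec[OF eu fu(1) i]])
                using prems(2) by (simp add: N_Suc[OF True])
            qed
          qed
          done
      qed
    qed
    subgoal for t
      using env_n[OF e] by simp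
    done
qed

definition "is_grown s \<longleftrightarrow> (\<exists>cur. grown (imem s aNum 0) (imem s aFac) (imem s aPar) (imem s aRoot)
  (imem s aNode) (imem s aHome) cur)"

lemma is_grown_iset [simp]:
  "a \<notin> {aNum, aFac, aPar, aRoot, aNode, aHome} \<Longrightarrow> is_grown (iset a i x s) = is_grown s"
  by (simp add: is_grown_def)

lemma add_node_spec:
  assumes e: "env s" and G: "is_grown s"
    and f: "imem s aBest 0 = Suc f" "cand s f"
    and p: "imem s aBestPar 0 = 0 \<Longrightarrow> (\<forall>f. cand s f \<longrightarrow> (\<forall>v\<in>ball f. imem s aNode v = 0))"
     "0 < imem s aBestPar 0 \<Longrightarrow> (\<exists>v\<in>ball f. imem s aNode v = imem s aBestPar 0)"
  shows "wlp add_node (\<lambda>t. is_grown t \<and> imem t aNum 0 = Suc (imem s aNum 0) \<and>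
    (\<forall>v\<in>cl. 0 < imem t aHome v \<longleftrightarrow> 0 < imem s aHome v \<or> v \<in> ball f)) s"
proof -
  define K where "K = imem s aNum 0"
  define p where "p = imem s aBestPar 0"
  define c where "c = (if 0 < p then imem s aRoot (p - 1) else K)"
  define s1 where "s1 = iset aNum 0 (Suc K) (iset aRoot K c (iset aPar K p (iset aFac K f s)))"
  have fn: "f < n" using f(2) fa_less by (simp add: cand_def valid_def)
  obtain cur where G: "grown K (imem s aFac) (imem s aPar) (imem s aRoot) (imem s aNode) (imem s aHome) cur"
    using G unfolding is_grown_def K_def by blast
  have s1: "wlp add_node Q s = wlp mark (wlp spread Q) s1" for Q
    unfolding add_node_def s1_def using f(1) by (simp add: p_def[symmetric] K_def[symmetric] c_def)
  have e1: "env s1" using e by (simp add: s1_def)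
  have b1: "imem s1 aBest 0 = Suc f" using f by (simp add: s1_def)
  show ?thesis
    unfolding s1
  proof (rule wlp_frame[OF mark_spec[OF e1 b1 fn]])
    fix t assume t: "\<forall>v<n. imem t aNode v = (if v \<in> ball f then imem s1 aNum 0 else imem s1 aNode v) \<and>
     imem t aHome v = (if v \<in> ball f then 1 else imem s1 aHome v)" and ft: "frame mark s1 t"
    have et: "env t" using env_frame[OF e1 ft] by simp
    have Kt: "imem t aNum 0 = Suc K" using ft by (simp add: frame_def s1_def)
    show "wlp spread (\<lambda>t. is_grown t \<and> imem t aNum 0 = Suc (imem s aNum 0) \<and>
      (\<forall>v\<in>cl. 0 < imem t aHome v \<longleftrightarrow> 0 < imem s aHome v \<or> v \<in> ball f)) t"
    proof (rule wlp_frame[OF spread_spec[OF et]])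
      show "0 < imem t aNum 0" using Kt by simp
      fix u assume u: "\<forall>v<n. imem u aNode v =
        (if imem t aNode v = 0 \<and> (\<exists>g. touched (imem t aHome) g \<and> v \<in> ball g) then imem t aNum 0 else imem t aNode v)"
        and fu: "frame spread t u"
      have fr: "imem u aNum 0 = Suc K" "imem u aFac = (imem s aFac)(K := f)" "imem u aPar = (imem s aPar)(K := p)"
        "imem u aRoot = (imem s aRoot)(K := c)" "imem u aHome = imem t aHome"
        using fu ft by (auto simp: frame_def s1_def)
      have h: "0 < imem u aHome v \<longleftrightarrow> 0 < imem s aHome v \<or> v \<in> ball f" if "v \<in> cl" for v
        using t cl_less[OF that] fr by (simp add: s1_def)
      have nd: "imem u aNode v = (if v \<in> ball f \<or> imem s aNode v = 0 \<and>
         (\<exists>g. valid g \<and> v \<in> ball g \<and> (\<exists>w\<in>ball g. 0 < imem u aHome w)) then Suc K else imem s aNode v)"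
        if "v \<in> cl" for v
      proof -
        have "imem t aNode v = (if v \<in> ball f then Suc K else imem s aNode v)"
          using t cl_less[OF that] by (simp add: s1_def)
        moreover have eq: "(\<exists>g. valid g \<and> v \<in> ball g \<and> (\<exists>w\<in>ball g. 0 < imem u aHome w)) \<longleftrightarrow>
            (\<exists>g. touched (imem t aHome) g \<and> v \<in> ball g)"
          unfolding touched_def fr by blast
        ultimately show ?thesis unfolding eq using u cl_less[OF that] Kt by simp
      qed
      have "\<exists>cur. grown (Suc K) ((imem s aFac)(K := f)) ((imem s aPar)(K := p)) ((imem s aRoot)(K := c))
         (imem u aNode) (imem u aHome) cur"
      proof (rule grown_extend[OF G _ _ _ h nd])
        show "valid f" "\<forall>v\<in>ball f. imem s aHome v = 0" using f(2) by (auto simp: cand_def)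
        show "p = 0 \<and> c = K \<and> (\<forall>g. valid g \<longrightarrow> (\<forall>v\<in>ball g. imem s aNode v = 0) \<or> (\<exists>v\<in>ball g. 0 < imem s aHome v)) \<or>
          0 < p \<and> c = imem s aRoot (p - 1) \<and> (\<exists>v\<in>ball f. imem s aNode v = p)"
        proof (cases "p = 0")
          case True
          then have "\<forall>g. cand s g \<longrightarrow> (\<forall>v\<in>ball g. imem s aNode v = 0)" using assms(5) p_def by simp
          then show ?thesis using True c_def unfolding cand_def by auto
        next
          case False
          then show ?thesis using assms(6) by (simp add: p_def c_def)
        qed
      qed
      then show "is_grown u \<and> imem u aNum 0 = Suc (imem s aNum 0) \<and>
        (\<forall>v\<in>cl. 0 < imem u aHome v \<longleftrightarrow> 0 < imem s aHome v \<or> v \<in> ball f)"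
        using h unfolding is_grown_def fr K_def by simp
    qed
  qed
qed

text \<open>A selected ball has at least \<open>L > 0\<close> clients and no home client, so each
  new node increases the number of home clients. After \<open>n\<close> rounds either no candidate
  is left or all points are home clients, and the latter also rules out candidates.\<close>

lemma grow_spec:
  assumes e: "env s" and z: "imem s aNum 0 = 0" "\<forall>v<n. imem s aNode v = 0" "\<forall>v<n. imem s aHome v = 0"
  shows "wlp grow (\<lambda>t. is_grown t \<and> imem t aNum 0 \<le> n \<and> (\<forall>g. valid g \<longrightarrow> (\<exists>v\<in>ball g. 0 < imem t aHome v))) s"
  unfolding grow_def
  apply (rule wlp_For[where J = "\<lambda>i t. is_grown t \<and> imem t aNum 0 \<le> i \<and>
    ((\<forall>f. \<not> cand t f) \<or> i \<le> card {v \<in> cl. 0 < imem t aHome v})"])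
       apply (simp_all)[3]
  subgoal
  proof -
    have "grown 0 (imem s aFac) (imem s aPar) (imem s aRoot) (imem s aNode) (imem s aHome) 0"
      using z cl_less ball_less
      by (simp add: grown_def is_forest_def is_assigned_def is_closed_def node_label_def)
    then show ?thesis using z(1) by (auto simp: is_grown_def)
  qed
  subgoal premises prems for i t
  proof -
    have et: "env t" using env_frame[OF e prems(4)] by simp
    show ?thesis
      apply simp
      apply (rule wlp_frame[OF select_spec[OF et]])
      subgoal premises p2 for u
      proof -
        have eu: "env u" using env_frame[OF et p2(2)] by simp
        have fu: "imem u a = imem t a" if "a \<in> {aNum, aFac, aPar, aRoot, aNode, aHome}" for a
          using p2(2) that by (auto simp: frame_def)
        have cu: "cand u = cand t" using fu by (simp add: cand_def fun_eq_iff)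
        have gu: "is_grown u" using prems(2) fu by (simp add: is_grown_def)
        show ?thesis
        proof (cases "imem u aBest 0")
          case 0
          then have "\<forall>f. \<not> cand t f" using p2(1) by blast
          then show ?thesis using 0 prems(2) gu fu cu by (simp add: cand_def)
        next
          case (Suc f)
          then have c: "cand u f" using p2(1) cu by simp
          have sp: "wlp add_node (\<lambda>t'. is_grown t' \<and> imem t' aNum 0 = Suc (imem u aNum 0) \<and>
            (\<forall>v\<in>cl. 0 < imem t' aHome v \<longleftrightarrow> 0 < imem u aHome v \<or> v \<in> ball f)) u"
            by (rule add_node_spec[OF eu gu Suc c]) (use p2(1) Suc cu fu in auto)
          show ?thesis
            using Suc
            apply simp
            apply (rule wlp_frame[OF sp])
            subgoal premises p3 for w
            proof -
              have "{v \<in> cl. 0 < imem w aHome v} = {v \<in> cl. 0 < imem t aHome v} \<union> ball f"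
                using p3(2) fu ball_sub by auto
              moreover have "{v \<in> cl. 0 < imem t aHome v} \<inter> ball f = {}"
                using c fu by (auto simp: cand_def)
              ultimately have "card {v \<in> cl. 0 < imem w aHome v} = card {v \<in> cl. 0 < imem t aHome v} + card (ball f)"
                using finite_cl finite_ball by (simp add: card_Un_disjoint)
              moreover have "0 < card (ball f)" using c L_pos by (simp add: cand_def valid_def)
              moreover have "i \<le> card {v \<in> cl. 0 < imem t aHome v}" using prems(2) c cu by auto
              ultimately show ?thesis using p3(2) prems(2) fu by simp
            qed
            done
        qed
      qed
      done
  qed
  subgoal premises prems for t
  proof -
    have "\<not> cand t f" for f
    proof
      assume f: "cand t f"
      then have "n \<le> card {v \<in> cl. 0 < imem t aHome v}" using prems(1) env_n[OF e] by auto
      moreover have "{v \<in> cl. 0 < imem t aHome v} \<subseteq> {..<n}" using cl_less by auto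
      ultimately have "{v \<in> cl. 0 < imem t aHome v} = {..<n}"
        by (metis card_lessThan card_seteq finite_lessThan)
      then have "v \<notin> ball f" for v
        using f ball_less[of v f] unfolding cand_def by (metis (no_types, lifting) lessThan_iff mem_Collect_eq less_irrefl)
      then have "ball f = {}" by blast
      then show False using f L_pos by (simp add: cand_def valid_def)
    qed
    then show ?thesis using prems(1) env_n[OF e] by (auto simp: cand_def)
  qed
  done

end

section \<open>Program code and specification for balancing\<close>

definition "carry x = Block [
  ISet aRem (sc aQ) (IAdd (IGet aRem (sc aQ)) x),
  When (BNot (ILess (IGet aRem (sc aQ)) (sc aLow))) (Block [
    ISet aRem (sc aQ) (ISub (IGet aRem (sc aQ)) (sc aLow)),
    ISet aMul (sc aQ) (inc (IGet aMul (sc aQ))),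
    ISet aSlack (sc aQ) (IAdd (IGet aSlack (sc aQ)) (ISub (IGet 0 (IConst 2)) (sc aLow))),
    ISet aQuota (sc aQ) (IAdd (IGet aQuota (sc aQ)) (IGet 0 (IConst 2)))])]"

text \<open>Counting one client at a time replaces division: \<open>carry\<close> builds quotient
  and remainder of each load by \<open>L\<close>, and \<open>aBud\<close> wraps at \<open>L\<close>
  to hold the tree size modulo \<open>L\<close>.\<close>

definition "count_nodes = For iCl (Block [
  ISet aPos (sc iCl) (IGet aNode (sc iCl)),
  When (BAnd (nz (IGet 1 (sc iCl))) (nz (IGet aNode (sc iCl)))) (Block [
    setsc aQ (dec (IGet aNode (sc iCl))),
    carry (IConst (Suc 0)),
    setsc aX (IGet aRoot (sc aQ)),
    ISet aBud (sc aX) (inc (IGet aBud (sc aX))),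
    When (BNot (ILess (IGet aBud (sc aX)) (sc aLow))) (ISet aBud (sc aX) (IConst 0))])])"

definition "movable a = BAnd (nz (sc aTodo)) (BAnd (nz (IGet 1 (sc iCl))) (BAnd (nz (IGet aHome (sc iCl)))
    (BAnd (ieq (IGet aNode (sc iCl)) (inc (sc a))) (ieq (IGet aPos (sc iCl)) (inc (sc a))))))"

definition "move a b = For iCl (When (movable a)
  (Block [ISet aPos (sc iCl) (inc (sc b)), setsc aTodo (dec (sc aTodo))]))"

text \<open>On entry \<open>aX\<close> is the amount granted at or below \<open>aJ\<close>. Of the
  two truncated differences at most one is positive.\<close>

definition "flow_exchange = Block [
  setsc aQ (dec (IGet aPar (sc aJ))),
  carry (IGet aRem (sc aJ)),
  ISet aAcc (sc aQ) (IAdd (IGet aAcc (sc aQ)) (sc aX)),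
  setsc aTodo (ISub (IGet aRem (sc aJ)) (sc aX)), move aJ aQ,
  setsc aTodo (ISub (sc aX) (IGet aRem (sc aJ))), move aQ aJ]"

definition "flow_node = Block [
  setsc aX (IGet aBud (IGet aRoot (sc aJ))),
  When (ILess (IGet aSlack (sc aJ)) (sc aX)) (setsc aX (IGet aSlack (sc aJ))),
  ISet aBud (IGet aRoot (sc aJ)) (ISub (IGet aBud (IGet aRoot (sc aJ))) (sc aX)),
  setsc aX (IAdd (IGet aAcc (sc aJ)) (sc aX)),
  When (nz (IGet aPar (sc aJ))) flow_exchange]"

text \<open>\<open>aJ\<close> runs downward; parents have smaller indices, so each node comes after
  all its children.\<close>

definition "balance = For iNode (When (ILess (sc iNode) (sc aNum)) (Block [
  setsc aJ (ISub (dec (sc aNum)) (sc iNode)), flow_node]))"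

lemma writes_balance [simp]:
  "writes (carry x) = {aRem, aMul, aSlack, aQuota}" "real_writes (carry x) = {}"
  "writes count_nodes = {iCl, aPos, aQ, aX, aBud, aRem, aMul, aSlack, aQuota}" "real_writes count_nodes = {}"
  "writes (move a b) = {iCl, aPos, aTodo}" "real_writes (move a b) = {}"
  "writes flow_exchange = {aQ, aRem, aMul, aSlack, aQuota, aAcc, aTodo, iCl, aPos}" "real_writes flow_exchange = {}"
  "writes flow_node = {aX, aBud, aQ, aRem, aMul, aSlack, aQuota, aAcc, aTodo, iCl, aPos}" "real_writes flow_node = {}"
  "writes balance = {iNode, aJ, aX, aBud, aQ, aRem, aMul, aSlack, aQuota, aAcc, aTodo, iCl, aPos}" "real_writes balance = {}"
  by (auto simp: carry_def count_nodes_def move_def flow_exchange_def flow_node_def balance_def)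

context run
begin

text \<open>\<open>aSlack\<close> caps the grant of a node and \<open>aQuota\<close> limits how many
  clients it serves.\<close>

definition "products s k \<longleftrightarrow> imem s aSlack k = imem s aMul k * (U - L) \<and> imem s aQuota k = imem s aMul k * U"

text \<open>A remainder below \<open>L\<close> plus an addend of at most \<open>L\<close> stays
  below twice \<open>L\<close>, so a single conditional subtraction suffices.\<close>

lemma carry_spec:
  assumes e: "env s" and q: "imem s aQ 0 = q" and T: "imem s aRem q < L" "ival x s \<le> L" and p: "products s q"
  shows "wlp (carry x) (\<lambda>t. imem t aMul q * L + imem t aRem q = imem s aMul q * L + imem s aRem q + ival x s \<and>
    imem t aRem q < L \<and> products t q \<and>
    (\<forall>j. j \<noteq> q \<longrightarrow> imem t aMul j = imem s aMul j \<and> imem t aRem j = imem s aRem j \<and>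
       (products s j \<longrightarrow> products t j))) s"
proof -
  have lU: "imem s aLow 0 = L" "imem s 0 2 = U" using e by (auto simp: env_def)
  show ?thesis
    unfolding carry_def using q T p by (auto simp: lU products_def)
qed

lemma card_cl_Suc: "card {v \<in> cl. v < Suc i \<and> P v} = card {v \<in> cl. v < i \<and> P v} + (if i \<in> cl \<and> P i then 1 else 0)"
proof -
  have "{v \<in> cl. v < Suc i \<and> P v} =
      (if i \<in> cl \<and> P i then insert i {v \<in> cl. v < i \<and> P v} else {v \<in> cl. v < i \<and> P v})"
    by (auto simp: less_Suc_eq)
  then show ?thesis using finite_cl by simp
qed

lemma card_cl_all: "card {v \<in> cl. v < n \<and> P v} = card {v \<in> cl. P v}"
  using cl_less by (intro arg_cong[where f = card]) auto

lemma count_spec: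
  assumes e: "env s" and G: "is_grown s" and K: "imem s aNum 0 = K"
    and z: "\<And>k. k < K \<Longrightarrow> imem s aMul k = 0 \<and> imem s aRem k = 0 \<and> imem s aSlack k = 0 \<and>
      imem s aQuota k = 0 \<and> imem s aBud k = 0"
  shows "wlp count_nodes (\<lambda>t. (\<forall>k<K. imem t aMul k * L + imem t aRem k = load (imem s aNode) k \<and>
      imem t aRem k < L \<and> products t k) \<and>
    (\<forall>c<K. imem t aBud c = label_count (imem s aRoot) (imem s aNode) c mod L) \<and>
    (\<forall>v<n. imem t aPos v = imem s aNode v)) s"
  unfolding count_nodes_def
  apply (rule wlp_For[where J = "\<lambda>i t. (\<forall>k<K. imem t aMul k * L + imem t aRem k = card {v \<in> cl. v < i \<and> imem s aNode v = Suc k} \<and>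
      imem t aRem k < L \<and> products t k) \<and>
    (\<forall>c<K. imem t aBud c = card {v \<in> cl. v < i \<and> 0 < imem s aNode v \<and> imem s aRoot (imem s aNode v - 1) = c} mod L) \<and>
    (\<forall>v<i. imem t aPos v = imem s aNode v)"])
       apply (simp_all)[3]
  subgoal
    using z L_pos by (simp add: products_def)
  subgoal premises prems for i t
  proof -
    have et: "env t" using env_frame[OF e prems(4)] by simp
    have fr: "imem t aNode = imem s aNode" "imem t aRoot = imem s aRoot"
      using prems(4) by (simp_all add: frame_def)
    have i: "i < n" using prems(1) env_n[OF e] by simp
    have ci: "0 < imem t 1 i \<longleftrightarrow> i \<in> cl" using et i by (simp add: env_def)
    show ?thesis
    proof (cases "i \<in> cl \<and> 0 < imem s aNode i")
      case False
      have "card {v \<in> cl. v < Suc i \<and> imem s aNode v = Suc k} = card {v \<in> cl. v < i \<and> imem s aNode v = Suc k}" for k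
        using False by (subst card_cl_Suc) auto
      moreover have "card {v \<in> cl. v < Suc i \<and> 0 < imem s aNode v \<and> imem s aRoot (imem s aNode v - 1) = c} =
         card {v \<in> cl. v < i \<and> 0 < imem s aNode v \<and> imem s aRoot (imem s aNode v - 1) = c}" for c
        using False by (subst card_cl_Suc) auto
      ultimately show ?thesis
        using prems(2,3) False fr ci by (cases "i \<in> cl") (simp_all add: less_Suc_eq products_def)
    next
      case True
      define q where "q = imem s aNode i - 1"
      define c where "c = imem s aRoot q"
      have A: "is_assigned K (imem s aFac) (imem s aNode) (imem s aHome)"
        and F: "is_forest K (imem s aFac) (imem s aPar) (imem s aRoot)"
        using G K by (auto simp: is_grown_def grown_def)
      have nq: "imem s aNode i = Suc q" using True by (simp add: q_def)
      have qK: "q < K" using A True nq unfolding is_assigned_def by fastforce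
      have cK: "c < K" using F qK unfolding c_def is_forest_def by (meson le_less_trans)
      define t1 where "t1 = iset aQ 0 q (iset aPos i (Suc q) t)"
      have e1: "env t1" using et by (simp add: t1_def)
      have r1: "imem t1 aRem q < L" "products t1 q" "imem t1 aQ 0 = q"
        using prems(2) qK by (auto simp: t1_def products_def)
      have x1: "ival (IConst (Suc 0)) t1 \<le> L" using L_pos by simp
      have cnt: "card {v \<in> cl. v < Suc i \<and> imem s aNode v = Suc k} =
          card {v \<in> cl. v < i \<and> imem s aNode v = Suc k} + (if k = q then 1 else 0)" for k
        using True nq by (subst card_cl_Suc) auto
      have cntc: "card {v \<in> cl. v < Suc i \<and> 0 < imem s aNode v \<and> imem s aRoot (imem s aNode v - 1) = c'} =
         card {v \<in> cl. v < i \<and> 0 < imem s aNode v \<and> imem s aRoot (imem s aNode v - 1) = c'} + (if c' = c then 1 else 0)" for c'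
        using True nq c_def by (subst card_cl_Suc) auto
      show ?thesis
        using True ci prems(3) nq fr
        apply simp
        apply (fold t1_def)
        apply (rule wlp_frame[OF carry_spec[OF e1 r1(3,1) x1 r1(2)]])
        subgoal premises p2 for u
        proof -
          have fu: "imem u iCl 0 = i" "imem u aRoot = imem s aRoot" "imem u aBud = imem t aBud"
            "imem u aPos = (imem t aPos)(i := Suc q)" "imem u aQ 0 = q"
            using p2(8) fr prems(3) by (auto simp: frame_def t1_def)
          have lu: "imem u aLow 0 = L" using env_frame[OF e1 p2(8)] by (simp add: env_def)
          have t1m: "imem t1 aMul = imem t aMul" "imem t1 aRem = imem t aRem" "products t1 = products t"
            by (auto simp: t1_def products_def fun_eq_iff)
          have a: "\<forall>k<K. imem u aMul k * L + imem u aRem k = card {v \<in> cl. v < Suc i \<and> imem s aNode v = Suc k} \<and>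
            imem u aRem k < L \<and> products u k"
          proof (intro allI impI)
            fix k assume k: "k < K"
            show "imem u aMul k * L + imem u aRem k = card {v \<in> cl. v < Suc i \<and> imem s aNode v = Suc k} \<and>
              imem u aRem k < L \<and> products u k"
              using p2(7) prems(2) k unfolding cnt t1m by (cases "k = q") auto
          qed
          have b: "(if Suc (imem t aBud c) < L then Suc (imem t aBud c) else 0) =
            Suc (card {v \<in> cl. v < i \<and> 0 < imem s aNode v \<and> imem s aRoot (imem s aNode v - 1) = c}) mod L"
          proof -
            have "imem t aBud c = card {v \<in> cl. v < i \<and> 0 < imem s aNode v \<and> imem s aRoot (imem s aNode v - 1) = c} mod L"
              using prems(2) cK by blast
            moreover have "card {v \<in> cl. v < i \<and> 0 < imem s aNode v \<and> imem s aRoot (imem s aNode v - 1) = c} mod L < L"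
              using L_pos by simp
            ultimately show ?thesis by (simp add: mod_Suc)
          qed
          have b': "\<forall>c'<K. (if c' = c then (if Suc (imem t aBud c) < L then Suc (imem t aBud c) else 0) else imem t aBud c') =
            card {v \<in> cl. v < Suc i \<and> 0 < imem s aNode v \<and> imem s aRoot (imem s aNode v - 1) = c'} mod L"
            unfolding cntc b using prems(2) by simp
          have p: "\<forall>v<Suc i. imem u aPos v = imem s aNode v"
            using prems(2) nq fu by (auto simp: less_Suc_eq)
          show ?thesis
            using a b' p fu lu by (auto simp: c_def[symmetric] products_def)
        qed
        done
    qed
  qed
  subgoal for t
    using env_n[OF e] by (simp add: card_cl_all load_def label_count_def)
  done

lemma move_spec:
  assumes e: "env s" and ab: "a \<notin> {iCl, aPos, aTodo}" "b \<notin> {iCl, aPos, aTodo}"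
  shows "wlp (move a b) (\<lambda>t. moved (imem s aNode) (imem s aHome) (imem s a 0) (imem s b 0) (imem s aTodo 0)
    (imem s aPos) (imem t aPos)) s"
proof -
  define S where "S = staying (imem s aNode) (imem s aHome) (imem s aPos) (imem s a 0)"
  have fin: "finite S" using finite_cl by (simp add: S_def staying_def)
  have Sn: "S \<inter> {..<n} = S" using cl_less by (auto simp: S_def staying_def)
  show ?thesis
    unfolding move_def
    \<comment> \<open>\<open>Z\<close> is the set moved so far. Either it contains every initial
      stayer seen yet, or \<open>aTodo\<close> has reached 0; at the end this yields the minimum in
      \<open>moved\<close>.\<close>
    apply (rule wlp_For[where J = "\<lambda>i t. \<exists>Z. Z \<subseteq> S \<inter> {..<i} \<and> card Z + imem t aTodo 0 = imem s aTodo 0 \<and>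
      (imem t aTodo 0 = 0 \<or> Z = S \<inter> {..<i}) \<and>
      (\<forall>v. imem t aPos v = (if v \<in> Z then Suc (imem s b 0) else imem s aPos v))"])
         apply (simp_all)[4]
    subgoal premises prems for i t
    proof -
      have et: "env t" using env_frame[OF e prems(4)] by simp
      have fr: "imem t aNode = imem s aNode" "imem t aHome = imem s aHome" "imem t a = imem s a" "imem t b = imem s b"
        using prems(4) ab by (simp_all add: frame_def)
      have i: "i < n" using prems(1) env_n[OF e] by simp
      have ci: "0 < imem t 1 i \<longleftrightarrow> i \<in> cl" using et i by (simp add: env_def)
      obtain Z where Z: "Z \<subseteq> S \<inter> {..<i}" "card Z + imem t aTodo 0 = imem s aTodo 0"
        "imem t aTodo 0 = 0 \<or> Z = S \<inter> {..<i}"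
        "\<And>v. imem t aPos v = (if v \<in> Z then Suc (imem s b 0) else imem s aPos v)"
        using prems(2) by blast
      have iZ: "i \<notin> Z" using Z(1) by auto
      have finZ: "finite Z" using Z(1) fin finite_subset by blast
      have iS: "i \<in> S \<longleftrightarrow> i \<in> cl \<and> 0 < imem t aHome i \<and> imem t aNode i = Suc (imem t a 0) \<and> imem t aPos i = Suc (imem t a 0)"
        using Z(4)[of i] iZ by (simp add: S_def staying_def fr)
      show ?thesis
      proof (cases "0 < imem t aTodo 0 \<and> i \<in> S")
        case False
        have "imem t aTodo 0 = 0 \<or> Z = S \<inter> {..<Suc i}" using False Z(3) by (auto simp: Int_lessThan_Suc)
        moreover have "Z \<subseteq> S \<inter> {..<Suc i}" using Z(1) by auto
        ultimately have "\<exists>Z. Z \<subseteq> S \<inter> {..<Suc i} \<and> card Z + imem t aTodo 0 = imem s aTodo 0 \<and>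
          (imem t aTodo 0 = 0 \<or> Z = S \<inter> {..<Suc i}) \<and>
          (\<forall>v. imem t aPos v = (if v \<in> Z then Suc (imem s b 0) else imem s aPos v))"
          using Z(2,4) by blast
        moreover have "\<not> bval (movable a) t"
          using False iS ci prems(3) by (auto simp: movable_def)
        ultimately show ?thesis using prems(3) by simp
      next
        case True
        have b: "bval (movable a) t"
          using True iS ci prems(3) by (auto simp: movable_def)
        have "insert i Z \<subseteq> S \<inter> {..<Suc i}" "insert i Z = S \<inter> {..<Suc i}" 
          using True Z(1,3) by (auto simp: Int_lessThan_Suc)
        moreover have "card (insert i Z) + (imem t aTodo 0 - 1) = imem s aTodo 0" using Z(2) True finZ iZ by simp
        ultimately have "\<exists>Z. Z \<subseteq> S \<inter> {..<Suc i} \<and> card Z + (imem t aTodo 0 - Suc 0) = imem s aTodo 0 \<and>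
          (imem t aTodo 0 - Suc 0 = 0 \<or> Z = S \<inter> {..<Suc i}) \<and>
          (\<forall>v. ((imem t aPos)(i := Suc (imem s b 0))) v = (if v \<in> Z then Suc (imem s b 0) else imem s aPos v))"
          using Z(4) by (intro exI[of _ "insert i Z"]) auto
        then show ?thesis using b prems(3) fr ab by simp
      qed
    qed
    subgoal premises prems for t
    proof -
      obtain Z where Z: "Z \<subseteq> S" "card Z + imem t aTodo 0 = imem s aTodo 0"
        "imem t aTodo 0 = 0 \<or> Z = S"
        "\<And>v. imem t aPos v = (if v \<in> Z then Suc (imem s b 0) else imem s aPos v)"
        using prems(1) env_n[OF e] Sn by auto
      have "card Z \<le> card S" using Z(1) fin card_mono by blast
      then have "card Z = min (imem s aTodo 0) (card S)" using Z(2,3) by auto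
      then show ?thesis using Z unfolding moved_def S_def by blast
    qed
    done
qed

definition "is_flow i s \<longleftrightarrow> flow (imem s aNum 0) (imem s aFac) (imem s aPar) (imem s aRoot) (imem s aNode) (imem s aHome) i
  (imem s aMul) (imem s aRem) (imem s aAcc) (imem s aBud) (imem s aPos) \<and> (\<forall>k<imem s aNum 0. products s k)"

text \<open>The grant \<open>x\<close> has already been deducted from \<open>aBud\<close>. The old
  flow is therefore stated with a separate budget \<open>bud\<close>, to which the last assumption
  relates the memory.\<close>

lemma flow_exchange_spec:
  assumes e: "env s" and G: "is_grown s" and k: "imem s aJ 0 = k" "k < imem s aNum 0" "imem s aPar k = Suc q"
    and fl: "flow (imem s aNum 0) (imem s aFac) (imem s aPar) (imem s aRoot) (imem s aNode) (imem s aHome) (Suc k)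
      (imem s aMul) (imem s aRem) (imem s aAcc) bud (imem s aPos)" "\<forall>k<imem s aNum 0. products s k"
    and x: "x = min (bud (imem s aRoot k)) (imem s aMul k * (U - L))" "imem s aX 0 = imem s aAcc k + x"
    and bud: "imem s aBud = bud(imem s aRoot k := bud (imem s aRoot k) - x)"
  shows "wlp flow_exchange (is_flow k) s"
proof -
  define K where "K = imem s aNum 0"
  have A: "is_assigned K (imem s aFac) (imem s aNode) (imem s aHome)"
    and F: "is_forest K (imem s aFac) (imem s aPar) (imem s aRoot)"
    using G by (auto simp: is_grown_def grown_def K_def)
  have kK: "k < K" using k by (simp add: K_def)
  have q: "q < k" "q < K" using F k kK unfolding is_forest_def by fastforce+
  define s1 where "s1 = iset aQ 0 q s"
  have e1: "env s1" using e by (simp add: s1_def)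
  have D: "imem s aRem j < L" if "j < K" for j using flowD(2)[OF fl(1)] that by (simp add: K_def)
  have c1: "imem s1 aQ 0 = q" "imem s1 aRem q < L" "ival (IGet aRem (sc aJ)) s1 \<le> L" "products s1 q"
    using D[OF q(2)] D[OF kK] k fl(2) q(2) by (auto simp: s1_def K_def products_def)
  have s1: "wlp flow_exchange Q s = wlp (carry (IGet aRem (sc aJ))) (wlp (Block [
      ISet aAcc (sc aQ) (IAdd (IGet aAcc (sc aQ)) (sc aX)),
      setsc aTodo (ISub (IGet aRem (sc aJ)) (sc aX)), move aJ aQ,
      setsc aTodo (ISub (sc aX) (IGet aRem (sc aJ))), move aQ aJ]) Q) s1" for Q
    unfolding flow_exchange_def s1_def using k by simp
  show ?thesis
    unfolding s1
  proof (rule wlp_frame[OF carry_spec[OF e1 c1]])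
    fix u assume u: "imem u aMul q * L + imem u aRem q =
        imem s1 aMul q * L + imem s1 aRem q + ival (IGet aRem (sc aJ)) s1 \<and>
      imem u aRem q < L \<and> products u q \<and>
      (\<forall>j. j \<noteq> q \<longrightarrow> imem u aMul j = imem s1 aMul j \<and> imem u aRem j = imem s1 aRem j \<and>
         (products s1 j \<longrightarrow> products u j))" and fu: "frame (carry (IGet aRem (sc aJ))) s1 u"
    define u1 where "u1 = iset aTodo 0 (imem s aRem k - imem s aX 0) (iset aAcc q (imem s aAcc q + imem s aX 0) u)"
    have eu: "env u" using env_frame[OF e1 fu] by simp
    have e2: "env u1" using eu by (simp add: u1_def)
    have fr: "imem u a = imem s a" if "a \<in> {aNum, aFac, aPar, aRoot, aNode, aHome, aAcc, aBud, aPos, aX, aJ}" for a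
      using fu that by (auto simp: frame_def s1_def)
    have uq: "imem u aQ 0 = q" "imem u aRem k = imem s aRem k" using fu u q by (auto simp: frame_def s1_def)
    have w1: "wlp (Block [
      ISet aAcc (sc aQ) (IAdd (IGet aAcc (sc aQ)) (sc aX)),
      setsc aTodo (ISub (IGet aRem (sc aJ)) (sc aX)), move aJ aQ,
      setsc aTodo (ISub (sc aX) (IGet aRem (sc aJ))), move aQ aJ]) Q u = wlp (move aJ aQ) (wlp (Block [
      setsc aTodo (ISub (sc aX) (IGet aRem (sc aJ))), move aQ aJ]) Q) u1" for Q
      unfolding u1_def using uq fr k by simp
    have ab: "aJ \<notin> {iCl, aPos, aTodo}" "aQ \<notin> {iCl, aPos, aTodo}" by simp_all
    show "wlp (Block [
      ISet aAcc (sc aQ) (IAdd (IGet aAcc (sc aQ)) (sc aX)),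
      setsc aTodo (ISub (IGet aRem (sc aJ)) (sc aX)), move aJ aQ,
      setsc aTodo (ISub (sc aX) (IGet aRem (sc aJ))), move aQ aJ]) (is_flow k) u"
      unfolding w1
    proof (rule wlp_frame[OF move_spec[OF e2 ab]])
      fix w assume mv1: "moved (imem u1 aNode) (imem u1 aHome) (imem u1 aJ 0) (imem u1 aQ 0) (imem u1 aTodo 0)
        (imem u1 aPos) (imem w aPos)" and fw: "frame (move aJ aQ) u1 w"
      define w2 where "w2 = iset aTodo 0 (imem s aX 0 - imem s aRem k) w"
      have e3: "env w2" using env_frame[OF e2 fw] by (simp add: w2_def)
      have frw: "imem w a = imem u1 a" if "a \<notin> {iCl, aPos, aTodo}" for a
        using fw that by (simp add: frame_def)
      have w2: "wlp (Block [setsc aTodo (ISub (sc aX) (IGet aRem (sc aJ))), move aQ aJ]) Q w = wlp (move aQ aJ) Q w2" for Q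
        unfolding w2_def using frw uq fr k by (simp add: u1_def)
      show "wlp (Block [setsc aTodo (ISub (sc aX) (IGet aRem (sc aJ))), move aQ aJ]) (is_flow k) w"
        unfolding w2
      proof (rule wlp_frame[OF move_spec[OF e3 ab(2,1)]])
        fix y assume mv2: "moved (imem w2 aNode) (imem w2 aHome) (imem w2 aQ 0) (imem w2 aJ 0) (imem w2 aTodo 0)
          (imem w2 aPos) (imem y aPos)" and fy: "frame (move aQ aJ) w2 y"
        have fry: "imem y a = imem u1 a" if "a \<notin> {iCl, aPos, aTodo}" for a
          using fy frw[OF that] that by (simp add: frame_def w2_def)
        have m1: "moved (imem s aNode) (imem s aHome) k q (imem s aRem k - (imem s aAcc k + x)) (imem s aPos) (imem w aPos)"
          using mv1 fr uq k x by (simp add: u1_def)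
        have m2: "moved (imem s aNode) (imem s aHome) q k ((imem s aAcc k + x) - imem s aRem k) (imem w aPos) (imem y aPos)"
          using mv2 fr uq k x frw by (simp add: w2_def u1_def)
        have mq: "imem u aMul q * L + imem u aRem q = imem s aMul q * L + imem s aRem q + imem s aRem k"
          "imem u aRem q < L"
          "\<And>j. j \<noteq> q \<Longrightarrow> imem u aMul j = imem s aMul j" "\<And>j. j \<noteq> q \<Longrightarrow> imem u aRem j = imem s aRem j"
          using u k by (auto simp: s1_def)
        have "flow K (imem s aFac) (imem s aPar) (imem s aRoot) (imem s aNode) (imem s aHome) k
          (imem u aMul) (imem u aRem) ((imem s aAcc)(q := imem s aAcc q + (imem s aAcc k + x)))
          (bud(imem s aRoot k := bud (imem s aRoot k) - x)) (imem y aPos)"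
          using flow_step_child[OF F A fl(1)[folded K_def] kK k(3) x(1) mq m1 m2] .
        moreover have "products y j" if "j < K" for j
        proof -
          have "products s1 j" using fl(2) that by (simp add: products_def s1_def K_def)
          then have "products u j" using u by (cases "j = q") auto
          then show ?thesis by (simp add: products_def fry u1_def)
        qed
        ultimately show "is_flow k y"
          using fr bud x(2) by (simp add: is_flow_def fry u1_def K_def)
      qed
    qed
  qed
qed

lemma flow_node_spec:
  assumes e: "env s" and G: "is_grown s" and k: "imem s aJ 0 = k" "k < imem s aNum 0" and fl: "is_flow (Suc k) s"
  shows "wlp flow_node (is_flow k) s"
proof -
  define bud where "bud = imem s aBud"
  define x where "x = min (bud (imem s aRoot k)) (imem s aMul k * (U - L))"
  define s1 where "s1 = iset aX 0 (imem s aAcc k + x) (iset aBud (imem s aRoot k) (bud (imem s aRoot k) - x)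
     (iset aX 0 x (iset aX 0 (bud (imem s aRoot k)) s)))"
  define s2 where "s2 = iset aX 0 (imem s aAcc k + x) (iset aBud (imem s aRoot k) (bud (imem s aRoot k) - x)
     (iset aX 0 (bud (imem s aRoot k)) s))"
  \<comment> \<open>Capping writes \<open>aX\<close> once more in one branch, but \<open>aX\<close>
    is overwritten afterwards, so both branches end in the same state.\<close>
  have eq: "s1 = s2" by (simp add: s1_def s2_def iset_def)
  have sl: "imem s aSlack k = imem s aMul k * (U - L)" using fl k by (simp add: is_flow_def products_def)
  have w: "wlp flow_node Q s = (if 0 < imem s aPar k then wlp flow_exchange Q s2 else Q s2)" for Q
  proof (cases "imem s aSlack k < bud (imem s aRoot k)")
    case True
    then have "x = imem s aSlack k" using sl by (simp add: x_def)
    then have "wlp flow_node Q s = (if 0 < imem s aPar k then wlp flow_exchange Q s1 else Q s1)"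
      unfolding flow_node_def s1_def using True k by (simp add: bud_def)
    then show ?thesis by (simp add: eq)
  next
    case False
    then have "x = bud (imem s aRoot k)" using sl by (simp add: x_def)
    then show ?thesis
      unfolding flow_node_def s2_def using False k by (simp add: bud_def)
  qed
  have fl1: "flow (imem s aNum 0) (imem s aFac) (imem s aPar) (imem s aRoot) (imem s aNode) (imem s aHome) (Suc k)
      (imem s aMul) (imem s aRem) (imem s aAcc) bud (imem s aPos)" "\<forall>k<imem s aNum 0. products s k"
    using fl by (auto simp: is_flow_def bud_def)
  have F: "is_forest (imem s aNum 0) (imem s aFac) (imem s aPar) (imem s aRoot)"
    using G by (auto simp: is_grown_def grown_def)
  have p2: "products s2 = products s" by (simp add: s2_def products_def fun_eq_iff)
  show ?thesis
  proof (cases "imem s aPar k")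
    case 0
    have "imem s aRoot k = k" using F k 0 by (simp add: is_forest_def)
    then have "is_flow k s2"
      using flow_step_root[OF F fl1(1) k(2) 0, of x] fl1(2) x_def
      unfolding is_flow_def p2 by (simp add: s2_def bud_def)
    then show ?thesis unfolding w using 0 by simp
  next
    case (Suc q)
    have "wlp flow_exchange (is_flow k) s2"
      by (rule flow_exchange_spec[where bud = bud and x = x and q = q])
        (use e G k Suc fl1 p2 x_def in \<open>simp_all add: s2_def bud_def\<close>)
    then show ?thesis unfolding w using Suc by simp
  qed
qed

lemma balance_spec:
  assumes e: "env s" and G: "is_grown s" and K: "imem s aNum 0 \<le> n" and fl: "is_flow (imem s aNum 0) s"
  shows "wlp balance (is_flow 0) s"
  unfolding balance_def
  \<comment> \<open>Round \<open>i\<close> processes the node \<open>imem s aNum 0 - Suc i\<close>;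
    in the surplus rounds truncation keeps the claim at 0.\<close>
  apply (rule wlp_For[where J = "\<lambda>i t. is_flow (imem s aNum 0 - i) t"])
       apply (simp_all)[3]
  subgoal
    using fl by (simp add: is_flow_def products_def)
  subgoal premises prems for i t
  proof -
    have et: "env t" using env_frame[OF e prems(4)] by simp
    have fr: "imem t a = imem s a" if "a \<in> {aNum, aFac, aPar, aRoot, aNode, aHome}" for a
      using prems(4) that by (auto simp: frame_def)
    have gt: "is_grown t" using G fr by (simp add: is_grown_def)
    have ins: "is_flow j (iset iNode 0 x u) = is_flow j u" for j x u by (simp add: is_flow_def products_def)
    show ?thesis
    proof (cases "i < imem s aNum 0")
      case False
      then show ?thesis using prems(2,3) fr ins by simp
    next
      case True
      define t1 where "t1 = iset aJ 0 (imem s aNum 0 - Suc i) t"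
      have "wlp flow_node (is_flow (imem s aNum 0 - Suc i)) t1"
      proof (rule flow_node_spec)
        show "env t1" "is_grown t1" using et gt by (simp_all add: t1_def)
        show "imem t1 aJ 0 = imem s aNum 0 - Suc i" by (simp add: t1_def)
        show "imem s aNum 0 - Suc i < imem t1 aNum 0" using True fr by (simp add: t1_def)
        have "Suc (imem s aNum 0 - Suc i) = imem s aNum 0 - i" using True by simp
        then show "is_flow (Suc (imem s aNum 0 - Suc i)) t1"
          using prems(2) by (simp add: t1_def is_flow_def products_def)
      qed
      then show ?thesis using True prems(3) fr by (simp add: ins t1_def diff_diff_add)
    qed
  qed
  subgoal for t
    using env_n[OF e] K by simp
  done

end

section \<open>Program code and specification for one threshold\<close>

definition "clear as = For iCl (Block (map (\<lambda>a. ISet a (sc iCl) (IConst 0)) as))"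

definition "prefix = For iNode (When (ILess (sc iNode) (sc aNum)) (Block [
  ISet aBase (sc iNode) (sc oNum), setsc oNum (IAdd (sc oNum) (IGet aMul (sc iNode)))]))"

definition "serve = Block [
  ISet oCenters (IAdd (IGet aBase (sc aQ)) (IGet aTurn (sc aQ))) (IGet aFac (sc aQ)),
  ISet oAssign (sc iCl) (inc (IAdd (IGet aBase (sc aQ)) (IGet aTurn (sc aQ)))),
  setsc aServed (inc (sc aServed))]"

text \<open>\<open>aTurn\<close> wraps around to follow the rank modulo the number of copies. Each
  call of \<open>serve\<close> rewrites the center of its copy, always with the same
  facility.\<close>

definition "deal = For iCl (When (BAnd (nz (IGet 1 (sc iCl))) (nz (IGet aPos (sc iCl)))) (Block [
  setsc aQ (dec (IGet aPos (sc iCl))),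
  When (ILess (IGet aRank (sc aQ)) (IGet aQuota (sc aQ))) serve,
  ISet aRank (sc aQ) (inc (IGet aRank (sc aQ))),
  ISet aTurn (sc aQ) (inc (IGet aTurn (sc aQ))),
  When (BNot (ILess (IGet aTurn (sc aQ)) (IGet aMul (sc aQ)))) (ISet aTurn (sc aQ) (IConst 0))]))"

definition "solve = Block [
  clear [oAssign, aNode, aHome, aMul, aRem, aSlack, aQuota, aBud, aAcc, aRank, aTurn],
  setsc aNum (IConst 0), setsc oNum (IConst 0), setsc aServed (IConst 0),
  grow, count_nodes, balance, prefix, deal]"

definition "publish = Block [
  setsc 3 (sc oNum),
  For iCl (Block [ISet 4 (sc iCl) (IGet oCenters (sc iCl)), ISet 5 (sc iCl) (IGet oAssign (sc iCl))])]"

lemma writes_Block_map: "writes (Block (map (\<lambda>a. ISet a e f) as)) = set as"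
  "real_writes (Block (map (\<lambda>a. ISet a e f) as)) = {}"
  by (induction as) auto

lemma writes_solve [simp]:
  "writes (clear as) = insert iCl (set as)" "real_writes (clear as) = {}"
  "writes prefix = {iNode, aBase, oNum}" "real_writes prefix = {}"
  "writes serve = {oCenters, oAssign, aServed}" "real_writes serve = {}"
  "writes deal = {iCl, aQ, oCenters, oAssign, aServed, aRank, aTurn}" "real_writes deal = {}"
  "writes publish = {3, 4, 5, iCl}" "real_writes publish = {}"
  by (auto simp: clear_def prefix_def serve_def deal_def publish_def writes_Block_map)

lemma writes_solve_disjoint: "writes solve \<inter> {0, 1, 2, 3, 4, 5, aRow, aLow, aFound, iRow, iCol} = {}"
  and real_writes_solve [simp]: "real_writes solve = {}"
  by (auto simp: solve_def)

definition "output n s = \<lparr>served = {v. v < n \<and> imem s oAssign v \<noteq> 0},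
  centers = map (imem s oCenters) [0..<imem s oNum 0], assign = (\<lambda>v. imem s oAssign v - 1)\<rparr>"

lemma clear_spec:
  assumes "0 \<notin> set as" "iCl \<notin> set as"
  shows "wlp (clear as) (\<lambda>t. \<forall>a\<in>set as. \<forall>v<imem s 0 0. imem t a v = 0) s"
proof -
  have B: "wlp (Block (map (\<lambda>a. ISet a (sc iCl) (IConst 0)) as)) (\<lambda>u. \<forall>a v. imem u a v =
    (if a \<in> set as \<and> v = imem t iCl 0 then 0 else imem t a v)) t" if "iCl \<notin> set as" for as t
    using that
  proof (induction as arbitrary: t)
    case (Cons a as)
    let ?t = "iset a (imem t iCl 0) 0 t"
    have "wlp (Block (map (\<lambda>a. ISet a (sc iCl) (IConst 0)) as)) (\<lambda>u. \<forall>a v. imem u a v =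
      (if a \<in> set as \<and> v = imem ?t iCl 0 then 0 else imem ?t a v)) ?t"
      using Cons by (intro Cons.IH) auto
    then show ?case
      using Cons.prems by (simp) (erule wlp_frame, auto)
  qed simp
  show ?thesis
    unfolding clear_def
    apply (rule wlp_For[where J = "\<lambda>i t. \<forall>a\<in>set as. \<forall>v<i. imem t a v = 0"])
    using assms apply (simp_all add: writes_Block_map)[4]
    subgoal for i t
      by (rule wlp_frame[OF B[OF assms(2), of t]]) (use assms in \<open>auto simp: less_Suc_eq\<close>)
    subgoal by simp
    done
qed

context run
begin

lemma prefix_spec:
  assumes e: "env s" and z: "imem s oNum 0 = 0" and K: "imem s aNum 0 = K" "K \<le> n"
  shows "wlp prefix (\<lambda>t. imem t oNum 0 = (\<Sum>k<K. imem s aMul k) \<and> (\<forall>k<K. imem t aBase k = (\<Sum>l<k. imem s aMul l))) s"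
  unfolding prefix_def
  apply (rule wlp_For[where J = "\<lambda>i t. imem t oNum 0 = (\<Sum>k<min i K. imem s aMul k) \<and>
     (\<forall>k<min i K. imem t aBase k = (\<Sum>l<k. imem s aMul l))"])
       apply (simp_all add: z)[4]
  subgoal premises prems for i t
  proof -
    have fr: "imem t aNum 0 = K" "imem t aMul = imem s aMul"
      using prems(4) K by (simp_all add: frame_def)
    show ?thesis
      using prems(2,3) fr by (cases "i < K") (auto simp: less_Suc_eq min_def)
  qed
  subgoal for t
    using env_n[OF e] K by (simp add: min_absorb2)
  done

lemma deal_spec:
  assumes e: "env s" and K: "imem s aNum 0 = K"
    and P: "\<forall>v\<in>cl. imem s aPos v \<le> K" and pr: "\<forall>k<K. products s k"
    and base: "\<forall>k<K. imem s aBase k = (\<Sum>l<k. imem s aMul l)" and num: "imem s oNum 0 = (\<Sum>k<K. imem s aMul k)"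
    and z: "\<forall>v<n. imem s oAssign v = 0 \<and> imem s aRank v = 0 \<and> imem s aTurn v = 0" "imem s aServed 0 = 0" "K \<le> n"
  shows "wlp deal (\<lambda>t. is_dealt K (imem s aFac) (imem s aPos) (imem s aMul) (output n t) \<and>
    imem t aServed 0 = card (served (output n t))) s"
proof -
  define p where "p = imem s aPos"
  define m where "m = imem s aMul"
  define slot where "slot v = (\<Sum>l<p v - 1. m l) + rank p v mod m (p v - 1)" for v
  define ok where "ok v \<longleftrightarrow> v \<in> cl \<and> 0 < p v \<and> rank p v < m (p v - 1) * U" for v
  have okK: "p v - 1 < K \<and> 0 < m (p v - 1)" if "ok v" for v
    using that P by (cases "m (p v - 1)") (fastforce simp: ok_def p_def)+
  \<comment> \<open>Equal slots belong to the same node, so a later write to a copy repeats the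
    facility stored there.\<close>
  have slot_inj: "p v - 1 = p w - 1" if "slot v = slot w" "ok v" "ok w" for v w
    using prefix_sum_inject[of m "p v - 1" _ "p w - 1"] that okK unfolding slot_def by (meson mod_less_divisor)
  show ?thesis
    unfolding deal_def
    \<comment> \<open>The turn is tied to the rank only for positive \<open>m k\<close>; a node
      without copies has quota 0 and serves nobody.\<close>
    apply (rule wlp_For[where J = "\<lambda>i t. (\<forall>k<K. imem t aRank k = card {v \<in> cl. v < i \<and> p v = Suc k} \<and>
        (0 < m k \<longrightarrow> imem t aTurn k = card {v \<in> cl. v < i \<and> p v = Suc k} mod m k)) \<and>
      imem t aServed 0 = card {v. v < i \<and> ok v} \<and>
      (\<forall>v<n. imem t oAssign v = (if v < i \<and> ok v then Suc (slot v) else 0)) \<and>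
      (\<forall>v<i. ok v \<longrightarrow> imem t oCenters (slot v) = imem s aFac (p v - 1))"])
         apply (simp_all)[3]
    subgoal
      using z by simp
    subgoal premises prems for i t
    proof -
      have et: "env t" using env_frame[OF e prems(4)] by simp
      have fr: "imem t a = imem s a" if "a \<in> {aPos, aMul, aFac, aBase, aQuota}" for a
        using prems(4) that by (auto simp: frame_def)
      have i: "i < n" using prems(1) env_n[OF e] by simp
      have ci: "0 < imem t 1 i \<longleftrightarrow> i \<in> cl" using et i by (simp add: env_def)
      have served_Suc: "{v. v < Suc i \<and> ok v} = (if ok i then insert i {v. v < i \<and> ok v} else {v. v < i \<and> ok v})"
        by (auto simp: less_Suc_eq)
      show ?thesis
      proof (cases "i \<in> cl \<and> 0 < p i")
        case False
        then have nok: "\<not> ok i" by (auto simp: ok_def)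
        have "card {v \<in> cl. v < Suc i \<and> p v = Suc k} = card {v \<in> cl. v < i \<and> p v = Suc k}" for k
          using False by (subst card_cl_Suc) auto
        moreover have "\<not> bval (BAnd (nz (IGet 1 (sc iCl))) (nz (IGet aPos (sc iCl)))) t"
          using False ci fr prems(3) by (auto simp: p_def)
        ultimately show ?thesis
          using prems(2,3) nok served_Suc by (simp only: wlp_simps if_False) (auto simp: less_Suc_eq)
      next
        case True
        define q where "q = p i - 1"
        have pq: "p i = Suc q" using True by (simp add: q_def)
        have qK: "q < K" using P True pq unfolding p_def by fastforce
        have cnt: "card {v \<in> cl. v < Suc i \<and> p v = Suc k} =
            card {v \<in> cl. v < i \<and> p v = Suc k} + (if k = q then 1 else 0)" for k
          using True pq by (subst card_cl_Suc) auto
        define c where "c = card {v \<in> cl. v < i \<and> p v = Suc q}"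
        have rk: "rank p i = c" unfolding rank_def c_def pq by (intro arg_cong[where f = card]) auto
        have old: "imem t aRank q = c" "0 < m q \<Longrightarrow> imem t aTurn q = c mod m q"
          using prems(2) qK by (auto simp: c_def)
        have bq: "imem t aBase q = (\<Sum>l<q. m l)" "imem t aQuota q = m q * U" "imem t aMul = m"
          using base pr qK fr by (auto simp: m_def products_def)
        have turn: "0 < m q \<Longrightarrow> Suc c mod m q = (if Suc (c mod m q) < m q then Suc (c mod m q) else 0)"
          using mod_less_divisor[of "m q" c] by (simp add: mod_Suc Suc_lessI)
        have ranks: "(\<forall>k<K. (if k = q then Suc c else imem t aRank k) = card {v \<in> cl. v < Suc i \<and> p v = Suc k} \<and>
          (0 < m k \<longrightarrow> (if k = q then (if Suc (imem t aTurn q) < m q then Suc (imem t aTurn q) else 0) else imem t aTurn k) =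
             card {v \<in> cl. v < Suc i \<and> p v = Suc k} mod m k))"
          using prems(2) turn old unfolding cnt by (auto simp: c_def)
        have b: "bval (BAnd (nz (IGet 1 (sc iCl))) (nz (IGet aPos (sc iCl)))) t"
          using True ci fr prems(3) by (auto simp: p_def)
        define t1 where "t1 = iset aQ 0 q t"
        define fin where "fin t2 = iset iCl 0 (Suc i) (iset aTurn q (if Suc (imem t aTurn q) < m q then Suc (imem t aTurn q) else 0)
           (iset aRank q (Suc c) t2))" for t2
        define t2 where "t2 = (if ok i then iset aServed 0 (Suc (imem t aServed 0)) (iset oAssign i (Suc (slot i))
          (iset oCenters (slot i) (imem s aFac q) t1)) else t1)"
        have slot: "slot i = (\<Sum>l<q. m l) + c mod m q" by (simp add: slot_def rk pq)
        have okc: "ok i \<longleftrightarrow> c < m q * U" using True by (simp add: ok_def rk pq)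
        have mq: "0 < m q" if "ok i" using okK[OF that] pq by simp
        have exe: "wlp (Block [setsc aQ (dec (IGet aPos (sc iCl))),
          When (ILess (IGet aRank (sc aQ)) (IGet aQuota (sc aQ))) serve,
          ISet aRank (sc aQ) (inc (IGet aRank (sc aQ))),
          ISet aTurn (sc aQ) (inc (IGet aTurn (sc aQ))),
          When (BNot (ILess (IGet aTurn (sc aQ)) (IGet aMul (sc aQ)))) (ISet aTurn (sc aQ) (IConst 0))])
            (\<lambda>s'. Q (iset iCl 0 (Suc i) s')) t" if Q: "Q (fin t2)" for Q
        proof -
          show ?thesis
          proof (cases "ok i")
            case True
            then show ?thesis
              using Q old(1) old(2)[OF mq[OF True]] bq okc pq fr prems(3) slot
              by (cases "Suc (c mod m q) < m q")
                (simp_all add: serve_def t2_def t1_def fin_def p_def[symmetric])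
          next
            case False
            then show ?thesis
              using Q old(1) bq okc pq fr prems(3)
              by (cases "Suc (imem t aTurn q) < m q")
                (simp_all add: t2_def t1_def fin_def p_def[symmetric])
          qed
        qed
        have A: "imem t2 oAssign v = (if v < Suc i \<and> ok v then Suc (slot v) else 0)" if "v < n" for v
          using prems(2) that by (auto simp: t2_def t1_def less_Suc_eq)
        have B: "imem t2 oCenters (slot v) = imem s aFac (p v - 1)" if "v < Suc i" "ok v" for v
        proof (cases "ok i \<and> slot v = slot i")
          case True
          then have "p v - 1 = q" using slot_inj[of v i] that pq by simp
          then show ?thesis using True by (simp add: t2_def)
        next
          case False
          then have "v < i" using that by (auto simp: less_Suc_eq)
          then show ?thesis using False prems(2) that by (auto simp: t2_def t1_def)
        qed
        have C: "imem t2 aServed 0 = card {v. v < Suc i \<and> ok v}"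
          using prems(2) unfolding served_Suc by (simp add: t2_def t1_def)
        have D: "imem t2 aRank = imem t aRank" "imem t2 aTurn = imem t aTurn" by (auto simp: t2_def t1_def)
        show ?thesis
          using b
          apply (simp only: wlp_simps if_True)
          apply (rule exe)
          using ranks A B C D unfolding fin_def by (auto simp: fun_upd_def)
      qed
    qed
    subgoal premises prems for t
    proof -
      have fr: "imem t oNum = imem s oNum" using prems(2) by (simp add: frame_def)
      have N: "imem s 0 0 = n" using env_n[OF e] .
      have okn: "ok v \<Longrightarrow> v < n" for v using cl_less by (auto simp: ok_def)
      have sv: "served (output n t) = {v. ok v}"
        using prems(1) okn unfolding N output_def by (auto split: if_splits)
      have slt: "slot v < (\<Sum>k<K. m k)" if "ok v" for v
      proof -
        have "slot v < (\<Sum>l<p v - 1. m l) + m (p v - 1)" using okK[OF that] by (simp add: slot_def)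
        also have "\<dots> \<le> (\<Sum>k<K. m k)" using okK[OF that] by (intro prefix_sum_mono) simp
        finally show ?thesis .
      qed
      have as: "assign (output n t) v = slot v" if "ok v" for v
        using prems(1) okn[OF that] that unfolding N by (simp add: output_def)
      have ce: "centers (output n t) ! slot v = imem s aFac (p v - 1)" if "ok v" for v
        using prems(1) okn[OF that] that slt[OF that] num fr unfolding N by (simp add: output_def m_def)
      have "is_dealt K (imem s aFac) p m (output n t)"
        unfolding is_dealt_def sv
        using as ce num fr by (auto simp: ok_def slot_def output_def m_def)
      moreover have "{v. v < n \<and> ok v} = {v. ok v}" using okn by auto
      ultimately show ?thesis using prems(1) unfolding N sv by (simp add: p_def m_def)
    qed
    done
qed

text \<open>Two complementary guarantees: an output that meets the target is feasible within
  \<open>5 * r\<close>, and no solution of value at most \<open>r\<close> serves more clients.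
  Missing the target thus refutes \<open>r\<close>.\<close>

lemma solve_spec:
  assumes e: "env s" and Lmax: "L = max 1 (lower I)"
  shows "wlp solve (\<lambda>t. imem t aServed 0 = card (served (output n t)) \<and> imem t oNum 0 \<le> n \<and>
    (target I \<le> imem t aServed 0 \<longrightarrow> feasible I (output n t) \<and> cost I (output n t) \<le> 5 * r) \<and>
    (\<forall>S. feasible I S \<and> cost I S \<le> r \<longrightarrow> card (served S) \<le> imem t aServed 0)) s"
  (is "wlp solve ?Q s")
proof -
  let ?z = "[oAssign, aNode, aHome, aMul, aRem, aSlack, aQuota, aBud, aAcc, aRank, aTurn]"
  show ?thesis
    unfolding solve_def Block.simps wlp_Seq wlp_Skip
  proof (rule wlp_frame[OF clear_spec], simp, simp)
    fix s0 assume z0: "\<forall>a\<in>set ?z. \<forall>v<imem s 0 0. imem s0 a v = 0" and f0: "frame (clear ?z) s s0"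
    have e0: "env s0" using env_frame[OF e f0] by simp
    define s1 where "s1 = iset aServed 0 0 (iset oNum 0 0 (iset aNum 0 0 s0))"
    have e1: "env s1" using e0 by (simp add: s1_def)
    have z: "imem s1 a v = 0" if "a \<in> set ?z" "v < n" for a v
    proof -
      have "imem s1 a = imem s0 a" using that(1) by (auto simp: s1_def)
      then show ?thesis using z0 that env_n[OF e] by metis
    qed
    have z1: "imem s1 aNum 0 = 0" "imem s1 oNum 0 = 0" "imem s1 aServed 0 = 0" by (simp_all add: s1_def)
    have "wlp grow (wlp count_nodes (wlp balance (wlp prefix (wlp deal ?Q)))) s1"
    proof (rule wlp_frame[OF grow_spec[OF e1 z1(1)]])
      show "\<forall>v<n. imem s1 aNode v = 0" "\<forall>v<n. imem s1 aHome v = 0" using z by simp_all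
      fix s2 assume g2: "is_grown s2 \<and> imem s2 aNum 0 \<le> n \<and> (\<forall>g. valid g \<longrightarrow> (\<exists>v\<in>ball g. 0 < imem s2 aHome v))"
        and f2: "frame grow s1 s2"
      define K where "K = imem s2 aNum 0"
      have K: "imem s2 aNum 0 = K" "K \<le> n" using g2 by (auto simp: K_def)
      have e2: "env s2" using env_frame[OF e1 f2] by simp
      have s2z: "imem s2 a v = 0" if "a \<in> {oAssign, aMul, aRem, aSlack, aQuota, aBud, aAcc, aRank, aTurn}" "v < n" for a v
      proof -
        have "imem s2 a = imem s1 a" using f2 that(1) by (auto simp: frame_def)
        moreover have "a \<in> set ?z" using that(1) by auto
        ultimately show ?thesis using z[of a v] that(2) by simp
      qed
      have s2z': "imem s2 oNum 0 = 0" "imem s2 aServed 0 = 0" using f2 z1 by (simp_all add: frame_def)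
      obtain cur where G: "grown K (imem s2 aFac) (imem s2 aPar) (imem s2 aRoot) (imem s2 aNode) (imem s2 aHome) cur"
        using g2 by (auto simp: is_grown_def K)
      then have A: "is_assigned K (imem s2 aFac) (imem s2 aNode) (imem s2 aHome)"
        and F: "is_forest K (imem s2 aFac) (imem s2 aPar) (imem s2 aRoot)"
        by (auto simp: grown_def)
      show "wlp count_nodes (wlp balance (wlp prefix (wlp deal ?Q))) s2"
      proof (rule wlp_frame[OF count_spec[OF e2 _ K(1)]])
        show "is_grown s2" using g2 by blast
        show "imem s2 aMul k = 0 \<and> imem s2 aRem k = 0 \<and> imem s2 aSlack k = 0 \<and>
          imem s2 aQuota k = 0 \<and> imem s2 aBud k = 0" if "k < K" for k
          using s2z K(2) that by simp
        fix s3 assume c3: "(\<forall>k<K. imem s3 aMul k * L + imem s3 aRem k = load (imem s2 aNode) k \<and>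
            imem s3 aRem k < L \<and> products s3 k) \<and>
          (\<forall>c<K. imem s3 aBud c = label_count (imem s2 aRoot) (imem s2 aNode) c mod L) \<and>
          (\<forall>v<n. imem s3 aPos v = imem s2 aNode v)" and f3: "frame count_nodes s2 s3"
        have fr3: "imem s3 a = imem s2 a" if "a \<in> {aNum, aFac, aPar, aRoot, aNode, aHome, aAcc, oAssign, aRank, aTurn, oNum, aServed}" for a
          using f3 that by (auto simp: frame_def)
        have e3: "env s3" using env_frame[OF e2 f3] by simp
        have "flow K (imem s2 aFac) (imem s2 aPar) (imem s2 aRoot) (imem s2 aNode) (imem s2 aHome) K
          (imem s3 aMul) (imem s3 aRem) (imem s3 aAcc) (imem s3 aBud) (imem s3 aPos)"
          by (rule flow_init[OF F A]) (use c3 cl_less s2z K(2) fr3 in auto)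
        then have fl3: "is_flow (imem s3 aNum 0) s3" using c3 fr3 K by (simp add: is_flow_def)
        have g3: "is_grown s3" using g2 fr3 by (simp add: is_grown_def)
        have K3: "imem s3 aNum 0 \<le> n" using K fr3 by simp
        show "wlp balance (wlp prefix (wlp deal ?Q)) s3"
        proof (rule wlp_frame[OF balance_spec[OF e3 g3 K3 fl3]])
          fix s4 assume fl4: "is_flow 0 s4" and f4: "frame balance s3 s4"
          have e4: "env s4" using env_frame[OF e3 f4] by simp
          have fr4: "imem s4 a = imem s2 a" if "a \<in> {aNum, aFac, aPar, aRoot, aNode, aHome, oAssign, aRank, aTurn, oNum, aServed}" for a
            using f4 fr3[of a] that by (auto simp: frame_def)
          have n4: "imem s4 oNum 0 = 0" "imem s4 aNum 0 = K" using fr4 s2z' K by simp_all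
          have fl: "flow K (imem s2 aFac) (imem s2 aPar) (imem s2 aRoot) (imem s2 aNode) (imem s2 aHome) 0
            (imem s4 aMul) (imem s4 aRem) (imem s4 aAcc) (imem s4 aBud) (imem s4 aPos)" "\<forall>k<K. products s4 k"
            using fl4 fr4 K by (simp_all add: is_flow_def)
          note D = flowD[OF fl(1)]
          have posK: "\<forall>v\<in>cl. imem s4 aPos v \<le> K" using D(1) by (simp add: good_pos_def)
          show "wlp prefix (wlp deal ?Q) s4"
          proof (rule wlp_frame[OF prefix_spec[OF e4 n4 K(2)]])
            fix s5 assume p5: "imem s5 oNum 0 = (\<Sum>k<K. imem s4 aMul k) \<and> (\<forall>k<K. imem s5 aBase k = (\<Sum>l<k. imem s4 aMul l))"
              and f5: "frame prefix s4 s5"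
            have e5: "env s5" using env_frame[OF e4 f5] by simp
            have fr5: "imem s5 a = imem s4 a" if "a \<in> {aNum, aFac, aPos, aMul, aSlack, aQuota, oAssign, aRank, aTurn, aServed}" for a
              using f5 that by (auto simp: frame_def)
            have K5: "imem s5 aNum 0 = K" using fr5 n4 by simp
            show "wlp deal ?Q s5"
            proof (rule wlp_frame[OF deal_spec[OF e5 K5]])
              show "\<forall>v\<in>cl. imem s5 aPos v \<le> K" using posK fr5 by simp
              show "\<forall>k<K. products s5 k" using fl(2) fr5 by (simp add: products_def)
              show "\<forall>k<K. imem s5 aBase k = (\<Sum>l<k. imem s5 aMul l)" "imem s5 oNum 0 = (\<Sum>k<K. imem s5 aMul k)"
                using p5 fr5 by simp_all
              show "\<forall>v<n. imem s5 oAssign v = 0 \<and> imem s5 aRank v = 0 \<and> imem s5 aTurn v = 0" "imem s5 aServed 0 = 0"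
                using fr5 fr4 s2z s2z' by simp_all
              show "K \<le> n" by fact
              fix s6 assume d6: "is_dealt K (imem s5 aFac) (imem s5 aPos) (imem s5 aMul) (output n s6) \<and>
                imem s6 aServed 0 = card (served (output n s6))" and f6: "frame deal s5 s6"
              have d: "is_dealt K (imem s2 aFac) (imem s4 aPos) (imem s4 aMul) (output n s6)"
                using d6 fr5 fr4 by simp
              have cs: "card (served (output n s6)) = (\<Sum>k<K. min (load (imem s4 aPos) k) (imem s4 aMul k * U))"
                by (rule dealt_card(1)[OF posK d])
              have mL: "imem s4 aMul k * L \<le> load (imem s4 aPos) k" if "k < K" for k using D(4)[OF that] by simp
              \<comment> \<open>Each copy accounts for at least one served client, so there are at
                most \<open>n\<close> copies and a loop to \<open>n\<close> can copy all
                centers.\<close>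
              have "(\<Sum>k<K. imem s4 aMul k) \<le> (\<Sum>k<K. min (load (imem s4 aPos) k) (imem s4 aMul k * U))"
              proof (rule sum_mono)
                fix k assume "k \<in> {..<K}"
                then have "imem s4 aMul k * L \<le> load (imem s4 aPos) k" using mL by simp
                moreover have "imem s4 aMul k * L \<le> imem s4 aMul k * U" using L_le by simp
                moreover have "imem s4 aMul k \<le> imem s4 aMul k * L" using L_pos by simp
                ultimately show "imem s4 aMul k \<le> min (load (imem s4 aPos) k) (imem s4 aMul k * U)"
                  by linarith
              qed
              also have "\<dots> \<le> card {..<n}"
                unfolding cs[symmetric] by (rule card_mono) (auto simp: output_def)
              finally have num: "imem s6 oNum 0 \<le> n" using p5 f6 by (simp add: frame_def)
              have feas: "feasible I (output n s6) \<and> cost I (output n s6) \<le> 5 * r" if t: "target I \<le> imem s6 aServed 0"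
              proof -
                have t: "target I \<le> card (served (output n s6))" using t d6 by simp
                have l: "lower I \<le> L" using Lmax by simp
                show ?thesis using dealt_feasible[OF F D(1) mL d t l] by blast
              qed
              have "card (served S) \<le> imem s6 aServed 0" if S: "feasible I S" "cost I S \<le> r" for S
              proof -
                have "\<And>g. valid g \<Longrightarrow> \<exists>v\<in>ball g. 0 < imem s2 aHome v" using g2 by blast
                from card_served_le[OF G this S Lmax] flow_served[OF F fl(1)] show ?thesis
                  using cs d6 by linarith
              qed
              then show "?Q s6" using d6 num feas by blast
            qed
          qed
        qed
      qed
    qed
    then show "wlp (setsc aNum (IConst 0)) (wlp (setsc oNum (IConst 0)) (wlp (setsc aServed (IConst 0))
      (wlp grow (wlp count_nodes (wlp balance (wlp prefix (wlp deal ?Q))))))) s0"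
      by (simp add: s1_def)
  qed
qed

end

section \<open>Search over all thresholds\<close>

definition "attempt = Block [
  RSet 1 (IConst 0) (RGet 0 (IAdd (IGet aRow (sc iRow)) (sc iCol))),
  When (BNot (BAnd (nz (sc aFound)) (BNot (RLess (RGet 1 (IConst 0)) (RGet 2 (IConst 0)))))) (Block [
    solve,
    When (BNot (ILess (sc aServed) (IGet 0 (IConst 3)))) (Block [
      setsc aFound (IConst (Suc 0)), RSet 2 (IConst 0) (RGet 1 (IConst 0)), publish])])]"

definition "prepare = Block [
  setsc aLow (IGet 0 (IConst (Suc 0))),
  When (BNot (nz (sc aLow))) (setsc aLow (IConst (Suc 0))),
  setsc aOff (IConst 0),
  For iRow (Block [ISet aRow (sc iRow) (sc aOff), setsc aOff (IAdd (sc aOff) (IGet 0 (IConst 0)))]),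
  setsc aFound (IConst 0)]"

text \<open>With \<open>lower I \<le> upper I\<close>, the guard gives
  \<open>max 1 (lower I) \<le> upper I\<close>. If it fails on a feasible instance, the target is 0
  and the initial memory already encodes an optimal solution, the empty one.\<close>

definition "supplier_program = When (BAnd (nz (IGet 0 (IConst 3))) (nz (IGet 0 (IConst 2))))
  (Seq prepare (For iRow (For iCol attempt)))"

lemma writes_attempt: "writes attempt \<inter> {0, 1, 2, aRow, aLow, iRow, iCol} = {}" "real_writes attempt = {1, 2}"
  using writes_solve_disjoint by (auto simp: attempt_def)

lemma tame_supplier_program: "tame supplier_program"
proof -
  have "tame solve"
    unfolding solve_def clear_def grow_def select_def scan_def add_node_def mark_def spread_def spread_ball_def
      count_nodes_def carry_def balance_def flow_node_def flow_exchange_def move_def prefix_def deal_def serve_def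
    by (auto intro!: tame.intros)
  then have "tame attempt"
    unfolding attempt_def publish_def by (auto intro!: tame.intros)
  then show ?thesis
    using writes_attempt(1) unfolding supplier_program_def prepare_def by (auto intro!: tame.intros)
qed

lemma solution_cong:
  assumes "served S = served S'" "centers S = centers S'" "\<And>v. v \<in> served S' \<Longrightarrow> assign S v = assign S' v"
  shows "feasible I S = feasible I S'" "cost I S = cost I S'"
proof -
  have "{v \<in> served S. assign S v = i} = {v \<in> served S'. assign S' v = i}" for i using assms by auto
  then show "feasible I S = feasible I S'" using assms by (simp add: feasible_def)
  have "(\<lambda>v. distance I v (centers S ! assign S v)) ` served S = (\<lambda>v. distance I v (centers S' ! assign S' v)) ` served S'"
    using assms by (intro image_cong) auto
  then show "cost I S = cost I S'" using assms(1) by (simp add: cost_def)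
qed

text \<open>Only feasibility and cost are compared, because the two records may differ in
  \<open>assign\<close> on points that are not served.\<close>

lemma publish_spec:
  assumes n: "card (points I) = imem s 0 0" and num: "imem s oNum 0 \<le> imem s 0 0"
  shows "wlp publish (\<lambda>t. feasible I (solution_of I t) = feasible I (output (imem s 0 0) s) \<and>
    cost I (solution_of I t) = cost I (output (imem s 0 0) s)) s"
  unfolding publish_def
  apply simp
  apply (rule wlp_For[where J = "\<lambda>i t. \<forall>v<i. imem t 4 v = imem s oCenters v \<and> imem t 5 v = imem s oAssign v"])
       apply (simp_all)[4]
  subgoal premises prems for i t
  proof -
    have "imem t oCenters = imem s oCenters" "imem t oAssign = imem s oAssign"
      using prems(4) by (simp_all add: frame_def)
    then show ?thesis using prems(2,3) by (simp add: less_Suc_eq)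
  qed
  subgoal premises prems for t
  proof -
    have 3: "imem t 3 0 = imem s oNum 0" using prems(2) by (simp add: frame_def)
    have "served (solution_of I t) = served (output (imem s 0 0) s)"
      using prems(1) n by (auto simp: solution_of_def output_def)
    moreover have "centers (solution_of I t) = centers (output (imem s 0 0) s)"
      using prems(1) num 3 by (simp add: solution_of_def output_def)
    moreover have "assign (solution_of I t) v = assign (output (imem s 0 0) s) v" if "v \<in> served (output (imem s 0 0) s)" for v
      using prems(1) that by (simp add: solution_of_def output_def)
    ultimately show ?thesis using solution_cong by blast
  qed
  done

definition loaded :: "nat supplier \<Rightarrow> state \<Rightarrow> bool" where
  "loaded I s \<longleftrightarrow> (let n = card (points I) in
     imem s 0 0 = n \<and> imem s 0 2 = upper I \<and> imem s 0 3 = target I \<and>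
     (\<forall>v<n. 0 < imem s 1 v \<longleftrightarrow> v \<in> clients I) \<and> (\<forall>f<n. 0 < imem s 2 f \<longleftrightarrow> f \<in> facilities I) \<and>
     (\<forall>v<n. imem s aRow v = v * n) \<and> imem s aLow 0 = max 1 (lower I) \<and>
     (\<forall>i<n * n. rmem s 0 i = distance I (i div n) (i mod n)))"

lemma loaded_frame:
  assumes "loaded I s" "frame c s s'" "writes c \<inter> {0, 1, 2, aRow, aLow} = {}" "0 \<notin> real_writes c"
  shows "loaded I s'"
proof -
  have "imem s' a = imem s a" if "a \<in> {0, 1, 2, aRow, aLow}" for a
  proof -
    have "a \<notin> writes c" using assms(3) that by blast
    then show ?thesis using assms(2) by (simp add: frame_def)
  qed
  moreover have "rmem s' 0 = rmem s 0" using assms(2,4) by (simp add: frame_def)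
  ultimately show ?thesis using assms(1) by (simp add: loaded_def)
qed

lemma loaded_distance:
  assumes "loaded I s" "i < card (points I)" "j < card (points I)"
  shows "rmem s 0 (imem s aRow i + j) = distance I i j"
proof -
  define n where "n = card (points I)"
  have ij: "i < n" "j < n" using assms by (simp_all add: n_def)
  then have "i * n + n \<le> n * n" using mult_le_mono1[of "Suc i" n n] by simp
  then have "i * n + j < n * n" using ij by linarith
  moreover have "imem s aRow i = i * n" using assms(1) ij by (simp add: loaded_def Let_def n_def)
  ultimately show ?thesis using assms(1) ij by (simp add: loaded_def Let_def n_def[symmetric])
qed

definition "reachable I \<rho> \<longleftrightarrow> (\<exists>S. feasible I S \<and> cost I S \<le> \<rho>)"

text \<open>\<open>A\<close> collects the index pairs already tried, and \<open>rmem s 2 0\<close>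
  is the threshold of the stored solution. For a positive target the optimum is among the distances,
  so once all pairs are tried the stored threshold is at most the optimum.\<close>

definition search_inv :: "nat supplier \<Rightarrow> (nat \<times> nat) set \<Rightarrow> state \<Rightarrow> bool" where
  "search_inv I A s \<longleftrightarrow> loaded I s \<and>
     (\<forall>(i, j)\<in>A. reachable I (distance I i j) \<longrightarrow> 0 < imem s aFound 0 \<and> rmem s 2 0 \<le> distance I i j) \<and>
     (0 < imem s aFound 0 \<longrightarrow> feasible I (solution_of I s) \<and> cost I (solution_of I s) \<le> 5 * rmem s 2 0)"

lemma search_inv_iset [simp]:
  "a \<notin> {0, 1, 2, 3, 4, 5, aRow, aLow, aFound} \<Longrightarrow> search_inv I A (iset a i x s) = search_inv I A s"
  by (auto simp: search_inv_def loaded_def Let_def solution_of_def)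

lemma solution_of_cong:
  assumes "imem s 3 = imem t 3" "imem s 4 = imem t 4" "imem s 5 = imem t 5"
  shows "solution_of I s = solution_of I t"
  using assms by (simp add: solution_of_def)

lemma attempt_spec:
  assumes I: "numbered_instance I" and U: "0 < upper I"
    and inv: "search_inv I A s" and i: "imem s iRow 0 = i" "i < card (points I)" and j: "imem s iCol 0 = j" "j < card (points I)"
  shows "wlp attempt (search_inv I (insert (i, j) A)) s"
proof -
  define n where "n = card (points I)"
  define r where "r = distance I i j"
  define L where "L = max 1 (lower I)"
  have si: "supplier_instance I" and pts: "points I = {..<n}"
    using I unfolding numbered_instance_def n_def by blast+
  have "i < n" "j < n" using i j by (simp_all add: n_def)
  then have "i \<in> points I" "j \<in> points I" unfolding pts by simp_all
  then have r0: "0 \<le> r" using si unfolding supplier_instance_def r_def by blast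
  have LU: "L \<le> upper I" using si U by (simp add: supplier_instance_def L_def)
  \<comment> \<open>\<open>r\<close> is a distance, hence nonnegative, and
    \<open>0 < upper I\<close> gives \<open>L \<le> upper I\<close>.\<close>
  interpret run I L r n
    by unfold_locales (use si LU r0 pts in \<open>simp_all add: L_def\<close>)
  define s1 where "s1 = rset 1 0 r s"
  have ls: "loaded I s" using inv by (simp add: search_inv_def)
  have w: "wlp attempt Q s = wlp (When (BNot (BAnd (nz (sc aFound)) (BNot (RLess (RGet 1 (IConst 0)) (RGet 2 (IConst 0)))))) (Block [
    solve,
    When (BNot (ILess (sc aServed) (IGet 0 (IConst 3)))) (Block [
      setsc aFound (IConst (Suc 0)), RSet 2 (IConst 0) (RGet 1 (IConst 0)), publish])])) Q s1" for Q
    unfolding attempt_def s1_def using loaded_distance[OF ls i(2) j(2)] i(1) j(1) by (simp add: r_def)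
  have l1: "loaded I s1" using ls by (simp add: loaded_def s1_def)
  have e1: "env s1" unfolding env_def using l1 by (simp add: loaded_def Let_def n_def L_def s1_def)
  have i1: "search_inv I A s1" using inv l1 by (simp add: search_inv_def s1_def solution_of_def)
  have s1r: "rmem s1 1 0 = r" by (simp add: s1_def)
  show ?thesis
  proof (cases "0 < imem s1 aFound 0 \<and> \<not> r < rmem s1 2 0")
    case True
    then have "search_inv I (insert (i, j) A) s1" using i1 by (auto simp: search_inv_def r_def)
    then show ?thesis unfolding w using True s1r by simp
  next
    case False
    have "wlp solve (wlp (When (BNot (ILess (sc aServed) (IGet 0 (IConst 3)))) (Block [
      setsc aFound (IConst (Suc 0)), RSet 2 (IConst 0) (RGet 1 (IConst 0)), publish])) (search_inv I (insert (i, j) A))) s1"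
    proof (rule wlp_frame[OF solve_spec[OF e1 L_def]])
      fix t assume t: "imem t aServed 0 = card (served (output n t)) \<and> imem t oNum 0 \<le> n \<and>
        (target I \<le> imem t aServed 0 \<longrightarrow> feasible I (output n t) \<and> cost I (output n t) \<le> 5 * r) \<and>
        (\<forall>S. feasible I S \<and> cost I S \<le> r \<longrightarrow> card (served S) \<le> imem t aServed 0)" and ft: "frame solve s1 t"
      have fr: "imem t a = imem s1 a" if "a \<in> {0, 1, 2, 3, 4, 5, aRow, aLow, aFound}" for a
      proof -
        have "a \<notin> writes solve" using writes_solve_disjoint that by blast
        then show ?thesis using ft by (simp add: frame_def)
      qed
      have rt: "rmem t = rmem s1" using ft by (auto simp: frame_def)
      have lt: "loaded I t" using loaded_frame[OF l1 ft] writes_solve_disjoint by auto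
      have tg: "imem t 0 3 = target I" "imem t 0 0 = n" using lt by (simp_all add: loaded_def Let_def n_def)
      show "wlp (When (BNot (ILess (sc aServed) (IGet 0 (IConst 3)))) (Block [
        setsc aFound (IConst (Suc 0)), RSet 2 (IConst 0) (RGet 1 (IConst 0)), publish])) (search_inv I (insert (i, j) A)) t"
      proof (cases "imem t aServed 0 < target I")
        case True
        \<comment> \<open>A solution of value at most \<open>r\<close> would serve at least the
          target but at most \<open>aServed\<close> clients.\<close>
        have "\<not> reachable I r"
        proof
          assume "reachable I r"
          then obtain S where S: "feasible I S" "cost I S \<le> r" by (auto simp: reachable_def)
          then have "card (served S) \<le> imem t aServed 0" using t by blast
          then show False using S(1) True by (simp add: feasible_def)
        qed
        moreover have "solution_of I t = solution_of I s1" by (rule solution_of_cong) (use fr in simp_all)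
        ultimately have "search_inv I (insert (i, j) A) t"
          using i1 lt fr rt by (simp add: search_inv_def r_def)
        then show ?thesis using True tg by simp
      next
        case False
        define u where "u = rset 2 0 r (iset aFound 0 (Suc 0) t)"
        have out: "output n u = output n t" by (simp add: u_def output_def)
        have un: "card (points I) = imem u 0 0" "imem u oNum 0 \<le> imem u 0 0" using tg t by (simp_all add: u_def n_def)
        have lu: "loaded I u" using lt by (simp add: u_def loaded_def)
        have "wlp publish (search_inv I (insert (i, j) A)) u"
        proof (rule wlp_frame[OF publish_spec[OF un]])
          fix y assume y: "feasible I (solution_of I y) = feasible I (output (imem u 0 0) u) \<and>
            cost I (solution_of I y) = cost I (output (imem u 0 0) u)" and fy: "frame publish u y"
          have "imem u 0 0 = n" using un by (simp add: n_def)
          then have sol: "feasible I (solution_of I y)" "cost I (solution_of I y) \<le> 5 * r"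
            using y t False out by simp_all
          have fry: "imem y aFound 0 = 1" "rmem y 2 0 = r" using fy by (simp_all add: frame_def u_def)
          \<comment> \<open>Either nothing was found before, so no earlier pair is reachable, or
            \<open>r\<close> is smaller than the stored threshold, which bounds the reachable
            earlier distances from below.\<close>
          have "r \<le> distance I a b" if "(a, b) \<in> A" "reachable I (distance I a b)" for a b
            using i1 that \<open>\<not> (0 < imem s1 aFound 0 \<and> \<not> r < rmem s1 2 0)\<close> unfolding search_inv_def by fastforce
          moreover have "loaded I y" using loaded_frame[OF lu fy] by simp
          ultimately show "search_inv I (insert (i, j) A) y"
            using sol fry by (auto simp: search_inv_def r_def)
        qed
        then show ?thesis using False tg rt s1r by (simp add: u_def)
      qed
    qed
    then show ?thesis unfolding w using False s1r by simp
  qed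
qed

lemma prepare_spec:
  assumes I: "numbered_instance I"
  shows "wlp prepare (\<lambda>t. search_inv I {} t) (initial_state I)"
proof -
  define n where "n = card (points I)"
  define s where "s = initial_state I"
  define s1 where "s1 = iset aOff 0 0 (iset aLow 0 (max 1 (lower I)) s)"
  have init: "imem s 0 0 = n" "imem s 0 (Suc 0) = lower I" "imem s 0 2 = upper I" "imem s 0 3 = target I"
    by (simp_all add: s_def initial_state_def Let_def n_def numeral_eq_Suc)
  have w: "wlp prepare Q s = wlp (For iRow (Block [ISet aRow (sc iRow) (sc aOff),
      setsc aOff (IAdd (sc aOff) (IGet 0 (IConst 0)))])) (wlp (setsc aFound (IConst 0)) Q) s1" for Q
  proof (cases "lower I")
    case 0
    then show ?thesis unfolding prepare_def s1_def using init 0 by simp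
  next
    case (Suc k)
    then show ?thesis unfolding prepare_def s1_def using init by simp
  qed
  have "wlp prepare (search_inv I {}) s"
    unfolding w
    apply (rule wlp_For[where J = "\<lambda>i t. imem t aOff 0 = i * n \<and> (\<forall>v<i. imem t aRow v = v * n)"])
         apply (simp_all add: s1_def)[4]
    subgoal premises prems for i t
    proof -
      have "imem t 0 0 = n" using prems(4) init by (simp add: frame_def s1_def)
      then show ?thesis using prems(2,3) by (auto simp: less_Suc_eq)
    qed
    subgoal premises prems for t
    proof -
      have fr: "imem t a = imem s1 a" if "a \<notin> {aRow, aOff, iRow}" for a
        using prems(2) that by (auto simp: frame_def)
      have rt: "rmem t = rmem s" using prems(2) by (auto simp: frame_def s1_def)
      have n1: "imem s1 0 0 = n" using init by (simp add: s1_def)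
      have "loaded I (iset aFound 0 0 t)"
        using prems(1) fr init rt unfolding n1 loaded_def n_def[symmetric] Let_def
        by (auto simp: s1_def s_def initial_state_def Let_def n_def)
      then show ?thesis by (simp add: search_inv_def)
    qed
    done
  then show ?thesis by (simp add: s_def)
qed

lemma search_spec:
  assumes I: "numbered_instance I" and U: "0 < upper I" and inv: "search_inv I {} s"
  shows "wlp (For iRow (For iCol attempt)) (search_inv I ({..<card (points I)} \<times> {..<card (points I)})) s"
proof -
  define n where "n = card (points I)"
  have w: "0 \<notin> writes attempt" "iRow \<notin> writes attempt" "iCol \<notin> writes attempt"
    using writes_attempt(1) by auto
  have l0: "imem t 0 0 = n" if "search_inv I B t" for t B
    using that by (simp add: search_inv_def loaded_def Let_def n_def)
  have s0: "imem s 0 0 = n" using l0[OF inv] .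
  show ?thesis
    unfolding n_def[symmetric]
    apply (rule wlp_For[where J = "\<lambda>i. search_inv I ({..<i} \<times> {..<n})"])
    using w inv apply (simp_all)[4]
    subgoal premises prems for i t
      apply (rule wlp_For[where J = "\<lambda>j. search_inv I ({..<i} \<times> {..<n} \<union> {i} \<times> {..<j})"])
      using w prems apply (simp_all)[4]
      subgoal premises p2 for j u
      proof -
        have ij: "i < n" "j < n" using prems(1) p2(1) l0[OF prems(2)] s0 by simp_all
        have ir: "imem u iRow 0 = i" using p2(4) prems(3) w by (simp add: frame_def)
        have "insert (i, j) ({..<i} \<times> {..<n} \<union> {i} \<times> {..<j}) = {..<i} \<times> {..<n} \<union> {i} \<times> {..<Suc j}" by auto
        then show ?thesis
          using attempt_spec[OF I U p2(2) ir _ p2(3)] ij by (simp add: n_def)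
      qed
      subgoal premises p2 for u
      proof -
        have "{..<i} \<times> {..<n} \<union> {i} \<times> {..<n} = {..<Suc i} \<times> {..<n}" by auto
        then show ?thesis using p2(1) l0[OF prems(2)] by simp
      qed
      done
    subgoal for t
      using s0 by simp
    done
qed

text \<open>With a positive target some client is served, so the value is the maximum of a nonempty
  finite set of distances. Trying all pairs therefore hits the optimum.\<close>

lemma optimum_is_distance:
  assumes I: "numbered_instance I" and S: "feasible I S" "cost I S = \<rho>" and t: "0 < target I"
  shows "\<exists>i<card (points I). \<exists>j<card (points I). \<rho> = distance I i j"
proof -
  define n where "n = card (points I)"
  have pts: "points I = {..<n}" and fin: "finite (clients I)"
    using I unfolding numbered_instance_def supplier_instance_def n_def by blast+
  have "0 < card (served S)" using S(1) t by (auto simp: feasible_def)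
  then have ne: "served S \<noteq> {}" and f: "finite (served S)" by (auto simp: card_gt_0_iff)
  let ?D = "(\<lambda>v. distance I v (centers S ! assign S v)) ` served S"
  have "\<rho> = Max ?D" using S(2) ne by (simp add: cost_def)
  then have "\<rho> \<in> ?D" using Max_in[of ?D] f ne by simp
  then obtain v where v: "v \<in> served S" "\<rho> = distance I v (centers S ! assign S v)" by blast
  have "v \<in> clients I" "centers S ! assign S v \<in> facilities I"
    using S(1) v(1) nth_mem[of "assign S v" "centers S"] unfolding feasible_def by blast+
  then have "v < n" "centers S ! assign S v < n" using pts by auto
  then show ?thesis using v(2) unfolding n_def by blast
qed

lemma supplier_program_correct:
  assumes I: "numbered_instance I" and ex: "\<exists>S. feasible I S"
  shows "wlp supplier_program (\<lambda>t. feasible I (solution_of I t) \<and> cost I (solution_of I t) \<le> 5 * optimum I) (initial_state I)"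
proof -
  have si: "supplier_instance I" using I by (simp add: numbered_instance_def)
  obtain S where S: "feasible I S" "cost I S = optimum I"
    using optimum_attained[OF si ex] by blast
  have init: "imem (initial_state I) 0 2 = upper I" "imem (initial_state I) 0 3 = target I"
    by (simp_all add: initial_state_def Let_def numeral_eq_Suc)
  show ?thesis
  proof (cases "0 < target I \<and> 0 < upper I")
    case True
    then obtain i j where ij: "i < card (points I)" "j < card (points I)" "optimum I = distance I i j"
      using optimum_is_distance[OF I S] by blast
    have "wlp (Seq prepare (For iRow (For iCol attempt)))
      (\<lambda>t. feasible I (solution_of I t) \<and> cost I (solution_of I t) \<le> 5 * optimum I) (initial_state I)"
      unfolding wlp_Seq
    proof (rule wlp_frame[OF prepare_spec[OF I]])
      fix s assume "search_inv I {} s"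
      then show "wlp (For iRow (For iCol attempt))
        (\<lambda>t. feasible I (solution_of I t) \<and> cost I (solution_of I t) \<le> 5 * optimum I) s"
      proof (rule wlp_frame[OF search_spec[OF I conjunct2[OF True]]])
        fix t assume t: "search_inv I ({..<card (points I)} \<times> {..<card (points I)}) t"
        have "reachable I (distance I i j)" using S ij(3) by (auto simp: reachable_def)
        then have "0 < imem t aFound 0 \<and> rmem t 2 0 \<le> optimum I"
          using t ij unfolding search_inv_def by fastforce
        then show "feasible I (solution_of I t) \<and> cost I (solution_of I t) \<le> 5 * optimum I"
          using t by (auto simp: search_inv_def)
      qed
    qed
    then show ?thesis unfolding supplier_program_def using True init by simp
  next
    case False
    have sol: "solution_of I (initial_state I) = \<lparr>served = {}, centers = [], assign = (\<lambda>v. 0)\<rparr>"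
      by (simp add: solution_of_def initial_state_def Let_def)
    \<comment> \<open>If \<open>upper I = 0\<close>, all copies are empty, so a feasible solution
      serves nobody and the target must be 0.\<close>
    have "target I = 0"
    proof (cases "0 < target I")
      case True
      then have U: "upper I = 0" using False by simp
      have fin: "finite (served S)" using S(1) si unfolding feasible_def supplier_instance_def by (meson finite_subset)
      have "served S = {}"
      proof (rule ccontr)
        assume "served S \<noteq> {}"
        then obtain v where v: "v \<in> served S" by blast
        then have "card {w \<in> served S. assign S w = assign S v} = 0" using S(1) U by (auto simp: feasible_def)
        then show False using v fin by auto
      qed
      then show ?thesis using S(1) by (simp add: feasible_def)
    qed simp
    moreover have "0 \<le> optimum I"
    proof (cases "served S = {}")
      case True
      then show ?thesis using S(2) by (simp add: cost_def)
    next
      case False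
      have fin: "finite (served S)" using S(1) si unfolding feasible_def supplier_instance_def by (meson finite_subset)
      obtain v where v: "v \<in> served S" using False by blast
      have "v \<in> clients I" "centers S ! assign S v \<in> facilities I"
        using S(1) v nth_mem[of "assign S v" "centers S"] unfolding feasible_def by blast+
      then have "0 \<le> distance I v (centers S ! assign S v)"
        using si unfolding supplier_instance_def by blast
      also have "\<dots> \<le> cost I S" using False fin v by (simp add: cost_def)
      finally show ?thesis using S(2) by simp
    qed
    ultimately show ?thesis
      unfolding supplier_program_def using False init by (auto simp: sol feasible_def cost_def)
  qed
qed

text \<open>The time bound provides a halting run, and partial correctness then applies to that very
  run.\<close>

theorem theorem8:
  "\<exists>c :: com. polynomial_time c \<and> approximation_algorithm 5 c"
proof (intro exI conjI)
  show poly: "polynomial_time supplier_program"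
    by (rule tame_polynomial_time[OF tame_supplier_program])
  show "approximation_algorithm 5 supplier_program"
    unfolding approximation_algorithm_def
  proof (intro allI impI)
    fix I :: "nat supplier" assume I: "numbered_instance I \<and> (\<exists>S. feasible I S)"
    obtain t s where e: "exec supplier_program (initial_state I) t s"
      using poly I unfolding polynomial_time_def by blast
    then show "\<exists>t s. exec supplier_program (initial_state I) t s \<and> feasible I (solution_of I s) \<and>
        cost I (solution_of I s) \<le> 5 * optimum I"
      using supplier_program_correct I unfolding wlp_def by blast
  qed
qed

end
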